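(* Let $0<\alpha\le1$ and let $\{X_{i,k}:i\ge0,k\ge1\}$ be independent real random variables with mean zero, variance one and $\sup_{i,k}\mathbb E|X_{i,k}|^l<\infty$ for each $l\ge3$, independent of the fractional Poisson process $N^\alpha$. Let $L^1(i,j)=(j-i+n)\bmod n$, $1\le i,j\le n$, and define the circulant matrices $$C_n(t)=((S^{(n)}_{L^1(i,j)}(t)))_{1\le i,j\le n},\qquad C_n^\alpha(t)=((\mathcal S^\alpha_{L^1(i,j),n}(t)))_{1\le i,j\le n},\qquad t\ge0,$$ where $S^{(n)}_i(t)=\sum_{k=1}^{[nt]}X_{i,k}$ and $\mathcal S^\alpha_{i,n}(t)=\sum_{k=1}^{N^\alpha(nt)}X_{i,k}$. Then, as $n\to\infty$, $\{n^{-1}C_n(t)\}_{t\ge0}$ and $\{n^{-(1+\alpha)/2}C_n^\alpha(t)\}_{t\ge0}$ converge algebraically (that is, in $*$-distribution) respectively to the complex Brownian motion $\{CBM(t)\}_{t\ge0}$ and the time-changed complex Brownian motion $\{CBM^\alpha(t)\}_{t\ge0}$.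
   Context: $[x]$ is the greatest integer $\le x$. $\{H^\alpha(t)\}_{t\ge0}$ is an $\alpha$-stable subordinator ($0<\alpha<1$): non-decreasing Lévy process with $\mathbb Ee^{-uH^\alpha(t)}=e^{-tu^\alpha}$, $u>0$. Its inverse is $L^\alpha(t)=\inf\{s\ge0:H^\alpha(s)\ge t\}$, and $L^\alpha(t)=t$ when $\alpha=1$. The fractional Poisson process is $N^\alpha(t)=N(L^\alpha(t))$, with $N$ a Poisson process of rate one independent of $L^\alpha$. (The process $L^\alpha$ is not to be confused with the link function $L^1$.) $CBM(t)=(B_1(t)+\iota B_2(t))/\sqrt2$ with $B_1,B_2$ independent standard (classical) Brownian motions and $\iota=\sqrt{-1}$; $CBM^\alpha(t)=CBM(L^\alpha(t))$ with $L^\alpha$ independent of $CBM$. Convergence in $*$-distribution of real matrix processes $M_n(t)$, regarded in the $*$-probability space of random $n\times n$ matrices (entries with all moments finite) with state $n^{-1}\mathbb E\,\mathrm{Trace}$, to a complex-valued process $M(t)$ means: for all $q\ge 1$, $t_1,\dots,t_q\ge0$ and every polynomial $g$ in $2q$ non-commuting variables, $n^{-1}\mathbb E\,\mathrm{Trace}\,g(M_n(t_1),M_n(t_1)^T,\dots,M_n(t_q),M_n(t_q)^T)\to\mathbb E\,g(M(t_1),\overline{M(t_1)},\dots,M(t_q),\overline{M(t_q)})$. *)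

theory Defs
  imports
    "HOL-Probability.Probability"
    "HOL-Library.Poly_Mapping"
    "Jordan_Normal_Form.Matrix"
begin

definition process_algebra ::
  "'a measure \<Rightarrow> 'i set \<Rightarrow> ('i \<Rightarrow> 'a \<Rightarrow> 'b::topological_space) \<Rightarrow> 'a set set" where
  "process_algebra M I Z =
     sigma_sets (space M) (\<Union>i\<in>I. {Z i -` A \<inter> space M | A. A \<in> sets borel})"

definition independent_processes ::
  "'a measure \<Rightarrow> 'i set \<Rightarrow> ('i \<Rightarrow> 'a \<Rightarrow> 'b::topological_space)
     \<Rightarrow> 'j set \<Rightarrow> ('j \<Rightarrow> 'a \<Rightarrow> 'c::topological_space) \<Rightarrow> bool" where
  "independent_processes M I Y J Z \<longleftrightarrow>
     prob_space.indep_set M (process_algebra M I Y) (process_algebra M J Z)"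

text \<open>Time is the half-line \<open>{0..}\<close>; values at negative arguments are irrelevant.
  Path regularity is required on the whole sample space, i.e. one works with regular
  versions. This makes time-changed processes such as \<open>N(L(t))\<close> measurable
  without completing the probability space.\<close>

definition levy_process :: "'a measure \<Rightarrow> (real \<Rightarrow> 'a \<Rightarrow> real) \<Rightarrow> bool" where
  "levy_process M Z \<longleftrightarrow>
     (\<forall>t\<ge>0. Z t \<in> borel_measurable M) \<and>
     (AE \<omega> in M. Z 0 \<omega> = 0) \<and>
     (\<forall>n (ts :: nat \<Rightarrow> real). 0 \<le> ts 0 \<longrightarrow> (\<forall>k<n. ts k < ts (Suc k)) \<longrightarrow>
        prob_space.indep_vars M (\<lambda>_. borel) (\<lambda>k \<omega>. Z (ts (Suc k)) \<omega> - Z (ts k) \<omega>) {..<n}) \<and>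
     (\<forall>s\<ge>0. \<forall>t\<ge>0. distr M borel (\<lambda>\<omega>. Z (s + t) \<omega> - Z s \<omega>) = distr M borel (Z t)) \<and>
     (\<forall>\<omega>\<in>space M. \<forall>t\<ge>0. continuous (at_right t) (\<lambda>s. Z s \<omega>)) \<and>
     (\<forall>\<omega>\<in>space M. \<forall>t>0. \<exists>l. ((\<lambda>s. Z s \<omega>) \<longlongrightarrow> l) (at_left t))"

definition brownian_motion :: "'a measure \<Rightarrow> (real \<Rightarrow> 'a \<Rightarrow> real) \<Rightarrow> bool" where
  "brownian_motion M B \<longleftrightarrow>
     levy_process M B \<and>
     (\<forall>t>0. distributed M lborel (B t) (normal_density 0 (sqrt t))) \<and>
     (\<forall>\<omega>\<in>space M. continuous_on {0..} (\<lambda>t. B t \<omega>))"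

definition poisson_process :: "'a measure \<Rightarrow> real \<Rightarrow> (real \<Rightarrow> 'a \<Rightarrow> nat) \<Rightarrow> bool" where
  "poisson_process M r N \<longleftrightarrow>
     levy_process M (\<lambda>t \<omega>. real (N t \<omega>)) \<and>
     (\<forall>t>0. distr M (count_space UNIV) (N t) = measure_pmf (poisson_pmf (r * t)))"

definition stable_subordinator :: "'a measure \<Rightarrow> real \<Rightarrow> (real \<Rightarrow> 'a \<Rightarrow> real) \<Rightarrow> bool" where
  "stable_subordinator M \<alpha> H \<longleftrightarrow>
     levy_process M H \<and>
     (\<forall>\<omega>\<in>space M. mono_on {0..} (\<lambda>t. H t \<omega>)) \<and>
     (\<forall>t\<ge>0. \<forall>u>0. prob_space.expectation M (\<lambda>\<omega>. exp (- u * H t \<omega>)) = exp (- t * u powr \<alpha>))"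

text \<open>The infimum is over a non-empty set almost surely; on the exceptional null set,
  where \<open>Inf {}\<close> would be an unspecified real, the value is taken to be \<open>0\<close>.\<close>

definition inverse_stable :: "real \<Rightarrow> (real \<Rightarrow> 'a \<Rightarrow> real) \<Rightarrow> real \<Rightarrow> 'a \<Rightarrow> real" where
  "inverse_stable \<alpha> H t \<omega> =
     (if \<alpha> = 1 then t
      else if \<exists>s\<ge>0. H s \<omega> \<ge> t then Inf {s. 0 \<le> s \<and> H s \<omega> \<ge> t}
      else 0)"

definition time_change ::
  "(real \<Rightarrow> 'a \<Rightarrow> 'b) \<Rightarrow> (real \<Rightarrow> 'a \<Rightarrow> real) \<Rightarrow> real \<Rightarrow> 'a \<Rightarrow> 'b" where
  "time_change Z L t \<omega> = Z (L t \<omega>) \<omega>"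

definition complex_bm ::
  "(real \<Rightarrow> 'a \<Rightarrow> real) \<Rightarrow> (real \<Rightarrow> 'a \<Rightarrow> real) \<Rightarrow> real \<Rightarrow> 'a \<Rightarrow> complex" where
  "complex_bm B\<^sub>1 B\<^sub>2 t \<omega> =
     (complex_of_real (B\<^sub>1 t \<omega>) + \<i> * complex_of_real (B\<^sub>2 t \<omega>)) / complex_of_real (sqrt 2)"

text \<open>A polynomial in non-commuting variables is a finitely supported complex-valued function
  on words. The letter \<open>(i, False)\<close> stands for the \<open>i\<close>-th variable (counted from \<open>0\<close>)
  and \<open>(i, True)\<close> for its adjoint.\<close>

type_synonym nc_poly = "(nat \<times> bool) list \<Rightarrow>\<^sub>0 complex"

definition nc_poly_in :: "nat \<Rightarrow> nc_poly \<Rightarrow> bool" where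
  "nc_poly_in q g \<longleftrightarrow> (\<forall>w\<in>Poly_Mapping.keys g. set w \<subseteq> {..<q} \<times> UNIV)"

definition word_mat :: "nat \<Rightarrow> (nat \<times> bool \<Rightarrow> complex mat) \<Rightarrow> (nat \<times> bool) list \<Rightarrow> complex mat" where
  "word_mat n A w = foldr (\<lambda>v P. A v * P) w (1\<^sub>m n)"

definition nc_eval_mat :: "nat \<Rightarrow> nc_poly \<Rightarrow> (nat \<times> bool \<Rightarrow> complex mat) \<Rightarrow> complex mat" where
  "nc_eval_mat n g A = mat n n (\<lambda>(i, j).
     \<Sum>w\<in>Poly_Mapping.keys g. Poly_Mapping.lookup g w * word_mat n A w $$ (i, j))"

definition nc_eval_complex :: "nc_poly \<Rightarrow> (nat \<times> bool \<Rightarrow> complex) \<Rightarrow> complex" where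
  "nc_eval_complex g z =
     (\<Sum>w\<in>Poly_Mapping.keys g. Poly_Mapping.lookup g w * (\<Prod>v\<leftarrow>w. z v))"

definition mat_letter :: "(nat \<Rightarrow> real mat) \<Rightarrow> nat \<times> bool \<Rightarrow> complex mat" where
  "mat_letter A = (\<lambda>(i, b). map_mat complex_of_real (if b then transpose_mat (A i) else A i))"

definition complex_letter :: "(nat \<Rightarrow> complex) \<Rightarrow> nat \<times> bool \<Rightarrow> complex" where
  "complex_letter z = (\<lambda>(i, b). if b then cnj (z i) else z i)"

definition mat_trace :: "'a::comm_monoid_add mat \<Rightarrow> 'a" where
  "mat_trace A = (\<Sum>i<dim_row A. A $$ (i, i))"

definition random_matrix :: "'a measure \<Rightarrow> nat \<Rightarrow> ('a \<Rightarrow> real mat) \<Rightarrow> bool" where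
  "random_matrix M n A \<longleftrightarrow>
     (\<forall>\<omega>\<in>space M. A \<omega> \<in> carrier_mat n n) \<and>
     (\<forall>i<n. \<forall>j<n. (\<lambda>\<omega>. A \<omega> $$ (i, j)) \<in> borel_measurable M \<and>
        (\<forall>p::nat. integrable M (\<lambda>\<omega>. \<bar>A \<omega> $$ (i, j)\<bar> ^ p)))"

text \<open>Membership of the random matrices and of the limit in the respective *-probability spaces
  is part of the definition, so that every expectation in the last clause is a genuine
  integral rather than the default value \<open>0\<close> of a non-integrable function.\<close>

definition converges_star_distribution ::
  "'a measure \<Rightarrow> (nat \<Rightarrow> real \<Rightarrow> 'a \<Rightarrow> real mat) \<Rightarrow> 'b measure \<Rightarrow> (real \<Rightarrow> 'b \<Rightarrow> complex) \<Rightarrow> bool"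
where
  "converges_star_distribution M A P Z \<longleftrightarrow>
     (\<forall>n\<ge>1. \<forall>t\<ge>0. random_matrix M n (A n t)) \<and>
     (\<forall>t\<ge>0. Z t \<in> borel_measurable P \<and> (\<forall>p::nat. integrable P (\<lambda>\<omega>. cmod (Z t \<omega>) ^ p))) \<and>
     (\<forall>q\<ge>1. \<forall>ts :: nat \<Rightarrow> real. (\<forall>i<q. 0 \<le> ts i) \<longrightarrow> (\<forall>g. nc_poly_in q g \<longrightarrow>
        (\<lambda>n. prob_space.expectation M
               (\<lambda>\<omega>. mat_trace (nc_eval_mat n g (mat_letter (\<lambda>i. A n (ts i) \<omega>)))) / of_nat n)
        \<longlonglongrightarrow> prob_space.expectation P (\<lambda>\<omega>. nc_eval_complex g (complex_letter (\<lambda>i. Z (ts i) \<omega>)))))"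

text \<open>The link function is used for \<open>1 \<le> i, j \<le> n\<close>, where the natural-number
  subtraction is exact. Library matrices are indexed from \<open>0\<close>.\<close>

definition circulant_link :: "nat \<Rightarrow> nat \<Rightarrow> nat \<Rightarrow> nat" where
  "circulant_link n i j = (j + n - i) mod n"

definition circulant :: "nat \<Rightarrow> (nat \<Rightarrow> real) \<Rightarrow> real mat" where
  "circulant n s = mat n n (\<lambda>(i, j). s (circulant_link n (Suc i) (Suc j)))"

definition circulant_walk :: "(nat \<Rightarrow> nat \<Rightarrow> 'a \<Rightarrow> real) \<Rightarrow> nat \<Rightarrow> real \<Rightarrow> 'a \<Rightarrow> real mat" where
  "circulant_walk X n t \<omega> = circulant n (\<lambda>i. \<Sum>k = 1..nat \<lfloor>real n * t\<rfloor>. X i k \<omega>)"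

definition circulant_counting_walk ::
  "(nat \<Rightarrow> nat \<Rightarrow> 'a \<Rightarrow> real) \<Rightarrow> (real \<Rightarrow> 'a \<Rightarrow> nat) \<Rightarrow> nat \<Rightarrow> real \<Rightarrow> 'a \<Rightarrow> real mat" where
  "circulant_counting_walk X K n t \<omega> = circulant n (\<lambda>i. \<Sum>k = 1..K (real n * t) \<omega>. X i k \<omega>)"

end

theory Submission
  imports Defs
begin

text \<open>
  The circulant matrices of a given order are diagonalised simultaneously by the Fourier vectors, so
  the normalised trace of a word is the average over frequencies \<open>k\<close> of products of the eigenvalues
  \<open>\<lambda>\<^sub>k = (\<Sum>m<n. s m * cis (2 * pi * k * m / n))\<close> and their conjugates. By polarisation only powers
  \<open>E Y ^ r\<close> of a sum \<open>Y\<close> of such eigenvalues are needed. Given the numbers of summands, \<open>Y\<close> is a linear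
  combination of independent centred variables, so \<open>E Y ^ r\<close> agrees to leading order with the Gaussian
  moment of variance \<open>E Y\<^sup>2\<close>, which for all but at most two \<open>k\<close> is \<open>n\<close> times a sum of minima of the
  counts at two times, taken over pairs of letters of opposite type. The same formula, with the counts
  replaced by the random clock, gives the moments of the time-changed complex Brownian motion.

  It remains to pass to the limit in product moments of counts. The Poisson process \<open>N (L t)\<close> differs
  from \<open>L t\<close> by its conditional standard deviation \<open>sqrt (L t)\<close>, which is negligible; and the joint law
  of \<open>L (n * t) / n powr \<alpha>\<close> does not depend on \<open>n\<close>, since events for \<open>L\<close> are events for the subordinator,
  whose independent increments have laws determined by their Laplace transforms.
\<close>

section \<open>Gaussian moments and moments of sums of independent variables\<close>

text \<open>Convergence of moments is claimed and the counts are unbounded, so weak limits do not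
  suffice. Every error needs a constant that depends only on the word and on the moment bounds of
  the array, not on \<open>n\<close>, the frequency or the counts, because the counts are averaged
  afterwards. This dictates the comparison with Gaussian moments: a recursion in the exponent and
  the number of summands, estimated with uniform constants, in place of a central limit theorem.
  Powers of one sum obey such a recursion with a single exponent; mixed products would need one
  exponent per letter, hence the polarisation. The recursion sees only \<open>E Z ^ r\<close> and no
  absolute values, so the Gaussian competitor may have complex variance and need not exist as a
  random variable. Conjugation enters as the sign of a frequency, which keeps the eigenvalues linear
  in the entries. Independence is used through the image of the diagonal map, which turns
  conditioning on the clock into Fubini. Both assertions are one statement about a clock, known only
  through product moments of minima: the floor function with exponent 1, or \<open>N (L t)\<close>
  with exponent \<alpha>.\<close>

text \<open>The \<open>r\<close>-th moment of a (possibly complex) centred Gaussian variable \<open>Z\<close> with \<open>E Z\<^sup>2 = s\<close>.\<close>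

definition gauss_mom :: "nat \<Rightarrow> complex \<Rightarrow> complex" where
  "gauss_mom r s = (if even r then fact r / (2 ^ (r div 2) * fact (r div 2)) * s ^ (r div 2) else 0)"

lemma gauss_mom_odd: "odd r \<Longrightarrow> gauss_mom r s = 0"
  by (simp add: gauss_mom_def)

lemma gauss_mom_double: "gauss_mom (2 * m) s = fact (2 * m) / (2 ^ m * fact m) * s ^ m"
  by (simp add: gauss_mom_def)

lemma gauss_mom_0_left [simp]: "gauss_mom 0 s = 1"
  by (simp add: gauss_mom_def)

lemma gauss_mom_Suc_0 [simp]: "gauss_mom (Suc 0) s = 0"
  by (simp add: gauss_mom_def)

lemma gauss_mom_2 [simp]: "gauss_mom 2 s = s"
  by (simp add: gauss_mom_def)

lemma gauss_mom_0_right [simp]: "gauss_mom r 0 = 0 ^ r"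
  by (cases "r = 0") (auto simp: gauss_mom_def power_0_left dvd_div_eq_0_iff)

lemma gauss_mom_scale: "gauss_mom r (c\<^sup>2 * s) = c ^ r * gauss_mom r s"
  by (auto simp: gauss_mom_def power_mult_distrib power_mult[symmetric])

text \<open>These are the moments of a sum of two independent Gaussians, but the proof is algebraic,
  since \<open>s\<close> and \<open>t\<close> may be complex. For odd \<open>r\<close> each term has
  a factor of odd index. For \<open>r = 2 * m\<close> the product of the two weights with
  \<open>r choose (2 * i)\<close> is the weight of \<open>r\<close> times \<open>m choose i\<close>,
  and the binomial theorem for \<open>(s + t) ^ m\<close> remains.\<close>

lemma gauss_mom_add:
  "(\<Sum>j\<le>r. of_nat (r choose j) * gauss_mom j s * gauss_mom (r - j) t) = gauss_mom r (s + t)"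
proof (cases "even r")
  case False
  have "of_nat (r choose j) * gauss_mom j s * gauss_mom (r - j) t = 0" if "j \<le> r" for j
    using False that by (cases "even j") (auto simp: gauss_mom_odd)
  then have "(\<Sum>j\<le>r. of_nat (r choose j) * gauss_mom j s * gauss_mom (r - j) t) = 0"
    by (intro sum.neutral) blast
  then show ?thesis using False by (simp add: gauss_mom_odd)
next
  case True
  then obtain m where r: "r = 2 * m" by blast
  let ?f = "\<lambda>j. of_nat (r choose j) * gauss_mom j s * gauss_mom (r - j) t"
  have "(\<Sum>j\<le>r. ?f j) = (\<Sum>j\<in>(\<lambda>i. 2 * i) ` {..m}. ?f j)"
  proof (rule sum.mono_neutral_right)
    show "\<forall>i\<in>{..r} - (\<lambda>i. 2 * i) ` {..m}. ?f i = 0"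
    proof
      fix i assume "i \<in> {..r} - (\<lambda>i. 2 * i) ` {..m}"
      then have "odd i" unfolding r by (auto elim!: evenE)
      then show "?f i = 0" by (simp add: gauss_mom_odd)
    qed
  qed (auto simp: r)
  also have "\<dots> = (\<Sum>i\<le>m. ?f (2 * i))"
    by (subst sum.reindex) (auto simp: inj_on_def)
  also have "\<dots> = (\<Sum>i\<le>m. fact (2 * m) / (2 ^ m * fact m) * (of_nat (m choose i) * s ^ i * t ^ (m - i)))"
  proof (rule sum.cong[OF refl])
    fix i assume "i \<in> {..m}"
    then have i: "i \<le> m" by simp
    have d: "r - 2 * i = 2 * (m - i)" using r by simp
    have p: "(2::complex) ^ m = 2 ^ i * 2 ^ (m - i)"
      using i by (simp flip: power_add)
    have b1: "of_nat (r choose (2 * i)) = (fact (2 * m) / (fact (2 * i) * fact (2 * (m - i))) :: complex)"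
      using binomial_fact[of "2 * i" r, where 'a = complex] i unfolding d by (simp add: r)
    have b2: "of_nat (m choose i) = (fact m / (fact i * fact (m - i)) :: complex)"
      using binomial_fact[OF i, where 'a = complex] .
    show "?f (2 * i) = fact (2 * m) / (2 ^ m * fact m) * (of_nat (m choose i) * s ^ i * t ^ (m - i))"
      unfolding d gauss_mom_double b1 b2 p by (simp add: field_simps)
  qed
  also have "\<dots> = gauss_mom r (s + t)"
    unfolding sum_distrib_left[symmetric] r gauss_mom_double binomial_ring ..
  finally show ?thesis .
qed

text \<open>Iterating the first difference in the directions \<open>y v\<close> kills powers below \<open>card V\<close>.\<close>

lemma alternating_subset_sum_power:
  fixes y :: "'v \<Rightarrow> 'a::field_char_0"
  assumes "finite V" "m \<le> card V"
  shows "(\<Sum>S\<in>Pow V. (-1) ^ card (V - S) * (x + (\<Sum>v\<in>S. y v)) ^ m)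
    = (if m = card V then fact m * (\<Prod>v\<in>V. y v) else 0)"
  using assms
proof (induction V arbitrary: m x rule: finite_induct)
  case empty
  then show ?case by simp
next
  case (insert u V)
  let ?D = "\<lambda>m. \<Sum>S\<in>Pow V. (-1) ^ card (V - S) * (x + (\<Sum>v\<in>S. y v)) ^ m"
  have step: "(x + y u + a) ^ m - (x + a) ^ m
      = (\<Sum>j<m. of_nat (m choose j) * (x + a) ^ j * y u ^ (m - j))" for a
  proof -
    have "(x + y u + a) ^ m = ((x + a) + y u) ^ m" by (simp add: algebra_simps)
    also have "\<dots> = (\<Sum>j\<le>m. of_nat (m choose j) * (x + a) ^ j * y u ^ (m - j))"
      by (rule binomial_ring)
    also have "\<dots> = (\<Sum>j<m. of_nat (m choose j) * (x + a) ^ j * y u ^ (m - j)) + (x + a) ^ m"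
      by (simp flip: lessThan_Suc_atMost)
    finally show ?thesis by simp
  qed
  \<comment> \<open>Subsets are split by whether they contain \<open>u\<close>: those that do give
    the same alternating sum at base point \<open>x + y u\<close>, the others at \<open>x\<close>
    with opposite sign. The difference lowers the degree in \<open>x\<close>, which is why the base
    point is arbitrary in the induction.\<close>
  have "(\<Sum>S\<in>Pow (insert u V). (-1) ^ card (insert u V - S) * (x + (\<Sum>v\<in>S. y v)) ^ m)
     = (\<Sum>S\<in>Pow V. (-1) ^ card (insert u V - S) * (x + (\<Sum>v\<in>S. y v)) ^ m)
     + (\<Sum>S\<in>Pow V. (-1) ^ card (insert u V - insert u S) * (x + (\<Sum>v\<in>insert u S. y v)) ^ m)"
  proof -
    have inj: "inj_on (insert u) (Pow V)" using insert.hyps by (auto simp: inj_on_def)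
    have disj: "Pow V \<inter> insert u ` Pow V = {}" using insert.hyps by auto
    have fin: "finite (Pow V)" using insert.hyps by simp
    show ?thesis
      unfolding Pow_insert sum.union_disjoint[OF fin finite_imageI[OF fin] disj]
        sum.reindex[OF inj] o_def ..
  qed
  also have "(\<Sum>S\<in>Pow V. (-1) ^ card (insert u V - S) * (x + (\<Sum>v\<in>S. y v)) ^ m)
     = - (\<Sum>S\<in>Pow V. (-1) ^ card (V - S) * (x + (\<Sum>v\<in>S. y v)) ^ m)"
    unfolding sum_negf[symmetric]
  proof (rule sum.cong[OF refl])
    fix S assume "S \<in> Pow V"
    then have "insert u V - S = insert u (V - S)" using insert.hyps by auto
    then have "card (insert u V - S) = Suc (card (V - S))" using insert.hyps by simp
    then show "(-1) ^ card (insert u V - S) * (x + sum y S) ^ m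
        = - ((-1) ^ card (V - S) * (x + sum y S) ^ m)" by simp
  qed
  also have "(\<Sum>S\<in>Pow V. (-1) ^ card (insert u V - insert u S) * (x + (\<Sum>v\<in>insert u S. y v)) ^ m)
     = (\<Sum>S\<in>Pow V. (-1) ^ card (V - S) * (x + y u + (\<Sum>v\<in>S. y v)) ^ m)"
  proof (rule sum.cong[OF refl])
    fix S assume S: "S \<in> Pow V"
    then have "insert u V - insert u S = V - S" using insert.hyps by auto
    moreover have "sum y (insert u S) = y u + sum y S"
      using S insert.hyps by (intro sum.insert) (auto intro: finite_subset)
    ultimately show "(-1) ^ card (insert u V - insert u S) * (x + sum y (insert u S)) ^ m
        = (-1) ^ card (V - S) * (x + y u + sum y S) ^ m" by (simp add: add.assoc)
  qed
  also have "- (\<Sum>S\<in>Pow V. (-1) ^ card (V - S) * (x + (\<Sum>v\<in>S. y v)) ^ m)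
     + (\<Sum>S\<in>Pow V. (-1) ^ card (V - S) * (x + y u + (\<Sum>v\<in>S. y v)) ^ m)
     = (\<Sum>S\<in>Pow V. (-1) ^ card (V - S) * ((x + y u + (\<Sum>v\<in>S. y v)) ^ m - (x + (\<Sum>v\<in>S. y v)) ^ m))"
    by (simp add: right_diff_distrib sum_subtractf)
  also have "\<dots> = (\<Sum>S\<in>Pow V. \<Sum>j<m. of_nat (m choose j) * y u ^ (m - j) *
       ((-1) ^ card (V - S) * (x + (\<Sum>v\<in>S. y v)) ^ j))"
    unfolding step sum_distrib_left by (intro sum.cong refl) (simp add: algebra_simps)
  also have "\<dots> = (\<Sum>j<m. of_nat (m choose j) * y u ^ (m - j) * ?D j)"
    by (subst sum.swap) (simp add: sum_distrib_left)
  also have "\<dots> = (\<Sum>j<m. of_nat (m choose j) * y u ^ (m - j) *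
      (if j = card V then fact j * (\<Prod>v\<in>V. y v) else 0))"
  proof (rule sum.cong[OF refl])
    fix j assume "j \<in> {..<m}"
    then have "j \<le> card V" using insert.prems insert.hyps by simp
    then show "of_nat (m choose j) * y u ^ (m - j) * ?D j = of_nat (m choose j) * y u ^ (m - j) *
      (if j = card V then fact j * (\<Prod>v\<in>V. y v) else 0)" by (simp only: insert.IH)
  qed
  \<comment> \<open>Only \<open>j = card V\<close> survives, and it lies below \<open>m\<close> only
    when \<open>m = Suc (card V)\<close>; the factor \<open>m choose card V\<close> is then
    \<open>m\<close>, which turns \<open>fact (card V)\<close> into \<open>fact m\<close>.\<close>
  also have "\<dots> = (if m = card (insert u V) then fact m * (\<Prod>v\<in>insert u V. y v) else 0)"
  proof (cases "m = Suc (card V)")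
    case True
    have "(\<Sum>j<m. of_nat (m choose j) * y u ^ (m - j) * (if j = card V then fact j * (\<Prod>v\<in>V. y v) else 0))
        = of_nat (m choose card V) * y u ^ (m - card V) * (fact (card V) * (\<Prod>v\<in>V. y v))"
      unfolding True lessThan_Suc by simp
    also have "\<dots> = fact m * (y u * (\<Prod>v\<in>V. y v))"
      unfolding True by (simp add: Suc_diff_le mult_ac)
    finally show ?thesis using insert.hyps True by simp
  next
    case False
    then have "m \<le> card V" using insert.prems insert.hyps by simp
    then show ?thesis using insert.hyps False by (auto intro!: sum.neutral)
  qed
  finally show ?case .
qed

text \<open>Base point \<open>0\<close> and top degree in the alternating sum above, divided by the
  factorial. It reduces mixed moments to powers of subset sums.\<close>

lemma polarization:
  fixes y :: "'v \<Rightarrow> 'a::field_char_0"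
  assumes "finite V"
  shows "(\<Prod>v\<in>V. y v)
    = (\<Sum>S\<in>Pow V. (-1) ^ card (V - S) / fact (card V) * (\<Sum>v\<in>S. y v) ^ card V)"
proof -
  have "fact (card V) * (\<Prod>v\<in>V. y v)
      = (\<Sum>S\<in>Pow V. (-1) ^ card (V - S) * (\<Sum>v\<in>S. y v) ^ card V)"
    using alternating_subset_sum_power[OF assms order.refl, of 0 y] by simp
  then have "(\<Prod>v\<in>V. y v)
      = (\<Sum>S\<in>Pow V. (-1) ^ card (V - S) * (\<Sum>v\<in>S. y v) ^ card V) / fact (card V)"
    by (simp add: field_simps)
  then show ?thesis by (simp add: sum_divide_distrib)
qed

text \<open>The recursion satisfied by \<open>e r A = E (\<Sum>i\<in>A. x i) ^ r\<close> for independent centred \<open>x i\<close>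
  with moments \<open>\<mu> i j = E (x i) ^ j\<close>.\<close>

definition moment_rec :: "'i set \<Rightarrow> ('i \<Rightarrow> nat \<Rightarrow> complex) \<Rightarrow> (nat \<Rightarrow> 'i set \<Rightarrow> complex) \<Rightarrow> bool" where
  "moment_rec J \<mu> e \<longleftrightarrow> (\<forall>r. e r {} = 0 ^ r) \<and>
     (\<forall>A i r. finite A \<longrightarrow> A \<subseteq> J \<longrightarrow> i \<in> J - A \<longrightarrow>
        e r (insert i A) = (\<Sum>j\<le>r. of_nat (r choose j) * \<mu> i j * e (r - j) A)) \<and>
     (\<forall>i\<in>J. \<mu> i 0 = 1 \<and> \<mu> i 1 = 0)"

section \<open>Growth and comparison of moments governed by the recursion\<close>

lemma moment_rec_empty: "moment_rec J \<mu> e \<Longrightarrow> e r {} = 0 ^ r"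
  unfolding moment_rec_def by blast

text \<open>Centring removes \<open>j = 1\<close>, so each new variable brings in only moments of
  order at most \<open>r - 2\<close> of the rest. This loss of two orders is balanced below against
  a number of summands of order \<open>p ^ 2\<close>.\<close>

lemma moment_rec_step:
  assumes "moment_rec J \<mu> e" "finite A" "A \<subseteq> J" "i \<in> J - A"
  shows "e r (insert i A) = e r A + (\<Sum>j=2..r. of_nat (r choose j) * \<mu> i j * e (r - j) A)"
proof -
  let ?f = "\<lambda>j. of_nat (r choose j) * \<mu> i j * e (r - j) A"
  have "e r (insert i A) = (\<Sum>j\<le>r. ?f j)"
    using assms unfolding moment_rec_def by blast
  also have "\<dots> = (\<Sum>j\<in>insert 0 {2..r}. ?f j)"
  proof (rule sum.mono_neutral_right)
    show "\<forall>j\<in>{..r} - insert 0 {2..r}. ?f j = 0"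
    proof
      fix j assume "j \<in> {..r} - insert 0 {2..r}"
      then have "j = 1" by auto
      then show "?f j = 0" using assms unfolding moment_rec_def by auto
    qed
  qed auto
  also have "\<dots> = e r A + (\<Sum>j=2..r. ?f j)"
    using assms unfolding moment_rec_def by simp
  finally show ?thesis .
qed

lemma card_accumulate:
  fixes f :: "'i set \<Rightarrow> real"
  assumes "finite A" "A \<subseteq> J" "\<And>B i. finite B \<Longrightarrow> insert i B \<subseteq> A \<Longrightarrow> i \<notin> B \<Longrightarrow> f (insert i B) \<le> f B + c"
  shows "f A \<le> f {} + real (card A) * c"
proof -
  have "B \<subseteq> A \<Longrightarrow> f B \<le> f {} + real (card B) * c" if "finite B" for B
    using that
  proof (induction B rule: finite_induct)
    case (insert i B)
    then have "f (insert i B) \<le> f B + c" using assms(3) by blast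
    moreover have "f B \<le> f {} + real (card B) * c" using insert by blast
    ultimately show ?case using insert.hyps by (simp add: algebra_simps)
  qed simp
  then show ?thesis using assms(1) by blast
qed

text \<open>\<open>p\<close> stands for the square root of the number of summands. By induction on
  \<open>r\<close>, adding one variable changes \<open>e r\<close> by at most
  \<open>C * p ^ (r - 2)\<close>, and there are at most \<open>p ^ 2\<close> additions. The constant
  is chosen before \<open>J\<close>, \<open>\<mu>\<close>, \<open>e\<close>, \<open>A\<close> and
  \<open>p\<close>, as the weights will depend on the matrix size, the frequency and the
  counts.\<close>

lemma moment_rec_bound:
  assumes D: "\<And>j. 0 \<le> D j"
  shows "\<exists>B\<ge>0. \<forall>(J::'i set) \<mu> e A p. moment_rec J \<mu> e \<longrightarrow> (\<forall>i\<in>J. \<forall>j. norm (\<mu> i j) \<le> D j) \<longrightarrow>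
    finite A \<longrightarrow> A \<subseteq> J \<longrightarrow> 1 \<le> p \<longrightarrow> real (card A) \<le> p\<^sup>2 \<longrightarrow> norm (e r A) \<le> B * p ^ r"
    (is "\<exists>B\<ge>0. ?P r B")
proof (induction r rule: less_induct)
  case (less r)
  have "\<forall>k\<in>{..<r}. \<exists>B. B \<ge> 0 \<and> ?P k B"
    by (intro ballI less.IH) (erule lessThan_iff[THEN iffD1])
  from bchoice[OF this] obtain b where "\<forall>k\<in>{..<r}. b k \<ge> 0 \<and> ?P k (b k)" by (rule exE)
  note b = bspec[OF this, OF lessThan_iff[THEN iffD2]]
  have bb: "norm (e k A) \<le> b k * p ^ k" if "k < r" "moment_rec J \<mu> e" "\<forall>i\<in>J. \<forall>j. norm (\<mu> i j) \<le> D j"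
      "finite A" "A \<subseteq> J" "1 \<le> p" "real (card A) \<le> p\<^sup>2" for k and J :: "'i set" and \<mu> e A p
    using b[OF that(1), THEN conjunct2, rule_format, OF that(2) _ that(4-7)] that(3) by simp
  define C where "C = (\<Sum>j=2..r. real (r choose j) * D j * b (r - j))"
  have C0: "C \<ge> 0" unfolding C_def using b D by (intro sum_nonneg mult_nonneg_nonneg) auto
  \<comment> \<open>The \<open>1\<close> pays for the empty set, where
    \<open>0 ^ r \<le> 1 \<le> p ^ r\<close>; \<open>C\<close> pays for the increments.\<close>
  have "?P r (1 + C)"
  proof (intro allI impI)
    fix J :: "'i set" and \<mu> e A and p :: real
    assume mr: "moment_rec J \<mu> e" and mu: "\<forall>i\<in>J. \<forall>j. norm (\<mu> i j) \<le> D j"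
      and A: "finite A" "A \<subseteq> J" and p: "1 \<le> p" "real (card A) \<le> p\<^sup>2"
    have step: "norm (e r (insert i B)) \<le> norm (e r B) + C * p ^ (r - 2)"
      if B: "finite B" "insert i B \<subseteq> A" "i \<notin> B" for B i
    proof -
      have cB: "real (card B) \<le> p\<^sup>2"
        by (rule order.trans[OF of_nat_mono[OF card_mono[OF A(1)]] p(2)]) (use B in auto)
      have "norm (of_nat (r choose j) * \<mu> i j * e (r - j) B)
          \<le> real (r choose j) * D j * b (r - j) * p ^ (r - 2)" if j: "j \<in> {2..r}" for j
      proof -
        have "norm (e (r - j) B) \<le> b (r - j) * p ^ (r - j)"
          using j B A by (intro bb[OF _ mr mu _ _ p(1) cB]) auto
        also have "\<dots> \<le> b (r - j) * p ^ (r - 2)"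
          using b[of "r - j"] j p by (intro mult_left_mono power_increasing) auto
        finally have "norm (\<mu> i j) * norm (e (r - j) B) \<le> D j * (b (r - j) * p ^ (r - 2))"
          using mu B A D by (intro mult_mono) auto
        then show ?thesis
          by (simp add: norm_mult mult.assoc mult_left_mono)
      qed
      then have "norm (\<Sum>j=2..r. of_nat (r choose j) * \<mu> i j * e (r - j) B) \<le> C * p ^ (r - 2)"
        unfolding C_def sum_distrib_right by (intro order.trans[OF norm_sum] sum_mono)
      moreover have "e r (insert i B) = e r B + (\<Sum>j=2..r. of_nat (r choose j) * \<mu> i j * e (r - j) B)"
        using B A by (intro moment_rec_step[OF mr]) auto
      ultimately show ?thesis by (simp only:) (rule order.trans[OF norm_triangle_ineq add_left_mono])
    qed
    have "norm (e r A) \<le> norm (e r {}) + real (card A) * (C * p ^ (r - 2))"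
      using card_accumulate[OF A, of "\<lambda>A. norm (e r A)"] step by blast
    also have "norm (e r {}) \<le> 1 * p ^ r"
      using one_le_power[OF p(1), of r] unfolding moment_rec_empty[OF mr] by (auto simp: power_0_left)
    also have "real (card A) * (C * p ^ (r - 2)) \<le> C * p ^ r"
    proof (cases "r \<ge> 2")
      case True
      have "real (card A) * (C * p ^ (r - 2)) \<le> p\<^sup>2 * (C * p ^ (r - 2))"
        using p C0 by (intro mult_right_mono) auto
      also have "\<dots> = C * (p\<^sup>2 * p ^ (r - 2))" by simp
      also have "p\<^sup>2 * p ^ (r - 2) = p ^ r"
        by (simp only: power_add[symmetric] le_add_diff_inverse True)
      finally show ?thesis .
    next
      case False
      \<comment> \<open>For \<open>r < 2\<close> the exponent \<open>r - 2\<close> is truncated, but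
        the sum defining \<open>C\<close> is empty.\<close>
      then have "C = 0" by (simp add: C_def)
      then show ?thesis by simp
    qed
    finally show "norm (e r A) \<le> (1 + C) * p ^ r" by (simp add: algebra_simps)
  qed
  then show ?case using C0 by (intro exI[of _ "1 + C"]) auto
qed

text \<open>Replacing the \<open>x i\<close> one at a time by variables with the same mean and variance changes
  the moments only to lower order.\<close>

lemma moment_rec_diff:
  assumes D: "\<And>j. 0 \<le> D j"
  shows "\<exists>B\<ge>0. \<forall>(J::'i set) \<mu> \<mu>' e e' A p. moment_rec J \<mu> e \<longrightarrow> moment_rec J \<mu>' e' \<longrightarrow>
    (\<forall>i\<in>J. \<forall>j. norm (\<mu> i j) \<le> D j \<and> norm (\<mu>' i j) \<le> D j) \<longrightarrow> (\<forall>i\<in>J. \<mu> i 2 = \<mu>' i 2) \<longrightarrow>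
    finite A \<longrightarrow> A \<subseteq> J \<longrightarrow> 1 \<le> p \<longrightarrow> real (card A) \<le> p\<^sup>2 \<longrightarrow> p * norm (e r A - e' r A) \<le> B * p ^ r"
    (is "\<exists>B\<ge>0. ?P r B")
proof (induction r rule: less_induct)
  case (less r)
  have "\<forall>k\<in>{..<r}. \<exists>B. B \<ge> 0 \<and> ?P k B"
    by (intro ballI less.IH) (erule lessThan_iff[THEN iffD1])
  from bchoice[OF this] obtain b where "\<forall>k\<in>{..<r}. b k \<ge> 0 \<and> ?P k (b k)" by (rule exE)
  note b = bspec[OF this, OF lessThan_iff[THEN iffD2]]
  have "\<forall>k. \<exists>a\<ge>0. (\<forall>(J::'i set) \<mu> e A p. moment_rec J \<mu> e \<longrightarrow>
      (\<forall>i\<in>J. \<forall>j. norm (\<mu> i j) \<le> D j) \<longrightarrow> finite A \<longrightarrow> A \<subseteq> J \<longrightarrow> 1 \<le> p \<longrightarrow>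
      real (card A) \<le> p\<^sup>2 \<longrightarrow> norm (e k A) \<le> a * p ^ k)"
    by (intro allI moment_rec_bound[OF D])
  from choice[OF this] obtain a where "\<forall>k. a k \<ge> 0 \<and> (\<forall>(J::'i set) \<mu> e A p. moment_rec J \<mu> e \<longrightarrow>
      (\<forall>i\<in>J. \<forall>j. norm (\<mu> i j) \<le> D j) \<longrightarrow> finite A \<longrightarrow> A \<subseteq> J \<longrightarrow> 1 \<le> p \<longrightarrow>
      real (card A) \<le> p\<^sup>2 \<longrightarrow> norm (e k A) \<le> a k * p ^ k)"
    by (rule exE)
  note a = spec[OF this]
  have bb: "p * norm (e k A - e' k A) \<le> b k * p ^ k" if "k < r" "moment_rec J \<mu> e" "moment_rec J \<mu>' e'"
      "\<forall>i\<in>J. \<forall>j. norm (\<mu> i j) \<le> D j \<and> norm (\<mu>' i j) \<le> D j" "\<forall>i\<in>J. \<mu> i 2 = \<mu>' i 2"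
      "finite A" "A \<subseteq> J" "1 \<le> p" "real (card A) \<le> p\<^sup>2" for k and J :: "'i set" and \<mu> \<mu>' e e' A p
    using b[OF that(1), THEN conjunct2, rule_format, OF that(2,3) _ _ that(6-9)] that(4,5) by simp
  have aa: "norm (e k A) \<le> a k * p ^ k" if "moment_rec J \<mu> e" "\<forall>i\<in>J. \<forall>j. norm (\<mu> i j) \<le> D j"
      "finite A" "A \<subseteq> J" "1 \<le> p" "real (card A) \<le> p\<^sup>2" for k and J :: "'i set" and \<mu> e A p
    using a[THEN conjunct2, rule_format, OF that(1) _ that(3-6)] that(2) by simp
  define C where "C = (\<Sum>j=2..r. real (r choose j) * (D j * (b (r - j) + 2 * a (r - j))))"
  have C0: "C \<ge> 0" unfolding C_def
  proof (rule sum_nonneg)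
    fix j assume "j \<in> {2..r}"
    then show "0 \<le> real (r choose j) * (D j * (b (r - j) + 2 * a (r - j)))"
      using b[of "r - j"] a[of "r - j"] D[of j] by simp
  qed
  \<comment> \<open>There is no additive \<open>1\<close> here: both sequences start from
    \<open>0 ^ r\<close>. The gain of one order is written as a factor \<open>p\<close> on the left,
    which avoids a truncated exponent \<open>r - 1\<close>.\<close>
  have "?P r C"
  proof (intro allI impI)
    fix J :: "'i set" and \<mu> \<mu>' e e' A and p :: real
    assume mr: "moment_rec J \<mu> e" and mr': "moment_rec J \<mu>' e'"
      and mu: "\<forall>i\<in>J. \<forall>j. norm (\<mu> i j) \<le> D j \<and> norm (\<mu>' i j) \<le> D j" and mu2: "\<forall>i\<in>J. \<mu> i 2 = \<mu>' i 2"
      and A: "finite A" "A \<subseteq> J" and p: "1 \<le> p" "real (card A) \<le> p\<^sup>2"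
    have step: "p * norm (e r (insert i B) - e' r (insert i B)) \<le> p * norm (e r B - e' r B) + C * p ^ (r - 2)"
      if B: "finite B" "insert i B \<subseteq> A" "i \<notin> B" for B i
    proof -
      have cB: "real (card B) \<le> p\<^sup>2"
        by (rule order.trans[OF of_nat_mono[OF card_mono[OF A(1)]] p(2)]) (use B in auto)
      have iJ: "i \<in> J" and BJ: "B \<subseteq> J" using A B by auto
      have trm: "p * norm (\<mu> i j * e (r - j) B - \<mu>' i j * e' (r - j) B)
          \<le> D j * (b (r - j) + 2 * a (r - j)) * p ^ (r - 2)" if j: "j \<in> {2..r}" for j
      \<comment> \<open>At \<open>j = 2\<close> the coefficients agree, so only the difference of
        lower moments is left and the induction hypothesis supplies the gain. For
        \<open>j \<ge> 3\<close> nothing cancels, but the order has dropped by three, and one of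
        these powers absorbs the factor \<open>p\<close>.\<close>
      proof (cases "j = 2")
        case True
        have "p * norm (e (r - j) B - e' (r - j) B) \<le> b (r - j) * p ^ (r - j)"
          using j B by (intro bb[OF _ mr mr' mu mu2 _ BJ p(1) cB]) auto
        then have "norm (\<mu> i j) * (p * norm (e (r - j) B - e' (r - j) B)) \<le> D j * (b (r - j) * p ^ (r - j))"
          by - (rule mult_mono, use mu iJ D p in auto)
        also have "\<dots> \<le> D j * (b (r - j) + 2 * a (r - j)) * p ^ (r - 2)"
          using D[of j] a[of "r - j"] p True by (simp add: mult.assoc mult_left_mono mult_right_mono)
        finally show ?thesis using mu2 iJ True
          by (simp add: norm_mult mult.left_commute flip: right_diff_distrib)
      next
        case False
        have *: "p * p ^ (r - j) \<le> p ^ (r - 2)"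
          using False j p by (subst power_Suc[symmetric], intro power_increasing) auto
        have "norm (e (r - j) B) \<le> a (r - j) * p ^ (r - j)"
          using mu by (intro aa[OF mr _ B(1) BJ p(1) cB]) auto
        then have 1: "norm (\<mu> i j) * norm (e (r - j) B) \<le> D j * (a (r - j) * p ^ (r - j))"
          using mu iJ D by (intro mult_mono) auto
        have "norm (e' (r - j) B) \<le> a (r - j) * p ^ (r - j)"
          using mu by (intro aa[OF mr' _ B(1) BJ p(1) cB]) auto
        then have 2: "norm (\<mu>' i j) * norm (e' (r - j) B) \<le> D j * (a (r - j) * p ^ (r - j))"
          using mu iJ D by (intro mult_mono) auto
        have "norm (\<mu> i j * e (r - j) B - \<mu>' i j * e' (r - j) B) \<le> 2 * (D j * (a (r - j) * p ^ (r - j)))"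
          using norm_triangle_ineq4[of "\<mu> i j * e (r - j) B" "\<mu>' i j * e' (r - j) B"] 1 2
          by (simp add: norm_mult)
        then have "p * norm (\<mu> i j * e (r - j) B - \<mu>' i j * e' (r - j) B)
            \<le> p * (2 * (D j * (a (r - j) * p ^ (r - j))))"
          using p by (intro mult_left_mono) auto
        also have "\<dots> = 2 * D j * a (r - j) * (p * p ^ (r - j))" by simp
        also have "\<dots> \<le> 2 * D j * a (r - j) * p ^ (r - 2)"
          using D[of j] a[of "r - j"] * by (intro mult_left_mono) auto
        also have "\<dots> = D j * (2 * a (r - j)) * p ^ (r - 2)" by simp
        also have "\<dots> \<le> D j * (b (r - j) + 2 * a (r - j)) * p ^ (r - 2)"
          using D[of j] b[of "r - j"] p j by (intro mult_right_mono mult_left_mono) auto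
        finally show ?thesis .
      qed
      have "p * norm (\<Sum>j=2..r. of_nat (r choose j) * (\<mu> i j * e (r - j) B - \<mu>' i j * e' (r - j) B))
          \<le> p * (\<Sum>j=2..r. real (r choose j) * norm (\<mu> i j * e (r - j) B - \<mu>' i j * e' (r - j) B))"
        using p by (intro mult_left_mono order.trans[OF norm_sum] sum_mono) (auto simp: norm_mult)
      also have "\<dots> = (\<Sum>j=2..r. real (r choose j) * (p * norm (\<mu> i j * e (r - j) B - \<mu>' i j * e' (r - j) B)))"
        by (simp add: sum_distrib_left mult.left_commute)
      also have "\<dots> \<le> C * p ^ (r - 2)"
        unfolding C_def sum_distrib_right mult.assoc[of "real (r choose _)"]
        using trm by (intro sum_mono mult_left_mono) auto
      finally have S: "p * norm (\<Sum>j=2..r. of_nat (r choose j) * (\<mu> i j * e (r - j) B - \<mu>' i j * e' (r - j) B))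
          \<le> C * p ^ (r - 2)" .
      have "e r (insert i B) = e r B + (\<Sum>j=2..r. of_nat (r choose j) * \<mu> i j * e (r - j) B)"
        using B iJ BJ by (intro moment_rec_step[OF mr]) auto
      moreover have "e' r (insert i B) = e' r B + (\<Sum>j=2..r. of_nat (r choose j) * \<mu>' i j * e' (r - j) B)"
        using B iJ BJ by (intro moment_rec_step[OF mr']) auto
      ultimately have "e r (insert i B) - e' r (insert i B) = (e r B - e' r B) +
          (\<Sum>j=2..r. of_nat (r choose j) * (\<mu> i j * e (r - j) B - \<mu>' i j * e' (r - j) B))"
        by (simp add: right_diff_distrib sum_subtractf mult.assoc)
      then have "norm (e r (insert i B) - e' r (insert i B)) \<le> norm (e r B - e' r B) +
          norm (\<Sum>j=2..r. of_nat (r choose j) * (\<mu> i j * e (r - j) B - \<mu>' i j * e' (r - j) B))"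
        by (simp add: norm_triangle_ineq)
      then have "p * norm (e r (insert i B) - e' r (insert i B)) \<le> p * (norm (e r B - e' r B) +
          norm (\<Sum>j=2..r. of_nat (r choose j) * (\<mu> i j * e (r - j) B - \<mu>' i j * e' (r - j) B)))"
        using p by (intro mult_left_mono) auto
      then show ?thesis using S by (simp add: distrib_left)
    qed
    have "p * norm (e r A - e' r A) \<le> p * norm (e r {} - e' r {}) + real (card A) * (C * p ^ (r - 2))"
      using card_accumulate[OF A, of "\<lambda>A. p * norm (e r A - e' r A)"] step by blast
    also have "p * norm (e r {} - e' r {}) = 0"
      by (simp add: moment_rec_empty[OF mr] moment_rec_empty[OF mr'])
    also have "0 + real (card A) * (C * p ^ (r - 2)) \<le> C * p ^ r"
    proof (cases "r \<ge> 2")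
      case True
      have "real (card A) * (C * p ^ (r - 2)) \<le> p\<^sup>2 * (C * p ^ (r - 2))"
        using p C0 by (intro mult_right_mono) auto
      also have "\<dots> = C * (p\<^sup>2 * p ^ (r - 2))" by simp
      also have "p\<^sup>2 * p ^ (r - 2) = p ^ r"
        by (simp only: power_add[symmetric] le_add_diff_inverse True)
      finally show ?thesis by simp
    next
      case False
      then have "C = 0" by (simp add: C_def)
      then show ?thesis by simp
    qed
    finally show "p * norm (e r A - e' r A) \<le> C * p ^ r" .
  qed
  then show ?case using C0 by blast
qed

section \<open>Eigenvalues of circulant matrices\<close>

text \<open>Integer exponents make conjugation a change of sign and allow frequencies to be
  subtracted.\<close>

definition unit_root :: "nat \<Rightarrow> int \<Rightarrow> complex" where
  "unit_root n x = cis (2 * pi * of_int x / of_nat n)"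

lemma norm_unit_root [simp]: "norm (unit_root n x) = 1"
  by (simp add: unit_root_def)

lemma unit_root_0 [simp]: "unit_root n 0 = 1"
  by (simp add: unit_root_def)

lemma unit_root_add: "unit_root n (x + y) = unit_root n x * unit_root n y"
  by (simp add: unit_root_def cis_mult add_divide_distrib distrib_left)

lemma unit_root_mult_of_nat: "unit_root n (x * int j) = unit_root n x ^ j"
  unfolding unit_root_def Complex.DeMoivre by (rule arg_cong[where f = cis]) simp

lemma unit_root_eq_1_iff:
  assumes "n > 0"
  shows "unit_root n x = 1 \<longleftrightarrow> int n dvd x"
proof
  assume "unit_root n x = 1"
  then have "Re (unit_root n x) = 1" by simp
  then have "cos (2 * pi * of_int x / of_nat n) = 1" by (simp add: unit_root_def)
  then obtain m :: int where "2 * pi * of_int x / of_nat n = of_int m * 2 * pi"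
    using cos_one_2pi_int by blast
  then have "of_int x = (of_int (m * int n) :: real)"
    using assms by (simp add: field_simps)
  then have "x = m * int n" by (simp only: of_int_eq_iff)
  then show "int n dvd x" by simp
next
  assume "int n dvd x"
  then obtain m where "x = int n * m" by blast
  then have "2 * pi * of_int x / of_nat n = 2 * pi * real_of_int m"
    using assms by simp
  then show "unit_root n x = 1"
    unfolding unit_root_def by (simp only: cis_multiple_2pi Ints_of_int)
qed

lemma unit_root_cong:
  assumes "n > 0" "int n dvd x - y"
  shows "unit_root n x = unit_root n y"
proof -
  have "unit_root n x = unit_root n (y + (x - y))" by simp
  also have "\<dots> = unit_root n y * 1"
    using unit_root_eq_1_iff[of n "x - y"] assms unfolding unit_root_add by simp
  finally show ?thesis by simp
qed

lemma sum_unit_root: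
  assumes "n > 0"
  shows "(\<Sum>j<n. unit_root n (x * int j)) = (if int n dvd x then of_nat n else 0)"
proof (cases "int n dvd x")
  case True
  then have "unit_root n (x * int j) = 1" for j
    by (subst unit_root_eq_1_iff[OF assms]) auto
  then show ?thesis using True by simp
next
  case False
  then have ne: "unit_root n x \<noteq> 1" using unit_root_eq_1_iff[OF assms] by simp
  have "unit_root n x ^ n = unit_root n (x * int n)" by (simp add: unit_root_mult_of_nat)
  also have "\<dots> = 1" by (subst unit_root_eq_1_iff[OF assms]) auto
  finally have "(\<Sum>j<n. unit_root n x ^ j) = 0"
    using geometric_sum[OF ne, of n] by simp
  then show ?thesis using False by (simp add: unit_root_mult_of_nat)
qed

section \<open>Eigenvalues of circulants and traces of words\<close>

definition letter_sign :: "bool \<Rightarrow> int" where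
  "letter_sign b = (if b then -1 else 1)"

text \<open>The discrete Fourier transform of the first row. Since \<open>s\<close> is real,
  \<open>b = True\<close> gives the complex conjugate, which is the eigenvalue of the transpose;
  placing the sign in the frequency keeps the expression linear in \<open>s\<close>.\<close>

definition circ_eig :: "nat \<Rightarrow> (nat \<Rightarrow> real) \<Rightarrow> nat \<Rightarrow> bool \<Rightarrow> complex" where
  "circ_eig n s k b = (\<Sum>m<n. of_real (s m) * unit_root n (letter_sign b * int k * int m))"

text \<open>Row \<open>i\<close> is the first row shifted cyclically by \<open>i\<close>, so summing
  over \<open>m = j - i\<close> modulo \<open>n\<close> pulls out the root at \<open>i\<close>; the
  transpose needs \<open>m = i - j\<close> and the opposite sign. Both have the same eigenvector, so
  words act on it by products of eigenvalues.\<close>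

lemma circulant_letter_eigenvector:
  assumes i: "i < n"
  shows "(\<Sum>j<n. mat_letter (\<lambda>v. c \<cdot>\<^sub>m circulant n (s v)) (v, b) $$ (i, j) * unit_root n (int k * int j))
    = of_real c * circ_eig n (s v) k b * unit_root n (int k * int i)"
proof -
  have n: "n > 0" using i by simp
  show ?thesis
  proof (cases b)
    case False
    have "(\<Sum>j<n. mat_letter (\<lambda>v. c \<cdot>\<^sub>m circulant n (s v)) (v, b) $$ (i, j) * unit_root n (int k * int j))
        = (\<Sum>j<n. of_real c * of_real (s v ((j + n - i) mod n)) * unit_root n (int k * int j))"
      using i False by (intro sum.cong refl) (auto simp: mat_letter_def circulant_def circulant_link_def)
    also have "\<dots> = (\<Sum>m<n. of_real c * of_real (s v m) * unit_root n (int k * int m + int k * int i))"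
    proof (rule sum.reindex_bij_witness[where i = "\<lambda>m. (m + i) mod n" and j = "\<lambda>j. (j + n - i) mod n"])
      fix j assume j: "j \<in> {..<n}"
      have "((j + n - i) mod n + i) mod n = (j + n - i + i) mod n" by (simp add: mod_simps)
      then show "((j + n - i) mod n + i) mod n = j" using i j by simp
      show "(j + n - i) mod n \<in> {..<n}" using n by simp
      have "int n dvd (int k * int ((j + n - i) mod n) + int k * int i) - int k * int j"
      proof -
        have "int ((j + n - i) mod n) = int (j + n - i) mod int n" by (simp add: zmod_int)
        also have "\<dots> = int (j + n - i) - int n * (int (j + n - i) div int n)"
          by (simp add: minus_mult_div_eq_mod)
        also have "int (j + n - i) = int j + int n - int i" using i by (subst of_nat_diff) auto
        finally obtain q where q: "int ((j + n - i) mod n) = int j + int n - int i - int n * q" by blast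
        have "(int k * int ((j + n - i) mod n) + int k * int i) - int k * int j = int n * (int k * (1 - q))"
          unfolding q by (simp add: algebra_simps)
        then show ?thesis by simp
      qed
      then show "of_real c * of_real (s v ((j + n - i) mod n)) * unit_root n (int k * int ((j + n - i) mod n) + int k * int i)
        = of_real c * of_real (s v ((j + n - i) mod n)) * unit_root n (int k * int j)"
        using unit_root_cong[OF n] by simp
    next
      fix m assume m: "m \<in> {..<n}"
      have "((m + i) mod n + n - i) mod n = ((m + i) mod n + (n - i)) mod n" using i by simp
      also have "\<dots> = (m + i + (n - i)) mod n" by (simp add: mod_simps)
      finally show "((m + i) mod n + n - i) mod n = m" using i m by simp
      show "(m + i) mod n \<in> {..<n}" using n by simp
    qed
    also have "\<dots> = of_real c * circ_eig n (s v) k b * unit_root n (int k * int i)"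
      using False by (simp add: circ_eig_def letter_sign_def unit_root_add sum_distrib_left sum_distrib_right mult.assoc)
    finally show ?thesis .
  next
    case True
    have "(\<Sum>j<n. mat_letter (\<lambda>v. c \<cdot>\<^sub>m circulant n (s v)) (v, b) $$ (i, j) * unit_root n (int k * int j))
        = (\<Sum>j<n. of_real c * of_real (s v ((i + n - j) mod n)) * unit_root n (int k * int j))"
      using i True by (intro sum.cong refl) (auto simp: mat_letter_def circulant_def circulant_link_def)
    also have "\<dots> = (\<Sum>m<n. of_real c * of_real (s v m) * unit_root n (- (int k * int m) + int k * int i))"
    proof (rule sum.reindex_bij_witness[where i = "\<lambda>m. (i + n - m) mod n" and j = "\<lambda>j. (i + n - j) mod n"])
      \<comment> \<open>The reflection is its own inverse, so the two bijectivity obligations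
        coincide.\<close>
      have inv: "(i + n - (i + n - j) mod n) mod n = j" if "j < n" for j
      proof (cases "j \<le> i")
        case True
        then have e: "i + n - j = (i - j) + n" "i + n - (i - j) = j + n" by simp_all
        have "(i + n - j) mod n = i - j"
          unfolding e(1) mod_add_self2 by (rule mod_less) (use i in simp)
        then show ?thesis by (simp only: e(2) mod_add_self2 mod_less that)
      next
        case False
        have "(i + n - j) mod n = i + n - j" by (rule mod_less) (use False that in simp)
        moreover have "i + n - (i + n - j) = j" using that by simp
        ultimately show ?thesis by (simp only: mod_less that)
      qed
      fix j assume j: "j \<in> {..<n}"
      show "(i + n - (i + n - j) mod n) mod n = j" using inv j by simp
      then show "(i + n - (i + n - j) mod n) mod n = j" .
      show "(i + n - j) mod n \<in> {..<n}" using n by simp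
      then show "(i + n - j) mod n \<in> {..<n}" .
      have "int n dvd (- (int k * int ((i + n - j) mod n)) + int k * int i) - int k * int j"
      proof -
        have "int ((i + n - j) mod n) = int (i + n - j) mod int n" by (simp add: zmod_int)
        also have "\<dots> = int (i + n - j) - int n * (int (i + n - j) div int n)"
          by (simp add: minus_mult_div_eq_mod)
        also have "int (i + n - j) = int i + int n - int j" using j by (subst of_nat_diff) auto
        finally obtain q where q: "int ((i + n - j) mod n) = int i + int n - int j - int n * q" by blast
        have "(- (int k * int ((i + n - j) mod n)) + int k * int i) - int k * int j = int n * (int k * (q - 1))"
          unfolding q by (simp add: algebra_simps)
        then show ?thesis by simp
      qed
      then show "of_real c * of_real (s v ((i + n - j) mod n)) * unit_root n (- (int k * int ((i + n - j) mod n)) + int k * int i)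
        = of_real c * of_real (s v ((i + n - j) mod n)) * unit_root n (int k * int j)"
        using unit_root_cong[OF n] by simp
    qed
    also have "\<dots> = of_real c * circ_eig n (s v) k b * unit_root n (int k * int i)"
      unfolding unit_root_add circ_eig_def letter_sign_def sum_distrib_left sum_distrib_right
      using True by (simp add: mult_ac)
    finally show ?thesis .
  qed
qed

lemma word_mat_carrier:
  assumes "\<And>v. A v \<in> carrier_mat n n"
  shows "word_mat n A w \<in> carrier_mat n n"
  using assms by (induction w) (auto simp: word_mat_def intro: mult_carrier_mat)

lemma mat_letter_circulant_carrier:
  "mat_letter (\<lambda>v. c \<cdot>\<^sub>m circulant n (s v)) v \<in> carrier_mat n n"
  by (cases v) (auto simp: mat_letter_def circulant_def)

lemma circulant_word_eigenvector:
  fixes c :: real and s :: "nat \<Rightarrow> nat \<Rightarrow> real" and n :: nat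
  defines "A \<equiv> mat_letter (\<lambda>v. c \<cdot>\<^sub>m circulant n (s v))"
  assumes "i < n"
  shows "(\<Sum>j<n. word_mat n A w $$ (i, j) * unit_root n (int k * int j))
    = (\<Prod>v\<leftarrow>w. of_real c * circ_eig n (s (fst v)) k (snd v)) * unit_root n (int k * int i)"
  using assms(2)
proof (induction w arbitrary: i)
  case Nil
  have "(\<Sum>j<n. word_mat n A [] $$ (i, j) * unit_root n (int k * int j))
      = (\<Sum>j<n. if j = i then unit_root n (int k * int i) else 0)"
    using Nil by (intro sum.cong refl) (auto simp: word_mat_def)
  then show ?case using Nil by simp
next
  case (Cons v w)
  have cA: "A u \<in> carrier_mat n n" for u
    unfolding A_def by (rule mat_letter_circulant_carrier)
  note cW = word_mat_carrier[of A n w, OF cA]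
  have entry: "word_mat n A (v # w) $$ (i, j) = (\<Sum>l<n. A v $$ (i, l) * word_mat n A w $$ (l, j))"
    if "j < n" for j
  proof -
    have "word_mat n A (v # w) = A v * word_mat n A w" by (simp add: word_mat_def)
    then show ?thesis using cA[of v] cW Cons.prems that
      by (auto simp: scalar_prod_def atLeast0LessThan intro!: sum.cong)
  qed
  have "(\<Sum>j<n. word_mat n A (v # w) $$ (i, j) * unit_root n (int k * int j))
      = (\<Sum>j<n. \<Sum>l<n. A v $$ (i, l) * (word_mat n A w $$ (l, j) * unit_root n (int k * int j)))"
    by (intro sum.cong refl) (simp add: entry sum_distrib_right mult.assoc)
  also have "\<dots> = (\<Sum>l<n. A v $$ (i, l) * (\<Sum>j<n. word_mat n A w $$ (l, j) * unit_root n (int k * int j)))"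
    by (subst sum.swap) (simp add: sum_distrib_left)
  also have "\<dots> = (\<Sum>l<n. A v $$ (i, l) * unit_root n (int k * int l)) *
      (\<Prod>v\<leftarrow>w. of_real c * circ_eig n (s (fst v)) k (snd v))"
    unfolding sum_distrib_right by (intro sum.cong refl) (simp add: Cons.IH)
  also have "(\<Sum>l<n. A v $$ (i, l) * unit_root n (int k * int l))
      = of_real c * circ_eig n (s (fst v)) k (snd v) * unit_root n (int k * int i)"
    using circulant_letter_eigenvector[OF Cons.prems, of c s "fst v" "snd v" k] by (simp add: A_def)
  finally show ?case by simp
qed

text \<open>No change of basis is performed: \<open>n\<close> times the trace is written as a double
  sum against \<open>n\<close> times the Kronecker delta, the latter is expanded by orthogonality of
  the roots of unity, and the eigenvector identity is applied frequency by frequency.\<close>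

lemma trace_circulant_word:
  fixes c :: real and s :: "nat \<Rightarrow> nat \<Rightarrow> real" and n :: nat
  defines "A \<equiv> mat_letter (\<lambda>v. c \<cdot>\<^sub>m circulant n (s v))"
  assumes n: "n > 0"
  shows "mat_trace (word_mat n A w) = (\<Sum>k<n. \<Prod>v\<leftarrow>w. of_real c * circ_eig n (s (fst v)) k (snd v))"
proof -
  let ?W = "word_mat n A w" and ?L = "\<lambda>k. \<Prod>v\<leftarrow>w. of_real c * circ_eig n (s (fst v)) k (snd v)"
  have cW: "?W \<in> carrier_mat n n"
    by (intro word_mat_carrier) (simp add: A_def mat_letter_circulant_carrier)
  have delta: "(\<Sum>k<n. unit_root n (int k * int j) * unit_root n (- (int k * int i))) = (if j = i then of_nat n else 0)"
    if "i < n" "j < n" for i j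
  proof -
    have "unit_root n (int k * int j) * unit_root n (- (int k * int i)) = unit_root n ((int j - int i) * int k)" for k
      unfolding unit_root_add[symmetric] by (rule arg_cong[of _ _ "unit_root n"]) (simp add: algebra_simps)
    moreover have "int n dvd int j - int i \<longleftrightarrow> j = i"
    proof
      assume "int n dvd int j - int i"
      moreover have "\<bar>int j - int i\<bar> < int n" using that by simp
      ultimately have "int j - int i = 0" using dvd_imp_le_int[of "int j - int i" "int n"] by linarith
      then show "j = i" by simp
    qed simp
    ultimately show ?thesis by (simp add: sum_unit_root[OF n])
  qed
  have "of_nat n * mat_trace ?W = (\<Sum>i<n. \<Sum>j<n. ?W $$ (i, j) * (if j = i then of_nat n else 0))"
  proof -
    have "(\<Sum>j<n. ?W $$ (i, j) * (if j = i then of_nat n else 0)) = (\<Sum>j<n. if j = i then of_nat n * ?W $$ (i, i) else 0)" for i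
      by (intro sum.cong refl) auto
    then show ?thesis using cW by (simp add: mat_trace_def sum_distrib_left)
  qed
  also have "\<dots> = (\<Sum>i<n. \<Sum>j<n. \<Sum>k<n. ?W $$ (i, j) * unit_root n (int k * int j) * unit_root n (- (int k * int i)))"
    by (intro sum.cong refl) (simp add: delta[symmetric] sum_distrib_left mult.assoc)
  also have "\<dots> = (\<Sum>i<n. \<Sum>k<n. (\<Sum>j<n. ?W $$ (i, j) * unit_root n (int k * int j)) * unit_root n (- (int k * int i)))"
    by (subst sum.swap[of _ "{..<n}"]) (simp add: sum_distrib_right)
  also have "\<dots> = (\<Sum>i<n. \<Sum>k<n. ?L k)"
  proof (intro sum.cong refl)
    fix i k assume i: "i \<in> {..<n}"
    have "unit_root n (int k * int i) * unit_root n (- (int k * int i)) = 1"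
      unfolding unit_root_add[symmetric] by simp
    then show "(\<Sum>j<n. ?W $$ (i, j) * unit_root n (int k * int j)) * unit_root n (- (int k * int i)) = ?L k"
      using circulant_word_eigenvector[of i n c s w k] i unfolding A_def by (simp add: mult.assoc)
  qed
  also have "\<dots> = of_nat n * (\<Sum>k<n. ?L k)" by simp
  finally show ?thesis using n by simp
qed

lemma trace_nc_eval_circulant:
  fixes c :: real and s :: "nat \<Rightarrow> nat \<Rightarrow> real"
  assumes n: "n > 0"
  shows "mat_trace (nc_eval_mat n g (mat_letter (\<lambda>v. c \<cdot>\<^sub>m circulant n (s v))))
    = (\<Sum>w\<in>Poly_Mapping.keys g. Poly_Mapping.lookup g w *
         (\<Sum>k<n. \<Prod>v\<leftarrow>w. of_real c * circ_eig n (s (fst v)) k (snd v)))"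
proof -
  let ?A = "mat_letter (\<lambda>v. c \<cdot>\<^sub>m circulant n (s v))"
  have d: "dim_row (word_mat n ?A w) = n" for w
    using word_mat_carrier[of ?A n w, OF mat_letter_circulant_carrier] by auto
  have "mat_trace (nc_eval_mat n g ?A)
      = (\<Sum>w\<in>Poly_Mapping.keys g. Poly_Mapping.lookup g w * mat_trace (word_mat n ?A w))"
    by (simp add: mat_trace_def nc_eval_mat_def d sum_distrib_left) (rule sum.swap)
  then show ?thesis by (simp add: trace_circulant_word[OF n])
qed

section \<open>Random variables with all moments and independent sigma-algebras\<close>

text \<open>For use where the single variables have exactly Gaussian moments, as Brownian increments
  do: then the moments of the sum are Gaussian with no error.\<close>

lemma moment_rec_unique:
  assumes "moment_rec J \<mu> e" "moment_rec J \<mu> e'" "finite A" "A \<subseteq> J"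
  shows "e r A = e' r A"
  using assms(3,4)
proof (induction A arbitrary: r rule: finite_induct)
  case empty
  then show ?case using moment_rec_empty[OF assms(1)] moment_rec_empty[OF assms(2)] by simp
next
  case (insert i A)
  have "A \<subseteq> J" "i \<in> J - A" using insert by auto
  from moment_rec_step[OF assms(1) insert.hyps(1) this] moment_rec_step[OF assms(2) insert.hyps(1) this]
  show ?case using insert by simp
qed

lemma moment_rec_gauss_mom: "moment_rec J (\<lambda>i j. gauss_mom j (s i)) (\<lambda>r A. gauss_mom r (\<Sum>i\<in>A. s i))"
  unfolding moment_rec_def by (simp add: gauss_mom_add)

text \<open>Integrability is not stable under products, this class is; membership of a few
  generators then settles integrability of every polynomial expression.\<close>

definition all_moments :: "'a measure \<Rightarrow> ('a \<Rightarrow> 'b::{real_normed_field, banach, second_countable_topology}) \<Rightarrow> bool" where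
  "all_moments M f \<longleftrightarrow> f \<in> borel_measurable M \<and> (\<forall>p::nat. integrable M (\<lambda>\<omega>. norm (f \<omega>) ^ p))"

lemma all_moments_measurable [measurable_dest]: "all_moments M f \<Longrightarrow> f \<in> borel_measurable M"
  by (simp add: all_moments_def)

lemma all_moments_norm_power: "all_moments M f \<Longrightarrow> integrable M (\<lambda>\<omega>. norm (f \<omega>) ^ p)"
  by (simp add: all_moments_def)

lemma all_moments_integrable: "all_moments M f \<Longrightarrow> integrable M f"
  using all_moments_norm_power[of M f 1] all_moments_measurable[of M f] by (simp add: integrable_norm_iff)

lemma all_moments_bound:
  assumes "all_moments M g" "f \<in> borel_measurable M" "AE \<omega> in M. norm (f \<omega>) \<le> norm (g \<omega>)"
  shows "all_moments M f"
  unfolding all_moments_def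
proof (intro conjI allI)
  fix p :: nat
  have "AE \<omega> in M. norm (norm (f \<omega>) ^ p) \<le> norm (norm (g \<omega>) ^ p)"
    using assms(3) by eventually_elim (simp add: power_mono)
  then show "integrable M (\<lambda>\<omega>. norm (f \<omega>) ^ p)"
    using assms(1,2) by (intro Bochner_Integration.integrable_bound[OF all_moments_norm_power]) auto
qed (fact assms(2))

text \<open>Each power \<open>x ^ p\<close> is dominated by \<open>1 + x ^ (2 * p)\<close>. This
  serves variables whose squares are the accessible objects: square roots, and moduli of complex
  Gaussians.\<close>

lemma all_moments_even:
  assumes f: "f \<in> borel_measurable M" and int: "\<And>p::nat. integrable M (\<lambda>\<omega>. norm (f \<omega>) ^ (2 * p))"
    and M: "finite_measure M"
  shows "all_moments M f"
  unfolding all_moments_def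
proof (intro conjI allI)
  fix p :: nat
  interpret finite_measure M by fact
  have "x ^ p \<le> 1 + x ^ (2 * p)" if "0 \<le> x" for x :: real
  proof (cases "x \<le> 1")
    case True
    then show ?thesis using that by (simp add: power_le_one add_increasing2)
  next
    case False
    then have "x ^ p \<le> x ^ (2 * p)" by (intro power_increasing) auto
    then show ?thesis by simp
  qed
  then have le: "AE \<omega> in M. norm (norm (f \<omega>) ^ p) \<le> norm (1 + norm (f \<omega>) ^ (2 * p))"
    by (auto intro!: AE_I2)
  have "integrable M (\<lambda>\<omega>. 1 + norm (f \<omega>) ^ (2 * p))"
    by (rule Bochner_Integration.integrable_add[OF _ int]) simp
  from Bochner_Integration.integrable_bound[OF this _ le] show "integrable M (\<lambda>\<omega>. norm (f \<omega>) ^ p)"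
    using f by simp
qed (fact f)

lemma add_power_le: "0 \<le> a \<Longrightarrow> 0 \<le> b \<Longrightarrow> (a + b) ^ p \<le> 2 ^ p * (a ^ p + b ^ p)" for a b :: real
proof -
  assume ab: "0 \<le> a" "0 \<le> b"
  have "(a + b) ^ p \<le> (2 * max a b) ^ p" using ab by (intro power_mono) auto
  also have "\<dots> = 2 ^ p * max a b ^ p" by (simp add: power_mult_distrib)
  also have "max a b ^ p \<le> a ^ p + b ^ p" using ab by (auto simp: max_def)
  finally show ?thesis by simp
qed

lemma mult_power_le: "0 \<le> a \<Longrightarrow> 0 \<le> b \<Longrightarrow> (a * b) ^ p \<le> a ^ (2 * p) + b ^ (2 * p)" for a b :: real
proof -
  assume ab: "0 \<le> a" "0 \<le> b"
  have "(a * b) ^ p \<le> (max a b * max a b) ^ p" using ab by (intro power_mono mult_mono) auto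
  also have "\<dots> = max a b ^ (2 * p)" by (simp add: power_mult power2_eq_square)
  also have "\<dots> \<le> a ^ (2 * p) + b ^ (2 * p)" using ab by (auto simp: max_def)
  finally show ?thesis .
qed

lemma all_moments_add:
  assumes "all_moments M f" "all_moments M g"
  shows "all_moments M (\<lambda>\<omega>. f \<omega> + g \<omega>)"
proof -
  note [measurable] = assms[THEN all_moments_measurable]
  have meas: "(\<lambda>\<omega>. f \<omega> + g \<omega>) \<in> borel_measurable M" by measurable
  show ?thesis unfolding all_moments_def
  proof (intro conjI allI)
    fix p :: nat
    have "norm (f \<omega> + g \<omega>) ^ p \<le> 2 ^ p * (norm (f \<omega>) ^ p + norm (g \<omega>) ^ p)" for \<omega>
      by (rule order.trans[OF power_mono[OF norm_triangle_ineq] add_power_le]) auto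
    then have le: "AE \<omega> in M. norm (norm (f \<omega> + g \<omega>) ^ p) \<le> norm (2 ^ p * (norm (f \<omega>) ^ p + norm (g \<omega>) ^ p))"
      by (auto intro!: AE_I2 order.trans[OF _ abs_ge_self])
    have "integrable M (\<lambda>\<omega>. 2 ^ p * (norm (f \<omega>) ^ p + norm (g \<omega>) ^ p))"
      using assms by (intro integrable_mult_right Bochner_Integration.integrable_add all_moments_norm_power)
    from Bochner_Integration.integrable_bound[OF this _ le] show "integrable M (\<lambda>\<omega>. norm (f \<omega> + g \<omega>) ^ p)"
      using meas by simp
  qed (fact meas)
qed

lemma all_moments_mult:
  assumes "all_moments M f" "all_moments M g"
  shows "all_moments M (\<lambda>\<omega>. f \<omega> * g \<omega>)"
proof -
  note [measurable] = assms[THEN all_moments_measurable]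
  have meas: "(\<lambda>\<omega>. f \<omega> * g \<omega>) \<in> borel_measurable M" by measurable
  show ?thesis unfolding all_moments_def
  proof (intro conjI allI)
    fix p :: nat
    have "norm (f \<omega> * g \<omega>) ^ p \<le> norm (f \<omega>) ^ (2 * p) + norm (g \<omega>) ^ (2 * p)" for \<omega>
      unfolding norm_mult by (rule mult_power_le) auto
    then have le: "AE \<omega> in M. norm (norm (f \<omega> * g \<omega>) ^ p) \<le> norm (norm (f \<omega>) ^ (2 * p) + norm (g \<omega>) ^ (2 * p))"
      by (auto intro!: AE_I2 order.trans[OF _ abs_ge_self])
    have "integrable M (\<lambda>\<omega>. norm (f \<omega>) ^ (2 * p) + norm (g \<omega>) ^ (2 * p))"
      by (rule Bochner_Integration.integrable_add) (rule all_moments_norm_power, fact)+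
    from Bochner_Integration.integrable_bound[OF this _ le] show "integrable M (\<lambda>\<omega>. norm (f \<omega> * g \<omega>) ^ p)"
      using meas by simp
  qed (fact meas)
qed

lemma (in finite_measure) all_moments_const: "all_moments M (\<lambda>_. c)"
  by (simp add: all_moments_def)

lemma (in finite_measure) all_moments_sum:
  "(\<And>i. i \<in> I \<Longrightarrow> all_moments M (f i)) \<Longrightarrow> all_moments M (\<lambda>\<omega>. \<Sum>i\<in>I. f i \<omega>)"
  by (induction I rule: infinite_finite_induct) (auto intro: all_moments_const all_moments_add)

lemma (in finite_measure) all_moments_prod:
  "(\<And>i. i \<in> I \<Longrightarrow> all_moments M (f i)) \<Longrightarrow> all_moments M (\<lambda>\<omega>. \<Prod>i\<in>I. f i \<omega>)"
  by (induction I rule: infinite_finite_induct) (auto intro: all_moments_const all_moments_mult)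

lemma (in finite_measure) all_moments_power:
  "all_moments M f \<Longrightarrow> all_moments M (\<lambda>\<omega>. f \<omega> ^ k)"
  by (induction k) (auto intro: all_moments_const all_moments_mult)

lemma (in finite_measure) all_moments_cmult:
  "all_moments M f \<Longrightarrow> all_moments M (\<lambda>\<omega>. c * f \<omega>)"
  by (intro all_moments_mult all_moments_const)

lemma all_moments_of_real:
  assumes "all_moments M f"
  shows "all_moments M (\<lambda>\<omega>. of_real (f \<omega>) :: 'b::{real_normed_field, banach, second_countable_topology})"
proof -
  have "(of_real :: real \<Rightarrow> 'b) \<in> borel_measurable borel"
    by (intro borel_measurable_continuous_onI continuous_intros)
  note m = measurable_compose[OF all_moments_measurable[OF assms] this]
  show ?thesis
    unfolding all_moments_def using m all_moments_norm_power[OF assms] by (intro conjI allI) simp_all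
qed

text \<open>One variable is split off by the binomial theorem, and independence factorises each
  term. The weights may be complex while the variables are real: no conjugate occurs, so the
  recursion concerns \<open>E Z ^ r\<close> and not absolute moments.\<close>

lemma (in prob_space) moment_rec_indep:
  fixes x :: "'i \<Rightarrow> 'a \<Rightarrow> real" and c :: "'i \<Rightarrow> complex"
  assumes indep: "indep_vars (\<lambda>_. borel) x J"
    and x: "\<And>i. i \<in> J \<Longrightarrow> all_moments M (x i)" "\<And>i. i \<in> J \<Longrightarrow> expectation (x i) = 0"
  shows "moment_rec J (\<lambda>i j. c i ^ j * of_real (expectation (\<lambda>\<omega>. x i \<omega> ^ j)))
    (\<lambda>r A. expectation (\<lambda>\<omega>. (\<Sum>i\<in>A. c i * of_real (x i \<omega>)) ^ r))"
  unfolding moment_rec_def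
proof (intro conjI allI impI ballI)
  fix A i and r :: nat
  assume A: "finite A" "A \<subseteq> J" and i: "i \<in> J - A"
  have iv: "indep_var borel (\<lambda>\<omega>. (c i * of_real (x i \<omega>)) ^ j)
      borel (\<lambda>\<omega>. (\<Sum>i\<in>A. c i * of_real (x i \<omega>)) ^ k)" for j k :: nat
  proof -
    have ind: "indep_vars (\<lambda>_. borel) x (insert i A)"
      using indep_vars_subset[OF indep] A i by auto
    have "indep_var
      borel ((\<lambda>f. (c i * of_real (f i)) ^ j) \<circ> (\<lambda>\<omega>. restrict (\<lambda>i. x i \<omega>) {i}))
      borel ((\<lambda>f. (\<Sum>i\<in>A. c i * of_real (f i)) ^ k) \<circ> (\<lambda>\<omega>. restrict (\<lambda>i. x i \<omega>) A))"
      using A i by (intro indep_var_compose[OF indep_var_restrict[OF ind]]) auto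
    also have "((\<lambda>f. (c i * of_real (f i)) ^ j) \<circ> (\<lambda>\<omega>. restrict (\<lambda>i. x i \<omega>) {i})) = (\<lambda>\<omega>. (c i * of_real (x i \<omega>)) ^ j)"
      by auto
    also have "((\<lambda>f. (\<Sum>i\<in>A. c i * of_real (f i)) ^ k) \<circ> (\<lambda>\<omega>. restrict (\<lambda>i. x i \<omega>) A)) = (\<lambda>\<omega>. (\<Sum>i\<in>A. c i * of_real (x i \<omega>)) ^ k)"
      by (auto cong: rev_conj_cong)
    finally show ?thesis .
  qed
  have mi: "all_moments M (\<lambda>\<omega>. (c i * of_real (x i \<omega>)) ^ j)" for j
    using x(1) i by (intro all_moments_power all_moments_cmult all_moments_of_real) auto
  have mA: "all_moments M (\<lambda>\<omega>. (\<Sum>i\<in>A. c i * of_real (x i \<omega>)) ^ k)" for k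
    using x(1) A by (intro all_moments_power all_moments_sum all_moments_cmult all_moments_of_real) auto
  have "expectation (\<lambda>\<omega>. (\<Sum>i\<in>insert i A. c i * of_real (x i \<omega>)) ^ r)
    = expectation (\<lambda>\<omega>. \<Sum>j\<le>r. of_nat (r choose j) * ((c i * of_real (x i \<omega>)) ^ j * (\<Sum>i\<in>A. c i * of_real (x i \<omega>)) ^ (r - j)))"
    using A i by (simp add: binomial_ring mult.assoc)
  also have "\<dots> = (\<Sum>j\<le>r. of_nat (r choose j) *
      expectation (\<lambda>\<omega>. (c i * of_real (x i \<omega>)) ^ j * (\<Sum>i\<in>A. c i * of_real (x i \<omega>)) ^ (r - j)))"
    by (subst Bochner_Integration.integral_sum)
      (auto intro!: all_moments_integrable all_moments_cmult all_moments_mult mi mA)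
  also have "\<dots> = (\<Sum>j\<le>r. of_nat (r choose j) * (c i ^ j * of_real (expectation (\<lambda>\<omega>. x i \<omega> ^ j))) *
      expectation (\<lambda>\<omega>. (\<Sum>i\<in>A. c i * of_real (x i \<omega>)) ^ (r - j)))"
  proof (rule sum.cong[OF refl])
    fix j
    have "expectation (\<lambda>\<omega>. (c i * of_real (x i \<omega>)) ^ j * (\<Sum>i\<in>A. c i * of_real (x i \<omega>)) ^ (r - j))
      = expectation (\<lambda>\<omega>. (c i * of_real (x i \<omega>)) ^ j) * expectation (\<lambda>\<omega>. (\<Sum>i\<in>A. c i * of_real (x i \<omega>)) ^ (r - j))"
      by (intro indep_var_lebesgue_integral iv all_moments_integrable mi mA)
    also have "expectation (\<lambda>\<omega>. (c i * of_real (x i \<omega>)) ^ j) = c i ^ j * of_real (expectation (\<lambda>\<omega>. x i \<omega> ^ j))"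
    proof -
      have "expectation (\<lambda>\<omega>. (c i * of_real (x i \<omega>)) ^ j) = expectation (\<lambda>\<omega>. c i ^ j * complex_of_real (x i \<omega> ^ j))"
        by (simp add: power_mult_distrib)
      also have "\<dots> = c i ^ j * expectation (\<lambda>\<omega>. complex_of_real (x i \<omega> ^ j))"
        by (rule integral_mult_right_zero)
      finally show ?thesis by (simp only: integral_complex_of_real)
    qed
    finally show "of_nat (r choose j) * expectation (\<lambda>\<omega>. (c i * of_real (x i \<omega>)) ^ j * (\<Sum>i\<in>A. c i * of_real (x i \<omega>)) ^ (r - j))
      = of_nat (r choose j) * (c i ^ j * of_real (expectation (\<lambda>\<omega>. x i \<omega> ^ j))) *
      expectation (\<lambda>\<omega>. (\<Sum>i\<in>A. c i * of_real (x i \<omega>)) ^ (r - j))" by (simp add: mult.assoc)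
  qed
  finally show "expectation (\<lambda>\<omega>. (\<Sum>i\<in>insert i A. c i * of_real (x i \<omega>)) ^ r)
    = (\<Sum>j\<le>r. of_nat (r choose j) * (c i ^ j * of_real (expectation (\<lambda>\<omega>. x i \<omega> ^ j))) *
      expectation (\<lambda>\<omega>. (\<Sum>i\<in>A. c i * of_real (x i \<omega>)) ^ (r - j)))" .
qed (auto simp: prob_space x(2))

section \<open>Integration over independent sigma-algebras\<close>

lemma (in prob_space) distr_diagonal:
  assumes A: "subalgebra M A" and B: "subalgebra M B" and ind: "indep_set (sets A) (sets B)"
  shows "distr M A (\<lambda>x. x) \<Otimes>\<^sub>M distr M B (\<lambda>x. x) = distr M (A \<Otimes>\<^sub>M B) (\<lambda>x. (x, x))"
proof -
  have m: "(\<lambda>x. x) \<in> measurable M A" "(\<lambda>x. x) \<in> measurable M B"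
    using A B by (auto simp: subalgebra_def measurable_def intro: sets.Int_space_eq2 dest: sets.sets_into_space)
  have *: "sigma_sets (space M) {(\<lambda>x. x) -` S \<inter> space M | S. S \<in> sets F} = sets F" if "subalgebra M F" for F
  proof -
    have sp: "space F = space M" using that by (simp add: subalgebra_def)
    have "{(\<lambda>x. x) -` S \<inter> space M | S. S \<in> sets F} = sets F"
      using sets.sets_into_space[of _ F] unfolding sp by (auto simp: Int_absorb2 intro!: exI)
    then show ?thesis using sets.sigma_sets_eq[of F] sp by simp
  qed
  \<comment> \<open>The identity map, read once into \<open>A\<close> and once into
    \<open>B\<close>, is a pair of independent variables whose joint law is the image of
    \<open>M\<close> under the diagonal.\<close>
  have "indep_var A (\<lambda>x. x) B (\<lambda>x. x)"
    unfolding indep_var_eq using m ind *[OF A] *[OF B] by simp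
  then show ?thesis unfolding indep_var_distribution_eq by simp
qed

text \<open>Fubini for the image of \<open>M\<close> under the diagonal: the
  \<open>B\<close>-variable is frozen at an independent copy \<open>\<omega>'\<close>. Nothing has
  to be integrable, so this version is the one that proves finiteness of moments at random
  times.\<close>

lemma (in prob_space) freezing_nn:
  assumes A: "subalgebra M A" and B: "subalgebra M B" and ind: "indep_set (sets A) (sets B)"
    and f: "case_prod f \<in> borel_measurable (A \<Otimes>\<^sub>M B)"
  shows "(\<integral>\<^sup>+\<omega>. f \<omega> \<omega> \<partial>M) = (\<integral>\<^sup>+\<omega>'. (\<integral>\<^sup>+\<omega>. f \<omega> \<omega>' \<partial>M) \<partial>M)"
proof -
  have mA: "(\<lambda>x. x) \<in> measurable M A" and mB: "(\<lambda>x. x) \<in> measurable M B"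
    using A B by (auto simp: subalgebra_def measurable_def intro: sets.Int_space_eq2 dest: sets.sets_into_space)
  interpret DA: prob_space "distr M A (\<lambda>x. x)" by (rule prob_space_distr[OF mA])
  interpret DB: prob_space "distr M B (\<lambda>x. x)" by (rule prob_space_distr[OF mB])
  interpret P: pair_prob_space "distr M A (\<lambda>x. x)" "distr M B (\<lambda>x. x)" ..
  have f': "case_prod f \<in> borel_measurable (distr M A (\<lambda>x. x) \<Otimes>\<^sub>M distr M B (\<lambda>x. x))"
    using f by (simp add: measurable_cong_sets[OF sets_pair_measure_cong[OF sets_distr sets_distr] refl])
  have "(\<integral>\<^sup>+\<omega>. f \<omega> \<omega> \<partial>M) = (\<integral>\<^sup>+z. case_prod f z \<partial>distr M (A \<Otimes>\<^sub>M B) (\<lambda>x. (x, x)))"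
    by (subst nn_integral_distr) (auto intro: measurable_Pair mA mB f)
  also have "\<dots> = (\<integral>\<^sup>+\<omega>'. (\<integral>\<^sup>+\<omega>. f \<omega> \<omega>' \<partial>distr M A (\<lambda>x. x)) \<partial>distr M B (\<lambda>x. x))"
    unfolding distr_diagonal[OF A B ind, symmetric] P.nn_integral_snd[OF f', symmetric] by simp
  also have "\<dots> = (\<integral>\<^sup>+\<omega>'. (\<integral>\<^sup>+\<omega>. f \<omega> \<omega>' \<partial>distr M A (\<lambda>x. x)) \<partial>M)"
    using DA.borel_measurable_nn_integral_fst[of "\<lambda>(y, x). f x y" B] f
    by (subst nn_integral_distr[OF mB]) (auto simp: measurable_pair_swap_iff[of _ A B] case_prod_beta')
  also have "\<dots> = (\<integral>\<^sup>+\<omega>'. (\<integral>\<^sup>+\<omega>. f \<omega> \<omega>' \<partial>M) \<partial>M)"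
  proof (rule nn_integral_cong)
    fix \<omega>' assume "\<omega>' \<in> space M"
    then have "\<omega>' \<in> space B" using B by (simp add: subalgebra_def)
    then have "(\<lambda>\<omega>. f \<omega> \<omega>') \<in> borel_measurable A"
      using measurable_compose[OF measurable_Pair2'[of \<omega>' B A] f] by simp
    then show "(\<integral>\<^sup>+\<omega>. f \<omega> \<omega>' \<partial>distr M A (\<lambda>x. x)) = (\<integral>\<^sup>+\<omega>. f \<omega> \<omega>' \<partial>M)"
      by (subst nn_integral_distr[OF mA]) auto
  qed
  finally show ?thesis .
qed

lemma (in prob_space) freezing:
  fixes f :: "'a \<Rightarrow> 'a \<Rightarrow> 'b::{banach, second_countable_topology}"
  assumes A: "subalgebra M A" and B: "subalgebra M B" and ind: "indep_set (sets A) (sets B)"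
    and f: "case_prod f \<in> borel_measurable (A \<Otimes>\<^sub>M B)" and int: "integrable M (\<lambda>\<omega>. f \<omega> \<omega>)"
  shows "(\<integral>\<omega>. f \<omega> \<omega> \<partial>M) = (\<integral>\<omega>'. (\<integral>\<omega>. f \<omega> \<omega>' \<partial>M) \<partial>M)"
    and "integrable M (\<lambda>\<omega>'. \<integral>\<omega>. f \<omega> \<omega>' \<partial>M)"
proof -
  have mA: "(\<lambda>x. x) \<in> measurable M A" and mB: "(\<lambda>x. x) \<in> measurable M B"
    using A B by (auto simp: subalgebra_def measurable_def intro: sets.Int_space_eq2 dest: sets.sets_into_space)
  interpret DA: prob_space "distr M A (\<lambda>x. x)" by (rule prob_space_distr[OF mA])
  interpret DB: prob_space "distr M B (\<lambda>x. x)" by (rule prob_space_distr[OF mB])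
  interpret P: pair_prob_space "distr M A (\<lambda>x. x)" "distr M B (\<lambda>x. x)" ..
  have mm: "(\<lambda>x. (x, x)) \<in> measurable M (A \<Otimes>\<^sub>M B)" by (intro measurable_Pair mA mB)
  have "integrable (distr M (A \<Otimes>\<^sub>M B) (\<lambda>x. (x, x))) (case_prod f)"
    by (subst integrable_distr_eq[OF mm f]) (simp add: int)
  then have int': "integrable (distr M A (\<lambda>x. x) \<Otimes>\<^sub>M distr M B (\<lambda>x. x)) (case_prod f)"
    unfolding distr_diagonal[OF A B ind] .
  have inner: "(\<integral>\<omega>. f \<omega> \<omega>' \<partial>distr M A (\<lambda>x. x)) = (\<integral>\<omega>. f \<omega> \<omega>' \<partial>M)" if "\<omega>' \<in> space M" for \<omega>'
  proof -
    have "\<omega>' \<in> space B" using B that by (simp add: subalgebra_def)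
    then have "(\<lambda>\<omega>. f \<omega> \<omega>') \<in> borel_measurable A"
      using measurable_compose[OF measurable_Pair2'[of \<omega>' B A] f] by simp
    then show ?thesis by (subst integral_distr[OF mA]) auto
  qed
  have i2: "integrable (distr M B (\<lambda>x. x)) (\<lambda>\<omega>'. \<integral>\<omega>. f \<omega> \<omega>' \<partial>distr M A (\<lambda>x. x))"
    using P.integrable_snd[OF int'] by simp
  have meas: "(\<lambda>\<omega>'. \<integral>\<omega>. f \<omega> \<omega>' \<partial>distr M A (\<lambda>x. x)) \<in> borel_measurable B"
    using borel_measurable_integrable[OF i2] by simp
  have "integrable M (\<lambda>\<omega>'. \<integral>\<omega>. f \<omega> \<omega>' \<partial>distr M A (\<lambda>x. x))"
    using i2 by (subst (asm) integrable_distr_eq[OF mB meas]) simp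
  then show "integrable M (\<lambda>\<omega>'. \<integral>\<omega>. f \<omega> \<omega>' \<partial>M)"
    by - (rule Bochner_Integration.integrable_cong[THEN iffD1, OF refl inner])
  have "(\<integral>\<omega>. f \<omega> \<omega> \<partial>M) = (\<integral>z. case_prod f z \<partial>distr M (A \<Otimes>\<^sub>M B) (\<lambda>x. (x, x)))"
    by (subst integral_distr[OF mm f]) simp
  also have "\<dots> = (\<integral>\<omega>'. (\<integral>\<omega>. f \<omega> \<omega>' \<partial>distr M A (\<lambda>x. x)) \<partial>distr M B (\<lambda>x. x))"
    unfolding distr_diagonal[OF A B ind, symmetric] P.integral_snd[OF int', symmetric] by simp
  also have "\<dots> = (\<integral>\<omega>'. (\<integral>\<omega>. f \<omega> \<omega>' \<partial>distr M A (\<lambda>x. x)) \<partial>M)"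
    by (subst integral_distr[OF mB meas]) simp
  also have "\<dots> = (\<integral>\<omega>'. (\<integral>\<omega>. f \<omega> \<omega>' \<partial>M) \<partial>M)"
    by (rule Bochner_Integration.integral_cong[OF refl]) (rule inner)
  finally show "(\<integral>\<omega>. f \<omega> \<omega> \<partial>M) = (\<integral>\<omega>'. (\<integral>\<omega>. f \<omega> \<omega>' \<partial>M) \<partial>M)" .
qed

text \<open>Packages the generated family as a measurable space, so that measurability with respect
  to it and products with it can be expressed.\<close>

definition process_measure :: "'a measure \<Rightarrow> 'i set \<Rightarrow> ('i \<Rightarrow> 'a \<Rightarrow> 'b::topological_space) \<Rightarrow> 'a measure" where
  "process_measure M I Z = sigma (space M) (\<Union>i\<in>I. {Z i -` A \<inter> space M | A. A \<in> sets borel})"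

lemma process_measure_gen: "(\<Union>i\<in>I. {Z i -` A \<inter> space M | A. A \<in> sets borel}) \<subseteq> Pow (space M)"
  by auto

lemma sets_process_measure: "sets (process_measure M I Z) = process_algebra M I Z"
  unfolding process_measure_def process_algebra_def by (rule sets_measure_of[OF process_measure_gen])

lemma space_process_measure [simp]: "space (process_measure M I Z) = space M"
  unfolding process_measure_def by (rule space_measure_of[OF process_measure_gen])

lemma measurable_process_measure: "i \<in> I \<Longrightarrow> Z i \<in> borel_measurable (process_measure M I Z)"
  unfolding measurable_def sets_process_measure process_algebra_def
  by (auto intro!: sigma_sets.Basic)

lemma process_algebra_least:
  assumes "space A = space M" "\<And>i. i \<in> I \<Longrightarrow> Z i \<in> borel_measurable A"
  shows "process_algebra M I Z \<subseteq> sets A"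
  unfolding process_algebra_def
proof (rule sets.sigma_sets_subset[of _ A, unfolded assms(1)])
  show "(\<Union>i\<in>I. {Z i -` S \<inter> space M |S. S \<in> sets borel}) \<subseteq> sets A"
    using measurable_sets[OF assms(2)] unfolding assms(1) by blast
qed

lemma subalgebra_process_measure:
  "(\<And>i. i \<in> I \<Longrightarrow> Z i \<in> borel_measurable M) \<Longrightarrow> subalgebra M (process_measure M I Z)"
  unfolding subalgebra_def sets_process_measure by (intro conjI space_process_measure process_algebra_least refl)

section \<open>Eigenvalues of random walk circulants\<close>

text \<open>Comparison with the largest summand is crude, but enough for integrability. The
  \<open>1 +\<close> is for empty \<open>A\<close> and \<open>p = 0\<close>.\<close>

lemma norm_sum_power_le:
  fixes x :: "'i \<Rightarrow> 'b::real_normed_vector"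
  assumes A: "finite A"
  shows "norm (\<Sum>i\<in>A. x i) ^ p \<le> real (card A) ^ p * (1 + (\<Sum>i\<in>A. norm (x i) ^ p))"
proof (cases "A = {}")
  case True
  then show ?thesis by simp
next
  case False
  define y where "y = Max ((\<lambda>i. norm (x i)) ` A)"
  have y: "y \<in> (\<lambda>i. norm (x i)) ` A" unfolding y_def using A False by (intro Max_in) auto
  have le: "norm (x i) \<le> y" if "i \<in> A" for i unfolding y_def using A that by (intro Max_ge) auto
  have "norm (\<Sum>i\<in>A. x i) \<le> real (card A) * y"
    using sum_norm_le[of A x "\<lambda>_. y"] le by simp
  then have "norm (\<Sum>i\<in>A. x i) ^ p \<le> (real (card A) * y) ^ p" by (rule power_mono) simp
  also have "\<dots> = real (card A) ^ p * y ^ p" by (rule power_mult_distrib)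
  also have "y ^ p \<le> 1 + (\<Sum>i\<in>A. norm (x i) ^ p)"
  proof -
    from y obtain i where "i \<in> A" "y = norm (x i)" by blast
    then have "y ^ p \<le> (\<Sum>i\<in>A. norm (x i) ^ p)"
      using member_le_sum[of i A "\<lambda>i. norm (x i) ^ p"] A by simp
    then show ?thesis by simp
  qed
  finally show ?thesis by (simp add: mult_left_mono)
qed

text \<open>The variance \<open>E Z\<^sup>2\<close> of \<open>Z = (\<Sum>p\<in>S. Z p)\<close>, where \<open>Z p\<close> is complex Brownian motion at time
  \<open>u p\<close>, conjugated if \<open>b p\<close>.\<close>

definition conj_cov :: "'p set \<Rightarrow> ('p \<Rightarrow> bool) \<Rightarrow> ('p \<Rightarrow> real) \<Rightarrow> real" where
  "conj_cov S b u = (\<Sum>p\<in>S. \<Sum>q\<in>S. if b p \<noteq> b q then min (u p) (u q) else 0)"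

definition walk :: "(nat \<Rightarrow> nat \<Rightarrow> 'a \<Rightarrow> real) \<Rightarrow> nat \<Rightarrow> 'a \<Rightarrow> nat \<Rightarrow> real" where
  "walk X m \<omega> i = (\<Sum>l=1..m. X i l \<omega>)"

text \<open>The weight of the single step \<open>X i l\<close>, with \<open>x = (i, l)\<close>, in a
  sum of eigenvalues over \<open>S\<close>: every walk that has already made step \<open>l\<close>
  contributes its root of unity.\<close>

definition walk_coeff :: "'p set \<Rightarrow> ('p \<Rightarrow> bool) \<Rightarrow> ('p \<Rightarrow> nat) \<Rightarrow> nat \<Rightarrow> nat \<Rightarrow> nat \<times> nat \<Rightarrow> complex" where
  "walk_coeff S b m n k x =
     (\<Sum>p\<in>S. if snd x \<le> m p then unit_root n (letter_sign (b p) * int k * int (fst x)) else 0)"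

lemma norm_walk_coeff: "norm (walk_coeff S b m n k x) \<le> real (card S)"
proof -
  have "norm (walk_coeff S b m n k x) \<le> (\<Sum>p\<in>S. 1)"
    unfolding walk_coeff_def by (rule sum_norm_le) auto
  then show ?thesis by simp
qed

text \<open>All walks are padded to a common length \<open>R\<close>, so that the sum runs over one
  rectangle of independent steps.\<close>

lemma sum_circ_eig_walk:
  assumes S: "finite S" and R: "\<And>p. p \<in> S \<Longrightarrow> m p \<le> R"
  shows "(\<Sum>p\<in>S. circ_eig n (walk X (m p) \<omega>) k (b p))
    = (\<Sum>x\<in>{..<n} \<times> {1..R}. walk_coeff S b m n k x * of_real (case x of (i, l) \<Rightarrow> X i l \<omega>))"
proof -
  let ?u = "\<lambda>p j. unit_root n (letter_sign (b p) * int k * int j)"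
  have "(\<Sum>x\<in>{..<n} \<times> {1..R}. walk_coeff S b m n k x * of_real (case x of (i, l) \<Rightarrow> X i l \<omega>))
    = (\<Sum>x\<in>{..<n} \<times> {1..R}. \<Sum>p\<in>S. (if snd x \<le> m p then ?u p (fst x) * of_real (X (fst x) (snd x) \<omega>) else 0))"
    unfolding walk_coeff_def sum_distrib_right by (intro sum.cong refl) (auto simp: case_prod_beta)
  also have "\<dots> = (\<Sum>p\<in>S. \<Sum>x\<in>{..<n} \<times> {1..R}. (if snd x \<le> m p then ?u p (fst x) * of_real (X (fst x) (snd x) \<omega>) else 0))"
    by (rule sum.swap)
  also have "\<dots> = (\<Sum>p\<in>S. circ_eig n (walk X (m p) \<omega>) k (b p))"
  proof (rule sum.cong[OF refl])
    fix p assume p: "p \<in> S"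
    have "(\<Sum>x\<in>{..<n} \<times> {1..R}. (if snd x \<le> m p then ?u p (fst x) * of_real (X (fst x) (snd x) \<omega>) else 0))
      = (\<Sum>j<n. \<Sum>l=1..R. (if l \<le> m p then ?u p j * of_real (X j l \<omega>) else 0))"
      by (simp add: sum.cartesian_product case_prod_beta)
    also have "\<dots> = (\<Sum>j<n. \<Sum>l=1..m p. ?u p j * of_real (X j l \<omega>))"
      using R[OF p] by (intro sum.cong[OF refl] sum.mono_neutral_cong_right) auto
    also have "\<dots> = circ_eig n (walk X (m p) \<omega>) k (b p)"
      by (simp add: circ_eig_def walk_def sum_distrib_left sum_distrib_right mult.commute)
    finally show "(\<Sum>x\<in>{..<n} \<times> {1..R}. (if snd x \<le> m p then ?u p (fst x) * of_real (X (fst x) (snd x) \<omega>) else 0))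
      = circ_eig n (walk X (m p) \<omega>) k (b p)" .
  qed
  finally show ?thesis ..
qed

text \<open>Unless \<open>n\<close> divides \<open>2 * k\<close>, only pairs of letters of opposite type survive
  the summation over roots of unity.\<close>

lemma sum_walk_coeff_square:
  assumes S: "finite S" and R: "\<And>p. p \<in> S \<Longrightarrow> m p \<le> R" and n: "n > 0" and k: "\<not> int n dvd 2 * int k"
  shows "(\<Sum>x\<in>{..<n} \<times> {1..R}. (walk_coeff S b m n k x)\<^sup>2) = of_real (real n * conj_cov S b (\<lambda>p. real (m p)))"
proof -
  let ?u = "\<lambda>p j. unit_root n (letter_sign (b p) * int k * int j)"
  let ?g = "\<lambda>p q x. if snd x \<le> m p \<and> snd x \<le> m q then ?u p (fst x) * ?u q (fst x) else 0"
  have "(\<Sum>x\<in>{..<n} \<times> {1..R}. (walk_coeff S b m n k x)\<^sup>2) = (\<Sum>x\<in>{..<n} \<times> {1..R}. \<Sum>p\<in>S. \<Sum>q\<in>S. ?g p q x)"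
    unfolding walk_coeff_def power2_eq_square sum_product by (intro sum.cong refl) auto
  also have "\<dots> = (\<Sum>p\<in>S. \<Sum>x\<in>{..<n} \<times> {1..R}. \<Sum>q\<in>S. ?g p q x)" by (rule sum.swap)
  also have "\<dots> = (\<Sum>p\<in>S. \<Sum>q\<in>S. \<Sum>x\<in>{..<n} \<times> {1..R}. ?g p q x)"
    by (intro sum.cong[OF refl] sum.swap)
  also have "\<dots> = (\<Sum>p\<in>S. \<Sum>q\<in>S. of_real (real n * (if b p \<noteq> b q then min (real (m p)) (real (m q)) else 0)))"
  proof (intro sum.cong[OF refl])
    fix p q assume pq: "p \<in> S" "q \<in> S"
    have "(\<Sum>x\<in>{..<n} \<times> {1..R}. ?g p q x) = (\<Sum>j<n. \<Sum>l=1..R. if l \<le> m p \<and> l \<le> m q then ?u p j * ?u q j else 0)"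
      by (simp add: sum.cartesian_product case_prod_beta)
    \<comment> \<open>A step counts for the pair only if both walks have made it; this is the source
      of the minimum.\<close>
    also have "\<dots> = (\<Sum>j<n. \<Sum>l=1..min (m p) (m q). ?u p j * ?u q j)"
      using R[OF pq(1)] by (intro sum.cong[OF refl] sum.mono_neutral_cong_right) auto
    also have "\<dots> = of_nat (min (m p) (m q)) * (\<Sum>j<n. ?u p j * ?u q j)"
      by (simp add: sum_distrib_left)
    also have "(\<Sum>j<n. ?u p j * ?u q j) = (\<Sum>j<n. unit_root n (((letter_sign (b p) + letter_sign (b q)) * int k) * int j))"
      unfolding unit_root_add[symmetric] by (simp add: algebra_simps)
    also have "\<dots> = (if b p \<noteq> b q then of_nat n else 0)"
      unfolding sum_unit_root[OF n] using k by (auto simp: letter_sign_def)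
    also have "of_nat (min (m p) (m q)) * (if b p \<noteq> b q then of_nat n else 0)
      = complex_of_real (real n * (if b p \<noteq> b q then min (real (m p)) (real (m q)) else 0))"
      by (auto simp: min_def)
    finally show "(\<Sum>x\<in>{..<n} \<times> {1..R}. ?g p q x)
      = complex_of_real (real n * (if b p \<noteq> b q then min (real (m p)) (real (m q)) else 0))" .
  qed
  also have "\<dots> = of_real (real n * conj_cov S b (\<lambda>p. real (m p)))"
    by (simp add: conj_cov_def sum_distrib_left)
  finally show ?thesis .
qed

text \<open>One sequence \<open>D\<close> serves all entries and all orders, including those below
  three; the constants in the estimates then depend on the array only through it.\<close>

locale bounded_array = prob_space M for M :: "'a measure" +
  fixes X :: "nat \<Rightarrow> nat \<Rightarrow> 'a \<Rightarrow> real" and D :: "nat \<Rightarrow> real"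
  assumes indep_X: "indep_vars (\<lambda>_. borel) (\<lambda>(i, k). X i k) (UNIV \<times> {1..})"
    and moments_X: "\<And>i k. 1 \<le> k \<Longrightarrow> all_moments M (X i k)"
    and mean_X: "\<And>i k. 1 \<le> k \<Longrightarrow> expectation (X i k) = 0"
    and var_X: "\<And>i k. 1 \<le> k \<Longrightarrow> expectation (\<lambda>\<omega>. X i k \<omega> ^ 2) = 1"
    and bound_X: "\<And>i k j. 1 \<le> k \<Longrightarrow> expectation (\<lambda>\<omega>. \<bar>X i k \<omega>\<bar> ^ j) \<le> D j"
begin

lemma D_nonneg: "0 \<le> D j"
proof -
  have "0 \<le> expectation (\<lambda>\<omega>. \<bar>X 0 1 \<omega>\<bar> ^ j)" by simp
  also have "\<dots> \<le> D j" by (rule bound_X) simp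
  finally show ?thesis .
qed

text \<open>The steps involved number at most \<open>P ^ 2\<close>, with \<open>P\<close> the square
  root of \<open>n * (1 + (\<Sum>p\<in>S. m p))\<close>, so both general estimates apply with
  \<open>p = P\<close>; the \<open>1 +\<close> under the root keeps \<open>P \<ge> 1\<close> when
  all counts vanish. Uniformity in \<open>m\<close> matters, since the counts will be replaced by
  random ones.\<close>

lemma walk_moment_bounds:
  assumes S: "finite (S :: 'p set)"
  shows "\<exists>B\<ge>0. \<forall>n k (m :: 'p \<Rightarrow> nat) b. 1 \<le> n \<longrightarrow>
    norm (expectation (\<lambda>\<omega>. (\<Sum>p\<in>S. circ_eig n (walk X (m p) \<omega>) k (b p)) ^ r))
      \<le> B * sqrt (real n * (1 + (\<Sum>p\<in>S. real (m p)))) ^ r \<and>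
    (\<not> int n dvd 2 * int k \<longrightarrow> sqrt (real n) *
       norm (expectation (\<lambda>\<omega>. (\<Sum>p\<in>S. circ_eig n (walk X (m p) \<omega>) k (b p)) ^ r)
         - gauss_mom r (of_real (real n * conj_cov S b (\<lambda>p. real (m p)))))
      \<le> B * sqrt (real n * (1 + (\<Sum>p\<in>S. real (m p)))) ^ r)"
proof -
  \<comment> \<open>\<open>card S\<close> bounds the weights; \<open>D t\<close> dominates the
    moments of the entries and \<open>gauss_mom t 1\<close> those of the Gaussian
    substitutes.\<close>
  define D' where "D' = (\<lambda>t. real (card S) ^ t * (D t + norm (gauss_mom t 1)))"
  have D': "0 \<le> D' t" for t unfolding D'_def using D_nonneg[of t] by simp
  obtain B1 where B1: "B1 \<ge> 0" and b1: "\<And>(J::(nat \<times> nat) set) \<mu> e A p. moment_rec J \<mu> e \<Longrightarrow>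
      (\<forall>i\<in>J. \<forall>j. norm (\<mu> i j) \<le> D' j) \<Longrightarrow>
      finite A \<Longrightarrow> A \<subseteq> J \<Longrightarrow> 1 \<le> p \<Longrightarrow> real (card A) \<le> p\<^sup>2 \<Longrightarrow> norm (e r A) \<le> B1 * p ^ r"
    using moment_rec_bound[of D' r, where 'i = "nat \<times> nat", OF D'] by (elim exE conjE) blast
  obtain B2 where B2: "B2 \<ge> 0" and b2: "\<And>(J::(nat \<times> nat) set) \<mu> \<mu>' e e' A p. moment_rec J \<mu> e \<Longrightarrow> moment_rec J \<mu>' e' \<Longrightarrow>
      (\<forall>i\<in>J. \<forall>j. norm (\<mu> i j) \<le> D' j \<and> norm (\<mu>' i j) \<le> D' j) \<Longrightarrow> (\<forall>i\<in>J. \<mu> i 2 = \<mu>' i 2) \<Longrightarrow>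
      finite A \<Longrightarrow> A \<subseteq> J \<Longrightarrow> 1 \<le> p \<Longrightarrow> real (card A) \<le> p\<^sup>2 \<Longrightarrow> p * norm (e r A - e' r A) \<le> B2 * p ^ r"
    using moment_rec_diff[of D' r, where 'i = "nat \<times> nat", OF D'] by (elim exE conjE) blast
  show ?thesis
  proof (intro exI[of _ "B1 + B2"] conjI allI impI)
    show "0 \<le> B1 + B2" using B1 B2 by simp
    fix n k :: nat and m :: "'p \<Rightarrow> nat" and b :: "'p \<Rightarrow> bool"
    assume n: "1 \<le> n"
    define R where "R = (\<Sum>p\<in>S. m p)"
    define P where "P = sqrt (real n * (1 + (\<Sum>p\<in>S. real (m p))))"
    define I where "I = {..<n} \<times> {1..R}"
    define J :: "(nat \<times> nat) set" where "J = UNIV \<times> {1..}"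
    define x where "x = (\<lambda>(i, l). X i l)"
    define c where "c = walk_coeff S b m n k"
    define \<mu> where "\<mu> = (\<lambda>i j. c i ^ j * of_real (expectation (\<lambda>\<omega>. x i \<omega> ^ j)))"
    define e where "e = (\<lambda>r A. expectation (\<lambda>\<omega>. (\<Sum>i\<in>A. c i * of_real (x i \<omega>)) ^ r))"
    \<comment> \<open>The substitute for a step with weight \<open>c i\<close> is a Gaussian of
      complex variance \<open>(c i) ^ 2\<close>, present only through its moment sequence. Unit
      variance of the entries makes the second moments agree.\<close>
    define \<mu>' where "\<mu>' = (\<lambda>i j. gauss_mom j ((c i)\<^sup>2))"
    define e' where "e' = (\<lambda>r A. gauss_mom r (\<Sum>i\<in>A. (c i)\<^sup>2))"
    have R: "m p \<le> R" if "p \<in> S" for p unfolding R_def using S that by (rule member_le_sum[rotated 2]) auto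
    have mr: "moment_rec J \<mu> e" unfolding \<mu>_def e_def
      by (rule moment_rec_indep) (use indep_X moments_X mean_X in \<open>auto simp: x_def J_def\<close>)
    have mr': "moment_rec J \<mu>' e'" unfolding \<mu>'_def e'_def by (rule moment_rec_gauss_mom)
    have P1: "1 \<le> P" unfolding P_def
    proof -
      have "1 * 1 \<le> real n * (1 + (\<Sum>p\<in>S. real (m p)))"
        using n by (intro mult_mono) (auto intro: sum_nonneg)
      then show "1 \<le> sqrt (real n * (1 + (\<Sum>p\<in>S. real (m p))))" by simp
    qed
    have "P\<^sup>2 = real n * (1 + (\<Sum>p\<in>S. real (m p)))" unfolding P_def
      by (rule real_sqrt_pow2) (auto intro!: mult_nonneg_nonneg add_nonneg_nonneg sum_nonneg)
    then have cardI: "real (card I) \<le> P\<^sup>2" by (simp add: I_def R_def algebra_simps)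
    have I: "finite I" "I \<subseteq> J" by (auto simp: I_def J_def)
    have sumI: "(\<Sum>p\<in>S. circ_eig n (walk X (m p) \<omega>) k (b p)) = (\<Sum>i\<in>I. c i * of_real (x i \<omega>))" for \<omega>
      unfolding I_def c_def x_def using sum_circ_eig_walk[OF S R] by (simp add: case_prod_beta)
    have eI: "expectation (\<lambda>\<omega>. (\<Sum>p\<in>S. circ_eig n (walk X (m p) \<omega>) k (b p)) ^ r) = e r I"
      unfolding e_def sumI ..
    have nc: "norm (c i) ^ j \<le> real (card S) ^ j" for i j
      unfolding c_def by (rule power_mono[OF norm_walk_coeff]) simp
    have mu1: "norm (\<mu> i j) \<le> D' j" if "i \<in> J" for i j
    proof -
      have "\<bar>expectation (\<lambda>\<omega>. x i \<omega> ^ j)\<bar> \<le> expectation (\<lambda>\<omega>. \<bar>x i \<omega> ^ j\<bar>)"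
        using integral_norm_bound[of M "\<lambda>\<omega>. x i \<omega> ^ j"] by simp
      also have "\<dots> \<le> D j" using that bound_X by (auto simp: power_abs x_def J_def)
      finally have "norm (c i) ^ j * \<bar>expectation (\<lambda>\<omega>. x i \<omega> ^ j)\<bar> \<le> real (card S) ^ j * D j"
        using nc by (intro mult_mono) auto
      also have "\<dots> \<le> D' j" unfolding D'_def by (rule mult_left_mono) auto
      finally show ?thesis by (simp add: \<mu>_def norm_mult norm_power)
    qed
    have mu2: "norm (\<mu>' i j) \<le> D' j" for i j
    proof -
      have "norm (\<mu>' i j) = norm (c i) ^ j * norm (gauss_mom j 1)"
        unfolding \<mu>'_def using gauss_mom_scale[of j "c i" 1] by (simp add: norm_mult norm_power)
      also have "\<dots> \<le> real (card S) ^ j * norm (gauss_mom j 1)" using nc by (intro mult_right_mono) auto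
      also have "\<dots> \<le> D' j" unfolding D'_def using D_nonneg by (intro mult_left_mono) auto
      finally show ?thesis .
    qed
    have mu3: "\<mu> i 2 = \<mu>' i 2" if "i \<in> J" for i
      using that var_X by (auto simp: \<mu>_def \<mu>'_def x_def J_def)
    have "norm (e r I) \<le> B1 * P ^ r" using b1[OF mr _ I P1 cardI] mu1 by blast
    also have "\<dots> \<le> (B1 + B2) * P ^ r" using B2 P1 by (intro mult_right_mono) auto
    finally show "norm (expectation (\<lambda>\<omega>. (\<Sum>p\<in>S. circ_eig n (walk X (m p) \<omega>) k (b p)) ^ r))
      \<le> (B1 + B2) * sqrt (real n * (1 + (\<Sum>p\<in>S. real (m p)))) ^ r" unfolding eI P_def .
    assume k: "\<not> int n dvd 2 * int k"
    have e'I: "gauss_mom r (of_real (real n * conj_cov S b (\<lambda>p. real (m p)))) = e' r I"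
      unfolding e'_def c_def I_def using sum_walk_coeff_square[OF S R _ k] n by simp
    have "sqrt (real n) \<le> P" unfolding P_def real_sqrt_le_iff using n
      by (auto intro!: sum_nonneg simp: mult_le_cancel_left1)
    then have "sqrt (real n) * norm (e r I - e' r I) \<le> P * norm (e r I - e' r I)"
      by (rule mult_right_mono) simp
    also have "\<dots> \<le> B2 * P ^ r" using b2[OF mr mr' _ _ I P1 cardI] mu1 mu2 mu3 by blast
    also have "\<dots> \<le> (B1 + B2) * P ^ r" using B1 P1 by (intro mult_right_mono) auto
    finally show "sqrt (real n) * norm (expectation (\<lambda>\<omega>. (\<Sum>p\<in>S. circ_eig n (walk X (m p) \<omega>) k (b p)) ^ r)
         - gauss_mom r (of_real (real n * conj_cov S b (\<lambda>p. real (m p)))))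
      \<le> (B1 + B2) * sqrt (real n * (1 + (\<Sum>p\<in>S. real (m p)))) ^ r"
      unfolding eI e'I P_def .
  qed
qed

end

section \<open>Walks with a random number of steps\<close>

lemma (in prob_space) freezing_processes:
  assumes Y: "\<And>i. i \<in> I \<Longrightarrow> Y i \<in> borel_measurable M" and Z: "\<And>j. j \<in> J \<Longrightarrow> Z j \<in> borel_measurable M"
    and ind: "independent_processes M I Y J Z"
  shows "subalgebra M (process_measure M I Y)" "subalgebra M (process_measure M J Z)"
    "indep_set (sets (process_measure M I Y)) (sets (process_measure M J Z))"
  using subalgebra_process_measure[of I Y M] subalgebra_process_measure[of J Z M] Y Z ind
  by (simp_all add: independent_processes_def sets_process_measure)

lemma sum_power_PiE:
  fixes f :: "'q \<Rightarrow> 'b::comm_semiring_1"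
  assumes "finite Q"
  shows "(\<Sum>q\<in>Q. f q) ^ h = (\<Sum>g\<in>PiE {..<h} (\<lambda>_. Q). \<Prod>i<h. f (g i))"
proof -
  have "(\<Sum>q\<in>Q. f q) ^ h = (\<Prod>i<h. \<Sum>q\<in>Q. f q)" by simp
  also have "\<dots> = (\<Sum>g\<in>PiE {..<h} (\<lambda>_. Q). \<Prod>i<h. f (g i))"
    by (rule prod_sum_PiE) (use assms in auto)
  finally show ?thesis .
qed

text \<open>Expanding the power as a sum over functions from \<open>{..<h}\<close> to
  \<open>Q\<close> reduces it to product moments, the form in which the asymptotics of the counts
  are known. The two families live on different spaces, so only expectations can be
  compared.\<close>

lemma tendsto_expectation_power_sum:
  fixes y :: "nat \<Rightarrow> 'q \<Rightarrow> 'a \<Rightarrow> real" and z :: "'q \<Rightarrow> 'b \<Rightarrow> real"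
  assumes Q: "finite Q" and M: "prob_space M" and P: "prob_space P"
    and y: "\<And>n q. q \<in> Q \<Longrightarrow> all_moments M (y n q)" and z: "\<And>q. q \<in> Q \<Longrightarrow> all_moments P (z q)"
    and lim: "\<And>g. (\<And>i. i < h \<Longrightarrow> g i \<in> Q) \<Longrightarrow>
      (\<lambda>n. \<integral>\<omega>. (\<Prod>i<h. y n (g i) \<omega>) \<partial>M) \<longlonglongrightarrow> (\<integral>\<omega>. (\<Prod>i<h. z (g i) \<omega>) \<partial>P)"
  shows "(\<lambda>n. \<integral>\<omega>. (\<Sum>q\<in>Q. a q * y n q \<omega>) ^ h \<partial>M) \<longlonglongrightarrow> (\<integral>\<omega>. (\<Sum>q\<in>Q. a q * z q \<omega>) ^ h \<partial>P)"
proof -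
  interpret M: prob_space M by fact
  interpret P: prob_space P by fact
  let ?F = "PiE {..<h} (\<lambda>_. Q)"
  have mem: "g i \<in> Q" if "g \<in> ?F" "i < h" for g i using that by auto
  have My: "(\<integral>\<omega>. (\<Sum>q\<in>Q. a q * y n q \<omega>) ^ h \<partial>M)
      = (\<Sum>g\<in>?F. (\<Prod>i<h. a (g i)) * (\<integral>\<omega>. (\<Prod>i<h. y n (g i) \<omega>) \<partial>M))" for n
    unfolding sum_power_PiE[OF Q] prod.distrib
    using mem y by (subst Bochner_Integration.integral_sum)
      (auto intro!: all_moments_integrable M.all_moments_cmult M.all_moments_prod)
  have Pz: "(\<integral>\<omega>. (\<Sum>q\<in>Q. a q * z q \<omega>) ^ h \<partial>P)
      = (\<Sum>g\<in>?F. (\<Prod>i<h. a (g i)) * (\<integral>\<omega>. (\<Prod>i<h. z (g i) \<omega>) \<partial>P))"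
    unfolding sum_power_PiE[OF Q] prod.distrib
    using mem z by (subst Bochner_Integration.integral_sum)
      (auto intro!: all_moments_integrable P.all_moments_cmult P.all_moments_prod)
  show ?thesis unfolding My Pz
    by (intro tendsto_sum tendsto_mult tendsto_const lim mem) auto
qed

context bounded_array
begin

text \<open>With the count frozen at \<open>m\<close>, the \<open>p\<close>-th absolute moment is at
  most \<open>m ^ p * (1 + m * D p)\<close>, a polynomial in \<open>m\<close>, so finite moments of
  the count suffice.\<close>

lemma walk_all_moments:
  assumes K: "\<And>t. 0 \<le> t \<Longrightarrow> all_moments M (\<lambda>\<omega>. real (K t \<omega>))"
    and Km: "\<And>t. 0 \<le> t \<Longrightarrow> K t \<in> borel_measurable M"
    and ind: "independent_processes M (UNIV \<times> {1..}) (\<lambda>(i, k). X i k) {0..} K"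
    and t: "0 \<le> t"
  shows "all_moments M (\<lambda>\<omega>. walk X (K t \<omega>) \<omega> i)"
proof -
  let ?A = "process_measure M (UNIV \<times> {1..}) (\<lambda>(i, k). X i k)" and ?B = "process_measure M {0..} K"
  have Xm: "(\<lambda>(i, k). X i k) z \<in> borel_measurable M" if "z \<in> UNIV \<times> {1..}" for z
    using that moments_X by (auto intro: all_moments_measurable)
  have Km': "K t \<in> borel_measurable M" if "t \<in> {0..}" for t using Km that by simp
  note fr = freezing_processes[OF Xm Km' ind]
  have XA: "X j l \<in> borel_measurable ?A" if "1 \<le> l" for j l
    using measurable_process_measure[of "(j, l)" "UNIV \<times> {1..}" "\<lambda>(i, k). X i k" M] that by simp
  have KB: "K t \<in> measurable ?B (count_space UNIV)"
    using measurable_process_measure[of t "{0..}" K M] t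
    by (simp add: measurable_cong_sets[OF refl sets_borel_eq_count_space])
  have meas: "(\<lambda>z. walk X (K t (snd z)) (fst z) i) \<in> borel_measurable (?A \<Otimes>\<^sub>M ?B)"
  \<comment> \<open>The count takes countably many values, so joint measurability reduces to a fixed
    number of steps.\<close>
  proof (rule measurable_compose_countable[of "\<lambda>m z. walk X m (fst z) i" _ _ "\<lambda>z. K t (snd z)"])
    show "(\<lambda>z. walk X m (fst z) i) \<in> borel_measurable (?A \<Otimes>\<^sub>M ?B)" for m
      unfolding walk_def by (intro borel_measurable_sum measurable_compose[OF measurable_fst] XA) auto
    show "(\<lambda>z. K t (snd z)) \<in> measurable (?A \<Otimes>\<^sub>M ?B) (count_space UNIV)"
      by (intro measurable_compose[OF measurable_snd] KB)
  qed
  have diag: "(\<lambda>\<omega>. (\<omega>, \<omega>)) \<in> measurable M (?A \<Otimes>\<^sub>M ?B)"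
    using fr(1,2) by (intro measurable_Pair) (auto simp: subalgebra_def measurable_def intro: sets.Int_space_eq2 dest: sets.sets_into_space)
  have m: "(\<lambda>\<omega>. walk X (K t \<omega>) \<omega> i) \<in> borel_measurable M"
    using measurable_compose[OF diag meas] by simp
  have "integrable M (\<lambda>\<omega>. \<bar>walk X (K t \<omega>) \<omega> i\<bar> ^ p)" for p
  proof (rule integrableI_bounded)
    show "(\<lambda>\<omega>. \<bar>walk X (K t \<omega>) \<omega> i\<bar> ^ p) \<in> borel_measurable M" using m by simp
    have "(\<integral>\<^sup>+\<omega>. ennreal (norm (\<bar>walk X (K t \<omega>) \<omega> i\<bar> ^ p)) \<partial>M)
      = (\<integral>\<^sup>+\<omega>'. \<integral>\<^sup>+\<omega>. ennreal (norm (\<bar>walk X (K t \<omega>') \<omega> i\<bar> ^ p)) \<partial>M \<partial>M)"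
    proof -
      have "(\<lambda>x::real. ennreal (norm (\<bar>x\<bar> ^ p))) \<in> borel_measurable borel" by measurable
      note m' = measurable_compose[OF meas this]
      have "case_prod (\<lambda>\<omega> \<omega>'. ennreal (norm (\<bar>walk X (K t \<omega>') \<omega> i\<bar> ^ p))) \<in> borel_measurable (?A \<Otimes>\<^sub>M ?B)"
        using m' unfolding case_prod_beta' .
      from freezing_nn[OF fr this] show ?thesis by simp
    qed
    also have "\<dots> \<le> (\<integral>\<^sup>+\<omega>'. ennreal (real (K t \<omega>') ^ p * (1 + real (K t \<omega>') * D p)) \<partial>M)"
    proof (rule nn_integral_mono)
      fix \<omega>'
      let ?m = "K t \<omega>'"
      have i1: "integrable M (\<lambda>\<omega>. \<bar>X i l \<omega>\<bar> ^ p)" if "1 \<le> l" for l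
        using all_moments_norm_power[OF moments_X[OF that]] by simp
      have int: "integrable M (\<lambda>\<omega>. real ?m ^ p * (1 + (\<Sum>l=1..?m. \<bar>X i l \<omega>\<bar> ^ p)))"
        by (intro integrable_mult_right Bochner_Integration.integrable_add Bochner_Integration.integrable_sum i1) auto
      have "(\<integral>\<^sup>+\<omega>. ennreal (norm (\<bar>walk X ?m \<omega> i\<bar> ^ p)) \<partial>M)
        \<le> (\<integral>\<^sup>+\<omega>. ennreal (real ?m ^ p * (1 + (\<Sum>l=1..?m. \<bar>X i l \<omega>\<bar> ^ p))) \<partial>M)"
        unfolding walk_def using norm_sum_power_le[of "{1..?m}" "\<lambda>l. X i l _" p]
        by (intro nn_integral_mono ennreal_leI) (simp add: power_abs)
      also have "\<dots> = ennreal (expectation (\<lambda>\<omega>. real ?m ^ p * (1 + (\<Sum>l=1..?m. \<bar>X i l \<omega>\<bar> ^ p))))"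
        by (intro nn_integral_eq_integral int AE_I2 mult_nonneg_nonneg add_nonneg_nonneg sum_nonneg) auto
      also have "expectation (\<lambda>\<omega>. real ?m ^ p * (1 + (\<Sum>l=1..?m. \<bar>X i l \<omega>\<bar> ^ p)))
        = real ?m ^ p * (1 + (\<Sum>l=1..?m. expectation (\<lambda>\<omega>. \<bar>X i l \<omega>\<bar> ^ p)))"
      proof -
        have "integrable M (\<lambda>\<omega>. \<Sum>l=1..?m. \<bar>X i l \<omega>\<bar> ^ p)"
          by (intro Bochner_Integration.integrable_sum i1) auto
        then have "expectation (\<lambda>\<omega>. real ?m ^ p * (1 + (\<Sum>l=1..?m. \<bar>X i l \<omega>\<bar> ^ p)))
            = real ?m ^ p * (1 + expectation (\<lambda>\<omega>. \<Sum>l=1..?m. \<bar>X i l \<omega>\<bar> ^ p))"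
          by (simp add: prob_space)
        also have "expectation (\<lambda>\<omega>. \<Sum>l=1..?m. \<bar>X i l \<omega>\<bar> ^ p) = (\<Sum>l=1..?m. expectation (\<lambda>\<omega>. \<bar>X i l \<omega>\<bar> ^ p))"
          by (rule Bochner_Integration.integral_sum) (rule i1, simp)
        finally show ?thesis .
      qed
      also have "\<dots> \<le> real ?m ^ p * (1 + real ?m * D p)"
        using sum_bounded_above[of "{1..?m}" "\<lambda>l. expectation (\<lambda>\<omega>. \<bar>X i l \<omega>\<bar> ^ p)" "D p"] bound_X
        by (intro mult_left_mono) auto
      finally show "(\<integral>\<^sup>+\<omega>. ennreal (norm (\<bar>walk X ?m \<omega> i\<bar> ^ p)) \<partial>M) \<le> ennreal (real ?m ^ p * (1 + real ?m * D p))"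
        by (simp add: ennreal_leI)
    qed
    also have "\<dots> < \<infinity>"
    proof -
      have "all_moments M (\<lambda>\<omega>. real (K t \<omega>) ^ p * (1 + real (K t \<omega>) * D p))"
        using K[OF t] by (intro all_moments_mult all_moments_power all_moments_add all_moments_const)
      then have "integrable M (\<lambda>\<omega>. real (K t \<omega>) ^ p * (1 + real (K t \<omega>) * D p))" by (rule all_moments_integrable)
      then show ?thesis using D_nonneg[of p]
        by (subst nn_integral_eq_integral) (auto intro!: AE_I2 mult_nonneg_nonneg add_nonneg_nonneg)
    qed
    finally show "(\<integral>\<^sup>+\<omega>. ennreal (norm (\<bar>walk X (K t \<omega>) \<omega> i\<bar> ^ p)) \<partial>M) < \<infinity>" .
  qed
  then show ?thesis using m by (simp add: all_moments_def)
qed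

lemma circ_eig_all_moments:
  assumes "\<And>i. all_moments M (\<lambda>\<omega>. s \<omega> i)"
  shows "all_moments M (\<lambda>\<omega>. circ_eig n (s \<omega>) k b)"
  unfolding circ_eig_def
  by (intro all_moments_sum all_moments_mult all_moments_const all_moments_of_real assms)

lemma circ_eig_walk_freezing:
  fixes tt :: "'p \<Rightarrow> real"
  assumes K: "\<And>t. 0 \<le> t \<Longrightarrow> all_moments M (\<lambda>\<omega>. real (K t \<omega>))"
    and Km: "\<And>t. 0 \<le> t \<Longrightarrow> K t \<in> borel_measurable M"
    and ind: "independent_processes M (UNIV \<times> {1..}) (\<lambda>(i, k). X i k) {0..} K"
    and tt: "\<And>p. p \<in> S \<Longrightarrow> 0 \<le> tt p"
  shows "expectation (\<lambda>\<omega>. (\<Sum>p\<in>S. circ_eig n (walk X (K (tt p) \<omega>) \<omega>) k (b p)) ^ r)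
      = expectation (\<lambda>\<omega>'. expectation (\<lambda>\<omega>. (\<Sum>p\<in>S. circ_eig n (walk X (K (tt p) \<omega>') \<omega>) k (b p)) ^ r))"
    and "integrable M (\<lambda>\<omega>'. expectation (\<lambda>\<omega>. (\<Sum>p\<in>S. circ_eig n (walk X (K (tt p) \<omega>') \<omega>) k (b p)) ^ r))"
proof -
  let ?A = "process_measure M (UNIV \<times> {1..}) (\<lambda>(i, k). X i k)" and ?B = "process_measure M {0..} K"
  have Xm: "(\<lambda>(i, k). X i k) z \<in> borel_measurable M" if "z \<in> UNIV \<times> {1..}" for z
    using that moments_X by (auto intro: all_moments_measurable)
  have Km': "K t \<in> borel_measurable M" if "t \<in> {0..}" for t using Km that by simp
  note fr = freezing_processes[OF Xm Km' ind]
  have XA: "X j l \<in> borel_measurable ?A" if "1 \<le> l" for j l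
    using measurable_process_measure[of "(j, l)" "UNIV \<times> {1..}" "\<lambda>(i, k). X i k" M] that by simp
  have KB: "K t \<in> measurable ?B (count_space UNIV)" if "0 \<le> t" for t
    using measurable_process_measure[of t "{0..}" K M] that
    by (simp add: measurable_cong_sets[OF refl sets_borel_eq_count_space])
  have meas: "(\<lambda>z. walk X (K t (snd z)) (fst z) i) \<in> borel_measurable (?A \<Otimes>\<^sub>M ?B)" if "0 \<le> t" for t i
  proof (rule measurable_compose_countable[of "\<lambda>m z. walk X m (fst z) i" _ _ "\<lambda>z. K t (snd z)"])
    show "(\<lambda>z. walk X m (fst z) i) \<in> borel_measurable (?A \<Otimes>\<^sub>M ?B)" for m
      unfolding walk_def by (intro borel_measurable_sum measurable_compose[OF measurable_fst] XA) auto
    show "(\<lambda>z. K t (snd z)) \<in> measurable (?A \<Otimes>\<^sub>M ?B) (count_space UNIV)"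
      by (intro measurable_compose[OF measurable_snd] KB that)
  qed
  have "(\<lambda>z. (\<Sum>p\<in>S. circ_eig n (walk X (K (tt p) (snd z)) (fst z)) k (b p)) ^ r) \<in> borel_measurable (?A \<Otimes>\<^sub>M ?B)"
    unfolding circ_eig_def
    by (intro borel_measurable_power borel_measurable_sum borel_measurable_times borel_measurable_const
        measurable_compose[OF meas borel_measurable_of_real] tt)
  then have m: "case_prod (\<lambda>\<omega> \<omega>'. (\<Sum>p\<in>S. circ_eig n (walk X (K (tt p) \<omega>') \<omega>) k (b p)) ^ r) \<in> borel_measurable (?A \<Otimes>\<^sub>M ?B)"
    by (simp add: case_prod_beta')
  have int: "integrable M (\<lambda>\<omega>. (\<Sum>p\<in>S. circ_eig n (walk X (K (tt p) \<omega>) \<omega>) k (b p)) ^ r)"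
    by (intro all_moments_integrable all_moments_power all_moments_sum circ_eig_all_moments walk_all_moments[OF K Km ind] tt)
  show "expectation (\<lambda>\<omega>. (\<Sum>p\<in>S. circ_eig n (walk X (K (tt p) \<omega>) \<omega>) k (b p)) ^ r)
      = expectation (\<lambda>\<omega>'. expectation (\<lambda>\<omega>. (\<Sum>p\<in>S. circ_eig n (walk X (K (tt p) \<omega>') \<omega>) k (b p)) ^ r))"
    by (rule freezing(1)[OF fr m int])
  show "integrable M (\<lambda>\<omega>'. expectation (\<lambda>\<omega>. (\<Sum>p\<in>S. circ_eig n (walk X (K (tt p) \<omega>') \<omega>) k (b p)) ^ r))"
    by (rule freezing(2)[OF fr m int])
qed

end

section \<open>Averages over the frequencies\<close>

lemma all_moments_min:
  fixes f g :: "'a \<Rightarrow> real"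
  assumes "all_moments M f" "all_moments M g"
  shows "all_moments M (\<lambda>\<omega>. min (f \<omega>) (g \<omega>))"
proof (rule all_moments_bound)
  have "all_moments M (\<lambda>\<omega>. norm (h \<omega>))" if "all_moments M h" for h :: "'a \<Rightarrow> real"
    using that by (auto simp: all_moments_def intro!: borel_measurable_abs)
  then show "all_moments M (\<lambda>\<omega>. norm (f \<omega>) + norm (g \<omega>))"
    using assms by (intro all_moments_add)
  show "(\<lambda>\<omega>. min (f \<omega>) (g \<omega>)) \<in> borel_measurable M"
    using assms[THEN all_moments_measurable] by simp
  show "AE \<omega> in M. norm (min (f \<omega>) (g \<omega>)) \<le> norm (norm (f \<omega>) + norm (g \<omega>))"
    by (intro AE_I2) auto
qed

lemma norm_gauss_mom_le:
  assumes "norm s \<le> a\<^sup>2" "0 \<le> a"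
  shows "norm (gauss_mom r s) \<le> norm (gauss_mom r 1) * a ^ r"
proof (cases "even r")
  case True
  then obtain m where r: "r = 2 * m" by blast
  have "norm s ^ m \<le> (a\<^sup>2) ^ m" using assms by (intro power_mono) auto
  then have "norm s ^ m \<le> a ^ r" by (simp add: r power_mult)
  then show ?thesis unfolding r gauss_mom_double
    by (auto simp: norm_mult norm_power norm_divide simp flip: r intro!: divide_right_mono mult_left_mono)
next
  case False
  then show ?thesis by (simp add: gauss_mom_odd)
qed

lemma abs_conj_cov_le:
  assumes S: "finite S" and u: "\<And>p. p \<in> S \<Longrightarrow> 0 \<le> u p"
  shows "\<bar>conj_cov S b u\<bar> \<le> (real (card S))\<^sup>2 * (\<Sum>p\<in>S. u p)"
proof -
  have "\<bar>if b p \<noteq> b q then min (u p) (u q) else 0\<bar> \<le> (\<Sum>p\<in>S. u p)" if "p \<in> S" "q \<in> S" for p q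
  proof -
    have "\<bar>if b p \<noteq> b q then min (u p) (u q) else 0\<bar> \<le> u p" using u[OF that(1)] u[OF that(2)] by auto
    also have "\<dots> \<le> (\<Sum>p\<in>S. u p)" using S u that by (intro member_le_sum) auto
    finally show ?thesis .
  qed
  then have "\<bar>conj_cov S b u\<bar> \<le> (\<Sum>p\<in>S. \<Sum>q\<in>S. \<Sum>p\<in>S. u p)"
    unfolding conj_cov_def by (intro order.trans[OF sum_abs] sum_mono order.trans[OF sum_abs])
  then show ?thesis by (simp add: power2_eq_square)
qed

lemma gauss_mom_of_real_double:
  "gauss_mom (2 * h) (of_real x) = of_real (fact (2 * h) / (2 ^ h * fact h) * x ^ h)"
  by (simp add: gauss_mom_double)

lemma all_moments_gauss_mom:
  assumes "prob_space M" "all_moments M f"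
  shows "all_moments M (\<lambda>\<omega>. gauss_mom r (of_real (f \<omega>)))"
proof -
  interpret prob_space M by fact
  show ?thesis
  proof (cases "even r")
    case True
    then show ?thesis unfolding gauss_mom_def
      by (simp only: if_True) (intro all_moments_cmult all_moments_power all_moments_of_real assms)
  next
    case False
    then show ?thesis by (simp add: gauss_mom_odd all_moments_const)
  qed
qed

lemma all_moments_conj_cov:
  assumes "prob_space M" "\<And>p. p \<in> S \<Longrightarrow> all_moments M (u p)"
  shows "all_moments M (\<lambda>\<omega>. conj_cov S b (\<lambda>p. u p \<omega>))"
proof -
  interpret prob_space M by fact
  have "all_moments M (\<lambda>\<omega>. if b p \<noteq> b q then min (u p \<omega>) (u q \<omega>) else 0)" if "p \<in> S" "q \<in> S" for p q
    using assms(2)[OF that(1)] assms(2)[OF that(2)] by (cases "b p = b q") (auto intro: all_moments_const all_moments_min)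
  then show ?thesis unfolding conj_cov_def by (intro all_moments_sum)
qed

lemma conj_cov_pairs:
  "conj_cov S b u = (\<Sum>x\<in>S \<times> S. (if b (fst x) \<noteq> b (snd x) then 1 else 0) * min (u (fst x)) (u (snd x)))"
  unfolding conj_cov_def sum.cartesian_product by (intro sum.cong refl) auto

text \<open>These are \<open>0\<close> and, for even \<open>n\<close>, \<open>n div 2\<close>: the
  frequencies with real eigenvalues, where a letter and its adjoint cannot be told apart.\<close>

lemma card_double_dvd_le_2:
  fixes n :: nat
  shows "card {k. k < n \<and> int n dvd 2 * int k} \<le> 2"
proof -
  have "{k. k < n \<and> int n dvd 2 * int k} \<subseteq> {0, n div 2}"
  proof
    fix k assume "k \<in> {k. k < n \<and> int n dvd 2 * int k}"
    then have k: "k < n" "n dvd 2 * k" using int_dvd_int_iff[of n "2 * k"] by auto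
    then obtain c where c: "2 * k = n * c" by blast
    have "n * c < n * 2" using c k by linarith
    then have "c < 2" by simp
    then have "c = 0 \<or> c = 1" by linarith
    then show "k \<in> {0, n div 2}" using c k by auto
  qed
  then have "card {k. k < n \<and> int n dvd 2 * int k} \<le> card {0, n div 2}" by (intro card_mono) auto
  also have "\<dots> \<le> 2" by (simp add: card_insert_if)
  finally show ?thesis .
qed

context bounded_array
begin

text \<open>The error is \<open>O(1 / sqrt n)\<close> at a generic frequency \<open>k\<close> and \<open>O(1)\<close> at the at most two
  frequencies with \<open>n dvd 2 * k\<close>.\<close>

lemma averaged_walk_moment_bound:
  fixes S :: "'p set"
  assumes S: "finite S"
  shows "\<exists>B\<ge>0. \<forall>n (K :: real \<Rightarrow> 'a \<Rightarrow> nat) (tt :: 'p \<Rightarrow> real) b. 1 \<le> n \<longrightarrow>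
    (\<forall>t\<ge>0. all_moments M (\<lambda>\<omega>. real (K t \<omega>)) \<and> K t \<in> borel_measurable M) \<longrightarrow>
    independent_processes M (UNIV \<times> {1..}) (\<lambda>(i, k). X i k) {0..} K \<longrightarrow> (\<forall>p\<in>S. 0 \<le> tt p) \<longrightarrow>
    norm ((\<Sum>k<n. expectation (\<lambda>\<omega>. (\<Sum>p\<in>S. circ_eig n (walk X (K (tt p) \<omega>) \<omega>) k (b p)) ^ r)) / of_nat n
       - expectation (\<lambda>\<omega>. gauss_mom r (of_real (real n * conj_cov S b (\<lambda>p. real (K (tt p) \<omega>))))))
    \<le> B / sqrt (real n) * expectation (\<lambda>\<omega>. sqrt (real n * (1 + (\<Sum>p\<in>S. real (K (tt p) \<omega>)))) ^ r)"
proof -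
  obtain B where B0: "B \<ge> 0" and B1: "\<And>n k (m :: 'p \<Rightarrow> nat) b. 1 \<le> n \<Longrightarrow>
    norm (expectation (\<lambda>\<omega>. (\<Sum>p\<in>S. circ_eig n (walk X (m p) \<omega>) k (b p)) ^ r))
      \<le> B * sqrt (real n * (1 + (\<Sum>p\<in>S. real (m p)))) ^ r"
    and B2: "\<And>n k (m :: 'p \<Rightarrow> nat) b. 1 \<le> n \<Longrightarrow> \<not> int n dvd 2 * int k \<Longrightarrow> sqrt (real n) *
       norm (expectation (\<lambda>\<omega>. (\<Sum>p\<in>S. circ_eig n (walk X (m p) \<omega>) k (b p)) ^ r)
         - gauss_mom r (of_real (real n * conj_cov S b (\<lambda>p. real (m p)))))
      \<le> B * sqrt (real n * (1 + (\<Sum>p\<in>S. real (m p)))) ^ r"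
    using walk_moment_bounds[OF S, of r] by (elim exE conjE) blast
  \<comment> \<open>Controls the Gaussian term by itself, its variance being at most
    \<open>(card S * \<rho>) ^ 2\<close> in absolute value; needed at the exceptional frequencies,
    where no cancellation is available.\<close>
  define B' where "B' = norm (gauss_mom r 1) * real (card S) ^ r"
  have B'0: "B' \<ge> 0" by (simp add: B'_def)
  show ?thesis
  \<comment> \<open>\<open>B\<close> comes from the generic frequencies. Each of the at most two
    others costs \<open>B + B'\<close>, and the average divides this by
    \<open>n \<ge> sqrt n\<close>.\<close>
  proof (intro exI[of _ "B + 2 * (B + B')"] conjI allI impI)
    show "0 \<le> B + 2 * (B + B')" using B0 B'0 by simp
    fix n :: nat and K :: "real \<Rightarrow> 'a \<Rightarrow> nat" and tt :: "'p \<Rightarrow> real" and b :: "'p \<Rightarrow> bool"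
    assume n: "1 \<le> n" and K: "\<forall>t\<ge>0. all_moments M (\<lambda>\<omega>. real (K t \<omega>)) \<and> K t \<in> borel_measurable M"
      and ind: "independent_processes M (UNIV \<times> {1..}) (\<lambda>(i, k). X i k) {0..} K" and tt: "\<forall>p\<in>S. 0 \<le> tt p"
    define a where "a k \<omega>' = expectation (\<lambda>\<omega>. (\<Sum>p\<in>S. circ_eig n (walk X (K (tt p) \<omega>') \<omega>) k (b p)) ^ r)" for k \<omega>'
    define g where "g \<omega> = gauss_mom r (of_real (real n * conj_cov S b (\<lambda>p. real (K (tt p) \<omega>))))" for \<omega>
    define \<rho> where "\<rho> \<omega> = sqrt (real n * (1 + (\<Sum>p\<in>S. real (K (tt p) \<omega>))))" for \<omega>
    have Kp: "all_moments M (\<lambda>\<omega>. real (K (tt p) \<omega>))" if "p \<in> S" for p using K tt that by blast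
    have Ea: "expectation (\<lambda>\<omega>. (\<Sum>p\<in>S. circ_eig n (walk X (K (tt p) \<omega>) \<omega>) k (b p)) ^ r) = expectation (a k)" for k
      unfolding a_def by (rule circ_eig_walk_freezing(1)) (use K ind tt in auto)
    have ia: "integrable M (a k)" for k
      unfolding a_def by (rule circ_eig_walk_freezing(2)) (use K ind tt in auto)
    have ig: "integrable M g" unfolding g_def
      by (intro all_moments_integrable all_moments_gauss_mom all_moments_cmult all_moments_conj_cov Kp prob_space_axioms)
    have arg_nonneg: "0 \<le> real n * (1 + (\<Sum>p\<in>S. real (K (tt p) \<omega>)))" for \<omega>
      by (intro mult_nonneg_nonneg add_nonneg_nonneg sum_nonneg) auto
    have \<rho>0: "0 \<le> \<rho> \<omega>" for \<omega> unfolding \<rho>_def by (rule real_sqrt_ge_zero[OF arg_nonneg])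
    have \<rho>2: "(\<rho> \<omega>)\<^sup>2 = real n * (1 + (\<Sum>p\<in>S. real (K (tt p) \<omega>)))" for \<omega>
      unfolding \<rho>_def by (rule real_sqrt_pow2[OF arg_nonneg])
    \<comment> \<open>Only the even powers of this square root are polynomials in the
      counts.\<close>
    have "all_moments M \<rho>"
    proof (rule all_moments_even)
      have "all_moments M (\<lambda>\<omega>. (real n * (1 + (\<Sum>p\<in>S. real (K (tt p) \<omega>)))) ^ p)" for p
        by (intro all_moments_power all_moments_cmult all_moments_add all_moments_sum all_moments_const Kp)
      then have "integrable M (\<lambda>\<omega>. (real n * (1 + (\<Sum>p\<in>S. real (K (tt p) \<omega>)))) ^ p)" for p
        by (rule all_moments_integrable)
      then show "integrable M (\<lambda>\<omega>. norm (\<rho> \<omega>) ^ (2 * p))" for p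
        by (simp add: power_mult \<rho>2)
      have "(\<lambda>\<omega>. real (K (tt p) \<omega>)) \<in> borel_measurable M" if "p \<in> S" for p
        by (rule all_moments_measurable[OF Kp[OF that]])
      then show "\<rho> \<in> borel_measurable M" unfolding \<rho>_def by measurable
    qed unfold_locales
    then have i\<rho>: "integrable M (\<lambda>\<omega>. \<rho> \<omega> ^ r)" by (intro all_moments_integrable all_moments_power)
    let ?E = "expectation (\<lambda>\<omega>. \<rho> \<omega> ^ r)"
    have E0: "0 \<le> ?E" using \<rho>0 by (intro integral_nonneg_AE AE_I2) auto
    have s1: "1 \<le> sqrt (real n)" using n by simp
    have good: "norm (expectation (a k) - expectation g) \<le> B / sqrt (real n) * ?E" if k: "\<not> int n dvd 2 * int k" for k
    proof -
      have le: "norm (a k \<omega> - g \<omega>) \<le> B / sqrt (real n) * \<rho> \<omega> ^ r" for \<omega>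
        using B2[OF n k, of "\<lambda>p. K (tt p) \<omega>" b] s1 unfolding a_def g_def \<rho>_def
        by (simp add: pos_le_divide_eq mult.commute)
      have "norm (expectation (\<lambda>\<omega>. a k \<omega> - g \<omega>)) \<le> expectation (\<lambda>\<omega>. B / sqrt (real n) * \<rho> \<omega> ^ r)"
        by (rule order.trans[OF integral_norm_bound integral_mono])
          (intro integrable_norm Bochner_Integration.integrable_diff ia ig integrable_mult_right i\<rho> le)+
      then show ?thesis using ia ig by simp
    qed
    have bad: "norm (expectation (a k) - expectation g) \<le> (B + B') * ?E" for k
    proof -
      have le: "norm (a k \<omega> - g \<omega>) \<le> (B + B') * \<rho> \<omega> ^ r" for \<omega>
      proof -
        have "norm (a k \<omega>) \<le> B * \<rho> \<omega> ^ r"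
          using B1[OF n, of "\<lambda>p. K (tt p) \<omega>" k b] unfolding a_def \<rho>_def .
        moreover have "norm (g \<omega>) \<le> B' * \<rho> \<omega> ^ r"
        proof -
          have "\<bar>conj_cov S b (\<lambda>p. real (K (tt p) \<omega>))\<bar> \<le> (real (card S))\<^sup>2 * (\<Sum>p\<in>S. real (K (tt p) \<omega>))"
            using S by (intro abs_conj_cov_le) auto
          also have "\<dots> \<le> (real (card S))\<^sup>2 * (1 + (\<Sum>p\<in>S. real (K (tt p) \<omega>)))"
            by (intro mult_left_mono) auto
          finally have "real n * \<bar>conj_cov S b (\<lambda>p. real (K (tt p) \<omega>))\<bar>
              \<le> real n * ((real (card S))\<^sup>2 * (1 + (\<Sum>p\<in>S. real (K (tt p) \<omega>))))"
            by (rule mult_left_mono) simp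
          then have "norm (complex_of_real (real n * conj_cov S b (\<lambda>p. real (K (tt p) \<omega>)))) \<le> (real (card S) * \<rho> \<omega>)\<^sup>2"
            unfolding power_mult_distrib \<rho>2 norm_of_real abs_mult by (simp add: mult_ac)
          from norm_gauss_mom_le[OF this, of r] show ?thesis
            using \<rho>0[of \<omega>] unfolding g_def B'_def by (simp add: power_mult_distrib mult_ac)
        qed
        ultimately show ?thesis using norm_triangle_ineq4[of "a k \<omega>" "g \<omega>"] by (simp add: distrib_right)
      qed
      have "norm (expectation (\<lambda>\<omega>. a k \<omega> - g \<omega>)) \<le> expectation (\<lambda>\<omega>. (B + B') * \<rho> \<omega> ^ r)"
        by (rule order.trans[OF integral_norm_bound integral_mono])
          (intro integrable_norm Bochner_Integration.integrable_diff ia ig integrable_mult_right i\<rho> le)+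
      then show ?thesis using ia ig by simp
    qed
    let ?N = "{k. k < n \<and> int n dvd 2 * int k}"
    have "(\<Sum>k<n. norm (expectation (a k) - expectation g))
      \<le> (\<Sum>k<n. B / sqrt (real n) * ?E + (if k \<in> ?N then (B + B') * ?E else 0))"
    proof (rule sum_mono)
      fix k assume "k \<in> {..<n}"
      show "norm (expectation (a k) - expectation g) \<le> B / sqrt (real n) * ?E + (if k \<in> ?N then (B + B') * ?E else 0)"
        using good[of k] bad[of k] B0 E0 s1 \<open>k \<in> {..<n}\<close> by (cases "int n dvd 2 * int k") (auto intro: add_increasing)
    qed
    also have "\<dots> = real n * (B / sqrt (real n) * ?E) + real (card ?N) * ((B + B') * ?E)"
    proof -
      have "(\<Sum>k<n. if k \<in> ?N then (B + B') * ?E else 0) = (\<Sum>k\<in>{..<n} \<inter> ?N. (B + B') * ?E)"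
        by (rule sum.inter_restrict[symmetric]) simp
      also have "{..<n} \<inter> ?N = ?N" by auto
      finally show ?thesis by (simp add: sum.distrib)
    qed
    also have "real (card ?N) * ((B + B') * ?E) \<le> 2 * ((B + B') * ?E)"
      using card_double_dvd_le_2[of n] B0 B'0 E0 by (intro mult_right_mono) auto
    also have "2 * ((B + B') * ?E) \<le> real n * (2 * (B + B') / sqrt (real n) * ?E)"
    proof -
      have "1 \<le> real n / sqrt (real n)" using s1 by (simp add: real_div_sqrt)
      then have "(2 * ((B + B') * ?E)) * 1 \<le> (2 * ((B + B') * ?E)) * (real n / sqrt (real n))"
        using B0 B'0 E0 by (intro mult_left_mono) auto
      then show ?thesis by (simp only: mult_1_right times_divide_eq_left times_divide_eq_right mult_ac)
    qed
    finally have sum_le: "(\<Sum>k<n. norm (expectation (a k) - expectation g))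
      \<le> real n * ((B + 2 * (B + B')) / sqrt (real n) * ?E)" by (simp add: algebra_simps add_divide_distrib)
    have "(\<Sum>k<n. expectation (a k)) / of_nat n - expectation g = (\<Sum>k<n. expectation (a k) - expectation g) / of_nat n"
      using n by (simp add: sum_subtractf diff_divide_distrib)
    then have "norm ((\<Sum>k<n. expectation (a k)) / of_nat n - expectation g)
        \<le> (\<Sum>k<n. norm (expectation (a k) - expectation g)) / real n"
      by (simp add: norm_divide divide_right_mono norm_sum)
    also have "\<dots> \<le> (B + 2 * (B + B')) / sqrt (real n) * ?E"
      using sum_le n by (simp add: pos_divide_le_eq mult.commute)
    finally show "norm ((\<Sum>k<n. expectation (\<lambda>\<omega>. (\<Sum>p\<in>S. circ_eig n (walk X (K (tt p) \<omega>) \<omega>) k (b p)) ^ r)) / of_nat n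
       - expectation (\<lambda>\<omega>. gauss_mom r (of_real (real n * conj_cov S b (\<lambda>p. real (K (tt p) \<omega>))))))
      \<le> (B + 2 * (B + B')) / sqrt (real n) * expectation (\<lambda>\<omega>. sqrt (real n * (1 + (\<Sum>p\<in>S. real (K (tt p) \<omega>)))) ^ r)"
      unfolding Ea g_def \<rho>_def .
  qed
qed

end

section \<open>Limits of moments of rescaled eigenvalue sums\<close>

context bounded_array
begin

text \<open>The hypothesis on product moments is used twice: with equal times it bounds the rescaled
  error term, and with pairs of times it gives the limit of the Gaussian term, which for even
  \<open>r\<close> is a power of a linear combination of minima and for odd \<open>r\<close> is
  zero.\<close>

lemma walk_power_limit:
  fixes S :: "'p set" and tt :: "'p \<Rightarrow> real" and K :: "real \<Rightarrow> 'a \<Rightarrow> nat"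
  assumes S: "finite S" and \<alpha>: "0 \<le> \<alpha>" and P: "prob_space P"
    and K: "\<And>t. 0 \<le> t \<Longrightarrow> all_moments M (\<lambda>\<omega>. real (K t \<omega>))"
    and Km: "\<And>t. 0 \<le> t \<Longrightarrow> K t \<in> borel_measurable M"
    and ind: "independent_processes M (UNIV \<times> {1..}) (\<lambda>(i, k). X i k) {0..} K"
    and T: "\<And>t. 0 \<le> t \<Longrightarrow> all_moments P (T t)"
    and lim: "\<And>h (s :: nat \<Rightarrow> real) t. (\<And>i. i < h \<Longrightarrow> 0 \<le> s i \<and> 0 \<le> t i) \<Longrightarrow>
      (\<lambda>n. expectation (\<lambda>\<omega>. \<Prod>i<h. min (real (K (real n * s i) \<omega>)) (real (K (real n * t i) \<omega>)) / real n powr \<alpha>))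
        \<longlonglongrightarrow> (\<integral>\<omega>. (\<Prod>i<h. min (T (s i) \<omega>) (T (t i) \<omega>)) \<partial>P)"
    and tt: "\<And>p. p \<in> S \<Longrightarrow> 0 \<le> tt p"
  shows "(\<lambda>n. (\<Sum>k<n. expectation (\<lambda>\<omega>. (\<Sum>p\<in>S. of_real (real n powr (- (1 + \<alpha>) / 2)) *
        circ_eig n (walk X (K (real n * tt p) \<omega>) \<omega>) k (b p)) ^ r)) / of_nat n)
    \<longlonglongrightarrow> (\<integral>\<omega>. gauss_mom r (of_real (conj_cov S b (\<lambda>p. T (tt p) \<omega>))) \<partial>P)"
proof -
  interpret P: prob_space P by fact
  define c where "c n = real n powr (- (1 + \<alpha>) / 2)" for n :: nat
  define A where "A n = (\<Sum>k<n. expectation (\<lambda>\<omega>. (\<Sum>p\<in>S. circ_eig n (walk X (K (real n * tt p) \<omega>) \<omega>) k (b p)) ^ r)) / of_nat n" for n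
  define G where "G n = expectation (\<lambda>\<omega>. gauss_mom r (of_real (real n * conj_cov S b (\<lambda>p. real (K (real n * tt p) \<omega>)))))" for n
  define \<rho> where "\<rho> n \<omega> = sqrt (real n * (1 + (\<Sum>p\<in>S. real (K (real n * tt p) \<omega>))))" for n \<omega>
  \<comment> \<open>The total rescaled count, written with a weight \<open>1\<close> and the minimum
    of each count with itself to fit the hypothesis on minima.\<close>
  define R where "R n \<omega> = (\<Sum>p\<in>S. 1 * (min (real (K (real n * tt p) \<omega>)) (real (K (real n * tt p) \<omega>)) / real n powr \<alpha>))" for n \<omega>
  define y where "y n x \<omega> = min (real (K (real n * tt (fst x)) \<omega>)) (real (K (real n * tt (snd x)) \<omega>)) / real n powr \<alpha>" for n and x :: "'p \<times> 'p" and \<omega>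
  have Kn: "all_moments M (\<lambda>\<omega>. real (K (real n * tt p) \<omega>))" if "p \<in> S" for n p
    using K[of "real n * tt p"] tt[OF that] by simp
  have div: "all_moments M (\<lambda>\<omega>. f \<omega> / d)" if "all_moments M f" for f and d :: real
    using all_moments_cmult[OF that, of "1 / d"] by simp
  have ym: "all_moments M (y n x)" if "x \<in> S \<times> S" for n x
    unfolding y_def using that by (intro div all_moments_min Kn) auto
  have Rm: "all_moments M (R n)" for n
    unfolding R_def by (intro all_moments_sum all_moments_cmult div all_moments_min Kn)
  have scaled: "(\<Sum>k<n. expectation (\<lambda>\<omega>. (\<Sum>p\<in>S. of_real (c n) *
        circ_eig n (walk X (K (real n * tt p) \<omega>) \<omega>) k (b p)) ^ r)) / of_nat n = of_real (c n) ^ r * A n" for n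
    unfolding A_def sum_distrib_left[symmetric] power_mult_distrib by (simp add: sum_distrib_left)
  \<comment> \<open>One factor \<open>n\<close> is the number of independent walks and
    \<open>n powr \<alpha>\<close> the order of the counts; the scaling is the inverse square root
    of their product.\<close>
  have c2: "(c n)\<^sup>2 * real n = 1 / real n powr \<alpha>" if "1 \<le> n" for n
  proof -
    have "(c n)\<^sup>2 = real n powr (- (1 + \<alpha>))"
      unfolding c_def power2_eq_square powr_add[symmetric] by (simp only: field_sum_of_halves)
    then have "(c n)\<^sup>2 * real n = real n powr (- (1 + \<alpha>)) * real n powr 1" using that by simp
    also have "\<dots> = real n powr (- \<alpha>)" by (subst powr_add[symmetric]) (simp add: field_simps)
    finally show ?thesis by (simp add: powr_minus_divide)
  qed
  have R_lim: "(\<lambda>n. expectation (\<lambda>\<omega>. R n \<omega> ^ r)) \<longlonglongrightarrow> (\<integral>\<omega>. (\<Sum>p\<in>S. 1 * min (T (tt p) \<omega>) (T (tt p) \<omega>)) ^ r \<partial>P)"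
    unfolding R_def
  proof (rule tendsto_expectation_power_sum[OF S prob_space_axioms P])
    show "all_moments M (\<lambda>\<omega>. min (real (K (real n * tt p) \<omega>)) (real (K (real n * tt p) \<omega>)) / real n powr \<alpha>)" if "p \<in> S" for n p
      by (intro div all_moments_min Kn that)
    show "all_moments P (\<lambda>\<omega>. min (T (tt p) \<omega>) (T (tt p) \<omega>))" if "p \<in> S" for p
      by (intro all_moments_min T tt that)
    show "(\<lambda>n. \<integral>\<omega>. (\<Prod>i<r. min (real (K (real n * tt (g i)) \<omega>)) (real (K (real n * tt (g i)) \<omega>)) / real n powr \<alpha>) \<partial>M)
      \<longlonglongrightarrow> (\<integral>\<omega>. (\<Prod>i<r. min (T (tt (g i)) \<omega>) (T (tt (g i)) \<omega>)) \<partial>P)" if "\<And>i. i < r \<Longrightarrow> g i \<in> S" for g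
      by (rule lim) (use tt that in auto)
  qed
  have "Bseq (\<lambda>n. expectation (\<lambda>\<omega>. R n \<omega> ^ r))"
    by (rule convergent_imp_Bseq[OF convergentI[OF R_lim]])
  then obtain W where W: "\<And>n. norm (expectation (\<lambda>\<omega>. R n \<omega> ^ r)) \<le> W"
    by (elim BseqE) blast
  obtain B where B0: "B \<ge> 0" and B: "\<And>n K (tt :: 'p \<Rightarrow> real) b. 1 \<le> n \<Longrightarrow>
    (\<forall>t\<ge>0. all_moments M (\<lambda>\<omega>. real (K t \<omega>)) \<and> K t \<in> borel_measurable M) \<Longrightarrow>
    independent_processes M (UNIV \<times> {1..}) (\<lambda>(i, k). X i k) {0..} K \<Longrightarrow> (\<forall>p\<in>S. 0 \<le> tt p) \<Longrightarrow>
    norm ((\<Sum>k<n. expectation (\<lambda>\<omega>. (\<Sum>p\<in>S. circ_eig n (walk X (K (tt p) \<omega>) \<omega>) k (b p)) ^ r)) / of_nat n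
       - expectation (\<lambda>\<omega>. gauss_mom r (of_real (real n * conj_cov S b (\<lambda>p. real (K (tt p) \<omega>))))))
    \<le> B / sqrt (real n) * expectation (\<lambda>\<omega>. sqrt (real n * (1 + (\<Sum>p\<in>S. real (K (tt p) \<omega>)))) ^ r)"
    using averaged_walk_moment_bound[OF S, of r] by (elim exE conjE) blast
  have diff: "norm (of_real (c n) ^ r * A n - of_real (c n) ^ r * G n) \<le> B * (2 ^ r * (2 ^ r + W)) * (1 / sqrt (real n))"
    if n: "1 \<le> n" for n
  proof -
    have c0: "0 \<le> c n" by (simp add: c_def)
    have n\<alpha>: "1 \<le> real n powr \<alpha>" using n \<alpha> by (simp add: ge_one_powr_ge_zero)
    have arg_nonneg: "0 \<le> real n * (1 + (\<Sum>p\<in>S. real (K (real n * tt p) \<omega>)))" for \<omega>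
      by (intro mult_nonneg_nonneg add_nonneg_nonneg sum_nonneg) auto
    have R0: "0 \<le> R n \<omega>" for \<omega> by (simp add: R_def sum_nonneg)
    have le: "c n ^ r * \<rho> n \<omega> ^ r \<le> 2 ^ r * (2 ^ r + R n \<omega> ^ r)" for \<omega>
    proof -
      let ?m = "\<Sum>p\<in>S. real (K (real n * tt p) \<omega>)"
      have "(c n * \<rho> n \<omega>)\<^sup>2 = ((c n)\<^sup>2 * real n) * (1 + ?m)"
        unfolding power_mult_distrib \<rho>_def real_sqrt_pow2[OF arg_nonneg] by simp
      also have "\<dots> = 1 / real n powr \<alpha> + R n \<omega>"
        unfolding c2[OF n] R_def by (simp add: add_divide_distrib sum_divide_distrib)
      also have "\<dots> \<le> 1 + R n \<omega>" using n\<alpha> n by (auto simp: divide_le_eq_1)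
      finally have sq: "(c n * \<rho> n \<omega>)\<^sup>2 \<le> 1 + R n \<omega>" .
      \<comment> \<open>Trades the square root for a polynomial in the counts, at the price of a
        larger exponent.\<close>
      have "c n * \<rho> n \<omega> \<le> 1 + (c n * \<rho> n \<omega>)\<^sup>2"
        using zero_le_power2[of "c n * \<rho> n \<omega> - 1"] zero_le_power2[of "c n * \<rho> n \<omega>"]
        unfolding power2_diff power_one mult_1_right by linarith
      with sq have "c n * \<rho> n \<omega> \<le> 2 + R n \<omega>" by simp
      then have "(c n * \<rho> n \<omega>) ^ r \<le> (2 + R n \<omega>) ^ r"
        using c0 real_sqrt_ge_zero[OF arg_nonneg] by (intro power_mono) (auto simp: \<rho>_def)
      also have "\<dots> \<le> 2 ^ r * (2 ^ r + R n \<omega> ^ r)"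
        by (rule add_power_le) (auto simp: R_def intro!: sum_nonneg)
      finally show ?thesis by (simp add: power_mult_distrib)
    qed
    have iR: "integrable M (\<lambda>\<omega>. 2 ^ r * (2 ^ r + R n \<omega> ^ r))"
      by (intro all_moments_integrable all_moments_cmult all_moments_add all_moments_power all_moments_const Rm)
    have "expectation (\<lambda>\<omega>. c n ^ r * \<rho> n \<omega> ^ r) \<le> expectation (\<lambda>\<omega>. 2 ^ r * (2 ^ r + R n \<omega> ^ r))"
    proof (rule integral_mono')
      show "0 \<le> 2 ^ r * (2 ^ r + R n \<omega> ^ r)" for \<omega>
        using R0[of \<omega>] by simp
    qed (use iR le in auto)
    also have "\<dots> = 2 ^ r * (2 ^ r + expectation (\<lambda>\<omega>. R n \<omega> ^ r))"
      using all_moments_integrable[OF all_moments_power[OF Rm, of n r]] by (simp add: prob_space)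
    also have "\<dots> \<le> 2 ^ r * (2 ^ r + W)" using W[of n] by simp
    finally have E: "c n ^ r * expectation (\<lambda>\<omega>. \<rho> n \<omega> ^ r) \<le> 2 ^ r * (2 ^ r + W)" by simp
    have "norm (A n - G n) \<le> B / sqrt (real n) * expectation (\<lambda>\<omega>. \<rho> n \<omega> ^ r)"
      unfolding A_def G_def \<rho>_def by (rule B[OF n]) (use K Km ind tt in auto)
    then have "c n ^ r * norm (A n - G n) \<le> c n ^ r * (B / sqrt (real n) * expectation (\<lambda>\<omega>. \<rho> n \<omega> ^ r))"
      using c0 by (intro mult_left_mono) auto
    also have "\<dots> = B / sqrt (real n) * (c n ^ r * expectation (\<lambda>\<omega>. \<rho> n \<omega> ^ r))" by simp
    also have "\<dots> \<le> B / sqrt (real n) * (2 ^ r * (2 ^ r + W))"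
      using E B0 by (intro mult_left_mono) auto
    finally have "c n ^ r * norm (A n - G n) \<le> B / sqrt (real n) * (2 ^ r * (2 ^ r + W))" .
    moreover have "norm (of_real (c n) ^ r * A n - of_real (c n) ^ r * G n) = c n ^ r * norm (A n - G n)"
      unfolding right_diff_distrib[symmetric] norm_mult norm_power using c0 by simp
    ultimately show ?thesis by simp
  qed
  have "(\<lambda>n. of_real (c n) ^ r * A n - of_real (c n) ^ r * G n) \<longlonglongrightarrow> 0"
  proof (rule Lim_null_comparison)
    show "\<forall>\<^sub>F n in sequentially. norm (of_real (c n) ^ r * A n - of_real (c n) ^ r * G n) \<le> B * (2 ^ r * (2 ^ r + W)) * (1 / sqrt (real n))"
      using eventually_ge_at_top[of 1] by eventually_elim (rule diff)
    show "(\<lambda>n. B * (2 ^ r * (2 ^ r + W)) * (1 / sqrt (real n))) \<longlonglongrightarrow> 0"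
      by (intro tendsto_mult_right_zero tendsto_divide_0[OF tendsto_const] filterlim_at_top_imp_at_infinity
          filterlim_compose[OF sqrt_at_top filterlim_real_sequentially])
  qed
  moreover have "(\<lambda>n. of_real (c n) ^ r * G n) \<longlonglongrightarrow> (\<integral>\<omega>. gauss_mom r (of_real (conj_cov S b (\<lambda>p. T (tt p) \<omega>))) \<partial>P)"
  proof (cases "even r")
    case False
    then show ?thesis by (simp add: G_def gauss_mom_odd)
  next
    case True
    then obtain h where r: "r = 2 * h" by blast
    let ?w = "\<lambda>x. if b (fst x) \<noteq> b (snd x) then 1 else 0 :: real"
    let ?\<kappa> = "fact (2 * h) / (2 ^ h * fact h) :: real"
    have Gn: "of_real (c n) ^ r * G n = of_real (?\<kappa> * expectation (\<lambda>\<omega>. (\<Sum>x\<in>S \<times> S. ?w x * y n x \<omega>) ^ h))" if n: "1 \<le> n" for n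
    proof -
      have "of_real (c n) ^ r * gauss_mom r (of_real (real n * conj_cov S b (\<lambda>p. real (K (real n * tt p) \<omega>))))
          = of_real (?\<kappa> * (\<Sum>x\<in>S \<times> S. ?w x * y n x \<omega>) ^ h)" for \<omega>
      proof -
        have "of_real (c n) ^ r * gauss_mom r (of_real (real n * conj_cov S b (\<lambda>p. real (K (real n * tt p) \<omega>))))
          = gauss_mom r (of_real (((c n)\<^sup>2 * real n) * conj_cov S b (\<lambda>p. real (K (real n * tt p) \<omega>))))"
          unfolding gauss_mom_scale[symmetric] by (simp add: mult.assoc)
        also have "((c n)\<^sup>2 * real n) * conj_cov S b (\<lambda>p. real (K (real n * tt p) \<omega>)) = (\<Sum>x\<in>S \<times> S. ?w x * y n x \<omega>)"
          unfolding c2[OF n] conj_cov_pairs y_def sum_distrib_left by (intro sum.cong refl) simp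
        finally show ?thesis unfolding r gauss_mom_of_real_double .
      qed
      then have "of_real (c n) ^ r * G n = expectation (\<lambda>\<omega>. complex_of_real (?\<kappa> * (\<Sum>x\<in>S \<times> S. ?w x * y n x \<omega>) ^ h))"
        unfolding G_def integral_mult_right_zero[symmetric] by presburger
      also have "\<dots> = of_real (?\<kappa> * expectation (\<lambda>\<omega>. (\<Sum>x\<in>S \<times> S. ?w x * y n x \<omega>) ^ h))"
        unfolding integral_complex_of_real integral_mult_right_zero ..
      finally show ?thesis .
    qed
    have "(\<lambda>n. expectation (\<lambda>\<omega>. (\<Sum>x\<in>S \<times> S. ?w x * y n x \<omega>) ^ h))
        \<longlonglongrightarrow> (\<integral>\<omega>. (\<Sum>x\<in>S \<times> S. ?w x * min (T (tt (fst x)) \<omega>) (T (tt (snd x)) \<omega>)) ^ h \<partial>P)"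
    proof (rule tendsto_expectation_power_sum[OF _ prob_space_axioms P ym])
      show "finite (S \<times> S)" using S by simp
      show "all_moments P (\<lambda>\<omega>. min (T (tt (fst x)) \<omega>) (T (tt (snd x)) \<omega>))" if "x \<in> S \<times> S" for x
        using that by (intro all_moments_min T tt) auto
      show "(\<lambda>n. \<integral>\<omega>. (\<Prod>i<h. y n (g i) \<omega>) \<partial>M)
        \<longlonglongrightarrow> (\<integral>\<omega>. (\<Prod>i<h. min (T (tt (fst (g i))) \<omega>) (T (tt (snd (g i))) \<omega>)) \<partial>P)"
        if "\<And>i. i < h \<Longrightarrow> g i \<in> S \<times> S" for g
        unfolding y_def by (rule lim) (use tt that in force)
    qed
    then have "(\<lambda>n. complex_of_real (?\<kappa> * expectation (\<lambda>\<omega>. (\<Sum>x\<in>S \<times> S. ?w x * y n x \<omega>) ^ h)))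
        \<longlonglongrightarrow> of_real (?\<kappa> * (\<integral>\<omega>. conj_cov S b (\<lambda>p. T (tt p) \<omega>) ^ h \<partial>P))"
      unfolding conj_cov_pairs by (intro tendsto_of_real tendsto_mult tendsto_const)
    also have "of_real (?\<kappa> * (\<integral>\<omega>. conj_cov S b (\<lambda>p. T (tt p) \<omega>) ^ h \<partial>P))
        = (\<integral>\<omega>. gauss_mom r (of_real (conj_cov S b (\<lambda>p. T (tt p) \<omega>))) \<partial>P)"
      unfolding r gauss_mom_of_real_double integral_complex_of_real integral_mult_right_zero ..
    finally show ?thesis
      using Gn by (rule_tac Lim_transform_eventually) (auto intro!: eventually_sequentiallyI[of 1])
  qed
  ultimately have "(\<lambda>n. (of_real (c n) ^ r * A n - of_real (c n) ^ r * G n) + of_real (c n) ^ r * G n)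
      \<longlonglongrightarrow> 0 + (\<integral>\<omega>. gauss_mom r (of_real (conj_cov S b (\<lambda>p. T (tt p) \<omega>))) \<partial>P)"
    by (rule tendsto_add)
  then show ?thesis unfolding c_def[symmetric] scaled by simp
qed

end

section \<open>Time-changed complex Brownian motion\<close>

lemma moment_rec_cong:
  assumes "\<And>i j. i \<in> J \<Longrightarrow> \<mu> i j = \<mu>' i j"
  shows "moment_rec J \<mu> e \<longleftrightarrow> moment_rec J \<mu>' e"
proof -
  have "(\<Sum>j\<le>r. of_nat (r choose j) * \<mu> i j * e (r - j) A) = (\<Sum>j\<le>r. of_nat (r choose j) * \<mu>' i j * e (r - j) A)"
    if "i \<in> J - A" for i A and r :: nat
    using that assms by (intro sum.cong refl) simp
  then show ?thesis unfolding moment_rec_def using assms by simp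
qed

section \<open>Moments of Brownian motion\<close>

lemma (in prob_space) normal_moments:
  assumes X: "distributed M lborel X (normal_density 0 (sqrt h))" and h: "0 < h"
  shows "all_moments M X" "complex_of_real (expectation (\<lambda>\<omega>. X \<omega> ^ j)) = gauss_mom j (of_real h)"
proof -
  have s: "0 < sqrt h" using h by simp
  have m: "X \<in> borel_measurable M" using distributed_measurable[OF X] by simp
  have "integrable M (\<lambda>\<omega>. \<bar>X \<omega>\<bar> ^ p)" for p
    using integrable_normal_moment_abs[OF s, of 0 p]
    by (subst distributed_integrable[OF X, of "\<lambda>x. \<bar>x\<bar> ^ p", symmetric]) auto
  then show "all_moments M X" using m by (simp add: all_moments_def)
  have E: "expectation (\<lambda>\<omega>. X \<omega> ^ j) = (\<integral>x. normal_density 0 (sqrt h) x * x ^ j \<partial>lborel)"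
    by (subst distributed_integral[OF X, of "\<lambda>x. x ^ j", symmetric]) auto
  show "complex_of_real (expectation (\<lambda>\<omega>. X \<omega> ^ j)) = gauss_mom j (of_real h)"
  proof (cases "even j")
    case True
    then obtain m where j: "j = 2 * m" by blast
    have "expectation (\<lambda>\<omega>. X \<omega> ^ j) = fact (2 * m) / ((2 / h) ^ m * fact m)"
      using integral_normal_moment_even[OF s, of 0 m] h unfolding j E[unfolded j] by simp
    also have "\<dots> = fact (2 * m) / (2 ^ m * fact m) * h ^ m"
      by (simp add: power_divide)
    finally show ?thesis unfolding j gauss_mom_of_real_double by simp
  next
    case False
    then obtain m where j: "j = 2 * m + 1" by (blast elim: oddE)
    have "expectation (\<lambda>\<omega>. X \<omega> ^ j) = 0"
      using integral_normal_moment_odd[OF s, of 0 m] unfolding j E[unfolded j] by simp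
    then show ?thesis using False by (simp add: gauss_mom_odd)
  qed
qed

lemma all_moments_distr_cong:
  assumes "f \<in> borel_measurable M" "g \<in> borel_measurable M" "distr M borel f = distr M borel g"
    and "all_moments M g"
  shows "all_moments M f"
proof -
  have "integrable M (\<lambda>\<omega>. norm (f \<omega>) ^ p)" for p
  proof -
    have "integrable (distr M borel g) (\<lambda>x. norm x ^ p)"
      using assms(2,4) by (subst integrable_distr_eq) (auto simp: all_moments_def)
    then show ?thesis using assms(1) unfolding assms(3)[symmetric] by (subst (asm) integrable_distr_eq) auto
  qed
  then show ?thesis using assms(1) by (simp add: all_moments_def)
qed

lemma brownian_increment_moments:
  assumes "prob_space M" and B: "brownian_motion M B" and st: "0 \<le> s" "s < t"
  shows "all_moments M (\<lambda>\<omega>. B t \<omega> - B s \<omega>)"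
    "complex_of_real (prob_space.expectation M (\<lambda>\<omega>. (B t \<omega> - B s \<omega>) ^ j)) = gauss_mom j (of_real (t - s))"
proof -
  interpret prob_space M by fact
  have lev: "levy_process M B" and nd: "distributed M lborel (B (t - s)) (normal_density 0 (sqrt (t - s)))"
    using B st by (auto simp: brownian_motion_def)
  have Bm: "B u \<in> borel_measurable M" if "0 \<le> u" for u using lev that by (simp add: levy_process_def)
  have eq: "distr M borel (\<lambda>\<omega>. B t \<omega> - B s \<omega>) = distr M borel (B (t - s))"
  proof -
    have "\<forall>s\<ge>0. \<forall>t\<ge>0. distr M borel (\<lambda>\<omega>. B (s + t) \<omega> - B s \<omega>) = distr M borel (B t)"
      using lev unfolding levy_process_def by blast
    from this[rule_format, of s "t - s"] show ?thesis using st by simp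
  qed
  have m: "(\<lambda>\<omega>. B t \<omega> - B s \<omega>) \<in> borel_measurable M" using Bm[of t] Bm[of s] st by simp
  have m': "B (t - s) \<in> borel_measurable M" using Bm st by simp
  have h: "0 < t - s" using st by simp
  show "all_moments M (\<lambda>\<omega>. B t \<omega> - B s \<omega>)"
    by (rule all_moments_distr_cong[OF m m' eq normal_moments(1)[OF nd h]])
  have "expectation (\<lambda>\<omega>. (B t \<omega> - B s \<omega>) ^ j) = (\<integral>x. x ^ j \<partial>distr M borel (\<lambda>\<omega>. B t \<omega> - B s \<omega>))"
    using m by (subst integral_distr) auto
  also have "\<dots> = expectation (\<lambda>\<omega>. B (t - s) \<omega> ^ j)"
    unfolding eq using m' by (subst integral_distr) auto
  finally show "complex_of_real (expectation (\<lambda>\<omega>. (B t \<omega> - B s \<omega>) ^ j)) = gauss_mom j (of_real (t - s))"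
    using normal_moments(2)[OF nd h, of j] by simp
qed

lemma brownian_all_moments:
  assumes "prob_space M" and B: "brownian_motion M B" and t: "0 \<le> t"
  shows "all_moments M (B t)"
proof -
  interpret prob_space M by fact
  have lev: "levy_process M B" using B by (simp add: brownian_motion_def)
  have Bm: "B t \<in> borel_measurable M" and B0: "AE \<omega> in M. B 0 \<omega> = 0"
    using lev t by (auto simp: levy_process_def)
  show ?thesis
  proof (cases "t = 0")
    case True
    then show ?thesis using B0 Bm
      by (intro all_moments_bound[OF all_moments_const[of "0::real"]]) auto
  next
    case False
    then have "distributed M lborel (B t) (normal_density 0 (sqrt t))" "0 < t"
      using B t by (auto simp: brownian_motion_def)
    then show ?thesis by (rule normal_moments)
  qed
qed

text \<open>Independence of increments is available along strictly increasing times only; finitely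
  many arbitrary times, possibly repeated, are therefore sorted without repetition, from
  \<open>0\<close> on.\<close>

lemma finite_times_enumeration:
  fixes U :: "real set"
  assumes "finite U" "\<And>u. u \<in> U \<Longrightarrow> 0 \<le> u" "0 \<in> U"
  obtains n and ts :: "nat \<Rightarrow> real" where "ts 0 = 0" "\<And>k. k < n \<Longrightarrow> ts k < ts (Suc k)" "U = ts ` {..n}"
proof -
  define xs where "xs = sorted_list_of_set U"
  have xs: "set xs = U" "sorted_wrt (<) xs" using assms(1) by (simp_all add: xs_def)
  then have ne: "xs \<noteq> []" using assms(3) by auto
  show ?thesis
  proof (rule that[of "\<lambda>k. xs ! k" "length xs - 1"])
    show "xs ! k < xs ! Suc k" if "k < length xs - 1" for k
      using xs(2) that by (auto simp: sorted_wrt_iff_nth_less)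
    show "U = (\<lambda>k. xs ! k) ` {..length xs - 1}"
      using ne xs(1) by (auto simp: set_conv_nth image_def less_Suc_eq_le[symmetric] intro!: bexI)
    have "xs ! 0 \<in> U" using ne xs(1) by auto
    moreover obtain i where "i < length xs" "xs ! i = 0" using assms(3) xs(1) by (metis in_set_conv_nth)
    moreover have "xs ! 0 \<le> xs ! i" using xs(2) \<open>i < length xs\<close>
      by (cases "i = 0") (auto simp: sorted_wrt_iff_nth_less less_imp_le)
    ultimately show "xs ! 0 = 0" using assms(2)[of "xs ! 0"] by simp
  qed
qed

text \<open>The condition is put on the times and not on the indices, so that it can be stated for a
  time \<open>u p\<close> before its position in the enumeration is known.\<close>

lemma telescoping_times:
  fixes ts :: "nat \<Rightarrow> real" and f :: "real \<Rightarrow> 'b::real_normed_field"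
  assumes "\<And>k. k < n \<Longrightarrow> ts k < ts (Suc k)" "i \<le> n"
  shows "(\<Sum>k<n. if ts (Suc k) \<le> ts i then f (ts (Suc k)) - f (ts k) else 0) = f (ts i) - f (ts 0)"
proof -
  have mono: "j < k \<Longrightarrow> k \<le> n \<Longrightarrow> ts j < ts k" for j k
  proof (induction k)
    case (Suc k)
    then show ?case using assms(1)[of k] by (cases "j = k") (auto intro: less_trans)
  qed simp
  have "ts (Suc k) \<le> ts i \<longleftrightarrow> k < i" if "k < n" for k
    using mono[of i "Suc k"] mono[of "Suc k" i] that assms(2) by (cases "Suc k = i") (auto simp: not_less_eq[symmetric] not_le[symmetric], linarith?)
  then have "(\<Sum>k<n. if ts (Suc k) \<le> ts i then f (ts (Suc k)) - f (ts k) else 0) = (\<Sum>k<n. if k < i then f (ts (Suc k)) - f (ts k) else 0)"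
    by (intro sum.cong) auto
  also have "\<dots> = (\<Sum>k<i. f (ts (Suc k)) - f (ts k))"
    using assms(2) by (intro sum.mono_neutral_cong_right) auto
  also have "\<dots> = f (ts i) - f (ts 0)" by (rule sum_lessThan_telescope)
  finally show ?thesis .
qed

lemma brownian_linear_moment:
  fixes a :: "'p \<Rightarrow> complex"
  assumes "prob_space M" and B: "brownian_motion M B" and S: "finite S" and u: "\<And>p. p \<in> S \<Longrightarrow> 0 \<le> u p"
  shows "prob_space.expectation M (\<lambda>\<omega>. (\<Sum>p\<in>S. a p * of_real (B (u p) \<omega>)) ^ r)
    = gauss_mom r (\<Sum>p\<in>S. \<Sum>q\<in>S. a p * a q * of_real (min (u p) (u q)))"
proof -
  interpret prob_space M by fact
  have lev: "levy_process M B" using B by (simp add: brownian_motion_def)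
  have Bm: "B t \<in> borel_measurable M" if "0 \<le> t" for t using lev that by (simp add: levy_process_def)
  have B0: "AE \<omega> in M. B 0 \<omega> = 0" using lev by (simp add: levy_process_def)
  obtain n ts where ts0: "ts 0 = 0" and ts: "\<And>k. k < n \<Longrightarrow> ts k < ts (Suc k)" and U: "insert 0 (u ` S) = ts ` {..n}"
    using finite_times_enumeration[of "insert 0 (u ` S)"] S u by (metis (no_types, lifting) finite.insertI finite_imageI imageE insertE insertI1 order_refl)
  have tsn: "0 \<le> ts k" if "k \<le> n" for k
  proof -
    have "ts k \<in> insert 0 (u ` S)" unfolding U using that by blast
    then show ?thesis using u by auto
  qed
  have idx: "\<exists>i\<le>n. u p = ts i" if "p \<in> S" for p
  proof -
    have "u p \<in> ts ` {..n}" unfolding U[symmetric] using that by blast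
    then show ?thesis by auto
  qed
  \<comment> \<open>The weight of the \<open>k\<close>-th increment: it is part of every value taken
    at or after its right end.\<close>
  define c where "c k = (\<Sum>p\<in>S. if ts (Suc k) \<le> u p then a p else 0)" for k
  define h where "h k = ts (Suc k) - ts k" for k
  define \<Delta> where "\<Delta> k \<omega> = B (ts (Suc k)) \<omega> - B (ts k) \<omega>" for k \<omega>
  have ind: "indep_vars (\<lambda>_. borel) \<Delta> {..<n}"
  proof -
    have "\<forall>n (ts :: nat \<Rightarrow> real). 0 \<le> ts 0 \<longrightarrow> (\<forall>k<n. ts k < ts (Suc k)) \<longrightarrow>
        indep_vars (\<lambda>_. borel) (\<lambda>k \<omega>. B (ts (Suc k)) \<omega> - B (ts k) \<omega>) {..<n}"
      using lev unfolding levy_process_def by blast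
    then show ?thesis using ts ts0 unfolding \<Delta>_def by auto
  qed
  have mom1: "all_moments M (\<Delta> k)" if "k < n" for k
    unfolding \<Delta>_def by (rule brownian_increment_moments(1)[OF assms(1) B tsn ts]) (use that in auto)
  have mom2: "complex_of_real (expectation (\<lambda>\<omega>. \<Delta> k \<omega> ^ j)) = gauss_mom j (of_real (h k))" if "k < n" for k j
    unfolding \<Delta>_def h_def by (rule brownian_increment_moments(2)[OF assms(1) B tsn ts]) (use that in auto)
  have "complex_of_real (expectation (\<Delta> k)) = 0" if "k < n" for k
    using mom2[OF that, of 1] by simp
  then have mean: "expectation (\<Delta> k) = 0" if "k < n" for k using that by simp
  have mr: "moment_rec {..<n} (\<lambda>i j. c i ^ j * of_real (expectation (\<lambda>\<omega>. \<Delta> i \<omega> ^ j)))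
    (\<lambda>r A. expectation (\<lambda>\<omega>. (\<Sum>i\<in>A. c i * of_real (\<Delta> i \<omega>)) ^ r))"
    by (rule moment_rec_indep[OF ind]) (use mom1 mean in auto)
  have mr': "moment_rec {..<n} (\<lambda>i j. c i ^ j * of_real (expectation (\<lambda>\<omega>. \<Delta> i \<omega> ^ j)))
    (\<lambda>r A. gauss_mom r (\<Sum>i\<in>A. (c i)\<^sup>2 * of_real (h i)))"
  proof -
    have "moment_rec {..<n} (\<lambda>i j. gauss_mom j ((c i)\<^sup>2 * of_real (h i))) (\<lambda>r A. gauss_mom r (\<Sum>i\<in>A. (c i)\<^sup>2 * of_real (h i)))"
      by (rule moment_rec_gauss_mom)
    then show ?thesis
      by (rule moment_rec_cong[THEN iffD1, rotated]) (simp add: mom2 gauss_mom_scale)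
  qed
  have key: "expectation (\<lambda>\<omega>. (\<Sum>k<n. c k * of_real (\<Delta> k \<omega>)) ^ r) = gauss_mom r (\<Sum>k<n. (c k)\<^sup>2 * of_real (h k))"
    using moment_rec_unique[OF mr mr', of "{..<n}" r] by simp
  have lin: "(\<Sum>k<n. c k * of_real (\<Delta> k \<omega>)) = (\<Sum>p\<in>S. a p * of_real (B (u p) \<omega> - B 0 \<omega>))" for \<omega>
  proof -
    have "(\<Sum>k<n. c k * of_real (\<Delta> k \<omega>)) = (\<Sum>k<n. \<Sum>p\<in>S. a p * of_real (if ts (Suc k) \<le> u p then B (ts (Suc k)) \<omega> - B (ts k) \<omega> else 0))"
      unfolding c_def \<Delta>_def sum_distrib_right by (intro sum.cong refl) auto
    also have "\<dots> = (\<Sum>p\<in>S. a p * of_real (\<Sum>k<n. if ts (Suc k) \<le> u p then B (ts (Suc k)) \<omega> - B (ts k) \<omega> else 0))"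
      by (subst sum.swap) (simp add: sum_distrib_left)
    also have "\<dots> = (\<Sum>p\<in>S. a p * of_real (B (u p) \<omega> - B 0 \<omega>))"
    proof (rule sum.cong[OF refl])
      fix p assume "p \<in> S"
      then obtain i where i: "i \<le> n" "u p = ts i" using idx by blast
      show "a p * of_real (\<Sum>k<n. if ts (Suc k) \<le> u p then B (ts (Suc k)) \<omega> - B (ts k) \<omega> else 0) = a p * of_real (B (u p) \<omega> - B 0 \<omega>)"
      proof -
        have "(\<Sum>k<n. if ts (Suc k) \<le> ts i then B (ts (Suc k)) \<omega> - B (ts k) \<omega> else 0) = B (ts i) \<omega> - B (ts 0) \<omega>"
          by (rule telescoping_times[of n ts i "\<lambda>t. B t \<omega>"]) (use ts i in auto)
        then show ?thesis unfolding i(2) ts0 by (simp only:)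
      qed
    qed
    finally show ?thesis .
  qed
  have var: "(\<Sum>k<n. (c k)\<^sup>2 * of_real (h k)) = (\<Sum>p\<in>S. \<Sum>q\<in>S. a p * a q * of_real (min (u p) (u q)))"
  proof -
    have "(\<Sum>k<n. (c k)\<^sup>2 * of_real (h k))
      = (\<Sum>k<n. \<Sum>p\<in>S. \<Sum>q\<in>S. a p * a q * of_real (if ts (Suc k) \<le> min (u p) (u q) then ts (Suc k) - ts k else 0))"
      unfolding c_def h_def power2_eq_square sum_product unfolding sum_distrib_right by (intro sum.cong refl) auto
    also have "\<dots> = (\<Sum>p\<in>S. \<Sum>k<n. \<Sum>q\<in>S. a p * a q * of_real (if ts (Suc k) \<le> min (u p) (u q) then ts (Suc k) - ts k else 0))"
      by (rule sum.swap)
    also have "\<dots> = (\<Sum>p\<in>S. \<Sum>q\<in>S. \<Sum>k<n. a p * a q * of_real (if ts (Suc k) \<le> min (u p) (u q) then ts (Suc k) - ts k else 0))"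
      by (intro sum.cong[OF refl] sum.swap)
    also have "\<dots> = (\<Sum>p\<in>S. \<Sum>q\<in>S. a p * a q * of_real (\<Sum>k<n. if ts (Suc k) \<le> min (u p) (u q) then ts (Suc k) - ts k else 0))"
      by (simp only: sum_distrib_left of_real_sum)
    also have "\<dots> = (\<Sum>p\<in>S. \<Sum>q\<in>S. a p * a q * of_real (min (u p) (u q)))"
    proof (intro sum.cong refl)
      fix p q assume pq: "p \<in> S" "q \<in> S"
      then obtain i where i: "i \<le> n" "min (u p) (u q) = ts i" using idx by (metis min_def)
      show "a p * a q * of_real (\<Sum>k<n. if ts (Suc k) \<le> min (u p) (u q) then ts (Suc k) - ts k else 0)
        = a p * a q * of_real (min (u p) (u q))"
      proof -
        have "(\<Sum>k<n. if ts (Suc k) \<le> ts i then ts (Suc k) - ts k else 0) = ts i - ts 0"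
          by (rule telescoping_times[of n ts i "\<lambda>t. t"]) (use ts i in auto)
        then show ?thesis unfolding i(2) ts0 by (simp only: diff_zero)
      qed
    qed
    finally show ?thesis .
  qed
  have Bu: "B (u p) \<in> borel_measurable M" if "p \<in> S" for p using Bm u that by blast
  \<comment> \<open>Increments only give \<open>B (u p) - B 0\<close>, and \<open>B 0\<close>
    vanishes merely almost surely.\<close>
  have "expectation (\<lambda>\<omega>. (\<Sum>p\<in>S. a p * of_real (B (u p) \<omega>)) ^ r)
      = expectation (\<lambda>\<omega>. (\<Sum>p\<in>S. a p * of_real (B (u p) \<omega> - B 0 \<omega>)) ^ r)"
  proof (rule integral_cong_AE)
    show "AE \<omega> in M. (\<Sum>p\<in>S. a p * of_real (B (u p) \<omega>)) ^ r = (\<Sum>p\<in>S. a p * of_real (B (u p) \<omega> - B 0 \<omega>)) ^ r"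
      using B0 by eventually_elim simp
  qed (use Bu Bm[of 0] in measurable)
  then show ?thesis using key unfolding lin var by simp
qed

text \<open>The random time is approximated from the right on the grid of mesh
  \<open>1 / Suc m\<close>. The grid is countable, so the approximations are measurable; right
  continuity of every path, not only of almost every one, passes this to the limit without
  completion.\<close>

lemma right_continuous_joint_measurable:
  fixes Z :: "real \<Rightarrow> 'a \<Rightarrow> 'b::metric_space"
  assumes Z: "\<And>u. 0 \<le> u \<Longrightarrow> Z u \<in> borel_measurable A"
    and rc: "\<And>\<omega> u. \<omega> \<in> space A \<Longrightarrow> 0 \<le> u \<Longrightarrow> continuous (at_right u) (\<lambda>s. Z s \<omega>)"
    and g: "g \<in> borel_measurable N" "\<And>x. x \<in> space N \<Longrightarrow> 0 \<le> g x" and h: "h \<in> measurable N A"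
  shows "(\<lambda>x. Z (g x) (h x)) \<in> borel_measurable N"
proof (rule borel_measurable_LIMSEQ_metric)
  \<comment> \<open>The \<open>+ 1\<close> makes the grid time strictly larger than
    \<open>g x\<close>, as convergence within \<open>at_right\<close> demands.\<close>
  define d where "d m x = (real (nat \<lfloor>real (Suc m) * g x\<rfloor>) + 1) / real (Suc m)" for m x
  show "(\<lambda>x. Z (d m x) (h x)) \<in> borel_measurable N" for m
    unfolding d_def
  proof (rule measurable_compose_countable[of "\<lambda>i x. Z ((real i + 1) / real (Suc m)) (h x)" _ _ "\<lambda>x. nat \<lfloor>real (Suc m) * g x\<rfloor>"])
    show "(\<lambda>x. Z ((real i + 1) / real (Suc m)) (h x)) \<in> borel_measurable N" for i
      by (rule measurable_compose[OF h Z]) auto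
    show "(\<lambda>x. nat \<lfloor>real (Suc m) * g x\<rfloor>) \<in> measurable N (count_space UNIV)"
      using g(1) by measurable
  qed
  fix x assume x: "x \<in> space N"
  have hx: "h x \<in> space A" using measurable_space[OF h x] .
  have bounds: "g x < d m x \<and> d m x \<le> g x + 1 / real (Suc m)" for m
  proof -
    have f: "real (nat \<lfloor>real (Suc m) * g x\<rfloor>) = of_int \<lfloor>real (Suc m) * g x\<rfloor>"
      using g(2)[OF x] by simp
    have "real (Suc m) * g x < real (nat \<lfloor>real (Suc m) * g x\<rfloor>) + 1"
      unfolding f by linarith
    moreover have "real (nat \<lfloor>real (Suc m) * g x\<rfloor>) + 1 \<le> real (Suc m) * g x + 1"
      unfolding f by linarith
    ultimately show ?thesis unfolding d_def
      by (simp add: pos_less_divide_eq pos_divide_le_eq distrib_left mult.commute del: of_nat_Suc)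
  qed
  have "(\<lambda>m. d m x) \<longlonglongrightarrow> g x"
  proof (rule tendsto_sandwich[OF _ _ tendsto_const])
    show "(\<lambda>m. g x + 1 / real (Suc m)) \<longlonglongrightarrow> g x"
      using tendsto_add[OF tendsto_const LIMSEQ_Suc[OF lim_1_over_n], of "g x"] by simp
  qed (use bounds in \<open>auto intro!: always_eventually less_imp_le\<close>)
  then have "filterlim (\<lambda>m. d m x) (at_right (g x)) sequentially"
    using bounds by (simp add: filterlim_at less_imp_neq[THEN not_sym])
  moreover have "((\<lambda>s. Z s (h x)) \<longlongrightarrow> Z (g x) (h x)) (at_right (g x))"
    using rc[OF hx g(2)[OF x]] by (simp add: continuous_within)
  ultimately show "(\<lambda>m. Z (d m x) (h x)) \<longlonglongrightarrow> Z (g x) (h x)"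
    by (rule filterlim_compose[rotated])
qed

section \<open>Complex Brownian motion and its time change\<close>

definition conj_if :: "bool \<Rightarrow> complex \<Rightarrow> complex" where
  "conj_if b z = (if b then cnj z else z)"

lemma conj_if_complex_bm:
  "conj_if b (complex_bm B1 B2 t \<omega>)
    = of_real (1 / sqrt 2) * of_real (B1 t \<omega>) + (of_int (letter_sign b) * \<i> / of_real (sqrt 2)) * of_real (B2 t \<omega>)"
  by (simp add: conj_if_def complex_bm_def letter_sign_def add_divide_distrib diff_divide_distrib)

locale complex_brownian = prob_space M for M :: "'a measure" +
  fixes B1 B2 :: "real \<Rightarrow> 'a \<Rightarrow> real"
  assumes B1: "brownian_motion M B1" and B2: "brownian_motion M B2"
    and B12: "independent_processes M {0..} B1 {0..} B2"
begin

lemma B_measurable: "0 \<le> t \<Longrightarrow> B1 t \<in> borel_measurable M" "0 \<le> t \<Longrightarrow> B2 t \<in> borel_measurable M"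
  using B1 B2 by (simp_all add: brownian_motion_def levy_process_def)

lemma complex_bm_measurable: "0 \<le> t \<Longrightarrow> complex_bm B1 B2 t \<in> borel_measurable M"
  using B_measurable[of t] unfolding complex_bm_def[abs_def] by measurable

lemma complex_bm_right_continuous:
  assumes "\<omega> \<in> space M" "0 \<le> u"
  shows "continuous (at_right u) (\<lambda>s. complex_bm B1 B2 s \<omega>)"
proof -
  have "continuous (at_right u) (\<lambda>s. B1 s \<omega>)" "continuous (at_right u) (\<lambda>s. B2 s \<omega>)"
    using B1 B2 assms by (auto simp: brownian_motion_def levy_process_def)
  then show ?thesis unfolding complex_bm_def
    by (intro continuous_divide continuous_add continuous_mult continuous_of_real continuous_const) auto
qed

text \<open>The parts coming from \<open>B1\<close> and \<open>B2\<close> are independent Gaussians,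
  so their variances add. For a pair of letters \<open>B1\<close> contributes half the minimum, and
  \<open>B2\<close> contributes minus half the minimum times the product of the two signs: these
  cancel for letters of equal type and add up for opposite ones.\<close>

lemma complex_bm_moment:
  assumes S: "finite S" and u: "\<And>p. p \<in> S \<Longrightarrow> 0 \<le> u p"
  shows "expectation (\<lambda>\<omega>. (\<Sum>p\<in>S. conj_if (b p) (complex_bm B1 B2 (u p) \<omega>)) ^ r)
    = gauss_mom r (of_real (conj_cov S b u))"
proof -
  define a2 where "a2 p = of_int (letter_sign (b p)) * \<i> / of_real (sqrt 2)" for p
  define U where "U \<omega> = (\<Sum>p\<in>S. of_real (1 / sqrt 2) * complex_of_real (B1 (u p) \<omega>))" for \<omega>
  define V where "V \<omega> = (\<Sum>p\<in>S. a2 p * complex_of_real (B2 (u p) \<omega>))" for \<omega>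
  let ?A = "process_measure M {0..} B1" and ?B = "process_measure M {0..} B2"
  have m1: "B1 t \<in> borel_measurable M" if "t \<in> {0..}" for t using B_measurable that by simp
  have m2: "B2 t \<in> borel_measurable M" if "t \<in> {0..}" for t using B_measurable that by simp
  note fr = freezing_processes[OF m1 m2 B12]
  have Um: "U \<in> borel_measurable ?A" unfolding U_def
    by (intro borel_measurable_sum borel_measurable_times borel_measurable_const
        measurable_compose[OF measurable_process_measure borel_measurable_of_real]) (use u in auto)
  have Vm: "V \<in> borel_measurable ?B" unfolding V_def
    by (intro borel_measurable_sum borel_measurable_times borel_measurable_const
        measurable_compose[OF measurable_process_measure borel_measurable_of_real]) (use u in auto)
  have Ua: "all_moments M U" unfolding U_def
    by (intro all_moments_sum all_moments_cmult all_moments_of_real brownian_all_moments[OF prob_space_axioms B1] u)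
  have Va: "all_moments M V" unfolding V_def
    by (intro all_moments_sum all_moments_cmult all_moments_of_real brownian_all_moments[OF prob_space_axioms B2] u)
  have EU: "expectation (\<lambda>\<omega>. U \<omega> ^ j) = gauss_mom j (\<Sum>p\<in>S. \<Sum>q\<in>S. of_real (1 / sqrt 2) * of_real (1 / sqrt 2) * of_real (min (u p) (u q)))" for j
    unfolding U_def by (rule brownian_linear_moment[OF prob_space_axioms B1 S u])
  have EV: "expectation (\<lambda>\<omega>. V \<omega> ^ j) = gauss_mom j (\<Sum>p\<in>S. \<Sum>q\<in>S. a2 p * a2 q * of_real (min (u p) (u q)))" for j
    unfolding V_def by (rule brownian_linear_moment[OF prob_space_axioms B2 S u])
  have prod: "expectation (\<lambda>\<omega>. U \<omega> ^ j * V \<omega> ^ k) = expectation (\<lambda>\<omega>. U \<omega> ^ j) * expectation (\<lambda>\<omega>. V \<omega> ^ k)" for j k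
  proof -
    have m: "case_prod (\<lambda>\<omega> \<omega>'. U \<omega> ^ j * V \<omega>' ^ k) \<in> borel_measurable (?A \<Otimes>\<^sub>M ?B)"
      using Um Vm unfolding case_prod_beta' by measurable
    have i: "integrable M (\<lambda>\<omega>. U \<omega> ^ j * V \<omega> ^ k)"
      by (intro all_moments_integrable all_moments_mult all_moments_power Ua Va)
    from freezing(1)[OF fr m i] show ?thesis by simp
  qed
  have "expectation (\<lambda>\<omega>. (\<Sum>p\<in>S. conj_if (b p) (complex_bm B1 B2 (u p) \<omega>)) ^ r)
      = expectation (\<lambda>\<omega>. (U \<omega> + V \<omega>) ^ r)"
    unfolding conj_if_complex_bm sum.distrib U_def V_def a2_def ..
  also have "\<dots> = expectation (\<lambda>\<omega>. \<Sum>j\<le>r. of_nat (r choose j) * (U \<omega> ^ j * V \<omega> ^ (r - j)))"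
    by (simp add: binomial_ring mult.assoc)
  also have "\<dots> = (\<Sum>j\<le>r. of_nat (r choose j) * (expectation (\<lambda>\<omega>. U \<omega> ^ j * V \<omega> ^ (r - j))))"
    by (subst Bochner_Integration.integral_sum)
      (auto intro!: all_moments_integrable all_moments_cmult all_moments_mult all_moments_power Ua Va)
  also have "\<dots> = gauss_mom r ((\<Sum>p\<in>S. \<Sum>q\<in>S. of_real (1 / sqrt 2) * of_real (1 / sqrt 2) * of_real (min (u p) (u q)))
      + (\<Sum>p\<in>S. \<Sum>q\<in>S. a2 p * a2 q * of_real (min (u p) (u q))))"
    unfolding prod EU EV mult.assoc[symmetric] by (rule gauss_mom_add)
  also have "(\<Sum>p\<in>S. \<Sum>q\<in>S. of_real (1 / sqrt 2) * of_real (1 / sqrt 2) * of_real (min (u p) (u q)))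
      + (\<Sum>p\<in>S. \<Sum>q\<in>S. a2 p * a2 q * of_real (min (u p) (u q))) = complex_of_real (conj_cov S b u)"
    unfolding conj_cov_def of_real_sum sum.distrib[symmetric]
  proof (intro sum.cong refl)
    fix p q
    have s: "complex_of_real (1 / sqrt 2) * of_real (1 / sqrt 2) = 1 / 2"
      by (simp flip: of_real_mult)
    have "a2 p * a2 q = - (of_int (letter_sign (b p) * letter_sign (b q)) * (of_real (1 / sqrt 2) * of_real (1 / sqrt 2)))"
      unfolding a2_def by (simp add: field_simps)
    then have "a2 p * a2 q = - (of_int (letter_sign (b p) * letter_sign (b q)) / 2)"
      unfolding s by simp
    then show "of_real (1 / sqrt 2) * of_real (1 / sqrt 2) * of_real (min (u p) (u q)) + a2 p * a2 q * of_real (min (u p) (u q))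
        = complex_of_real (if b p \<noteq> b q then min (u p) (u q) else 0)"
      unfolding s by (auto simp: letter_sign_def)
  qed
  finally show ?thesis .
qed

text \<open>The dependence on \<open>u\<close> is explicit because \<open>u\<close> will be replaced
  by a random time with finite moments.\<close>

lemma complex_bm_even_moment_bound:
  "\<exists>C\<ge>0. \<forall>u\<ge>0. (\<integral>\<^sup>+\<omega>. ennreal (norm (complex_bm B1 B2 u \<omega>) ^ (2 * p)) \<partial>M) \<le> ennreal (C * u ^ p)"
proof -
  define \<kappa> :: real where "\<kappa> = fact (2 * p) / (2 ^ p * fact p)"
  have EB: "expectation (\<lambda>\<omega>. B u \<omega> ^ (2 * p)) = \<kappa> * u ^ p" if "brownian_motion M B" "0 \<le> u" for B u
  proof -
    \<comment> \<open>The general formula with a one-point index set; it includes time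
      \<open>0\<close>, where there is no density.\<close>
    have "expectation (\<lambda>\<omega>. (\<Sum>q\<in>{()}. 1 * complex_of_real (B ((\<lambda>_. u) q) \<omega>)) ^ (2 * p))
        = gauss_mom (2 * p) (\<Sum>q\<in>{()}. \<Sum>q'\<in>{()}. 1 * 1 * of_real (min ((\<lambda>_. u) q) ((\<lambda>_. u) q')))"
      by (rule brownian_linear_moment[OF prob_space_axioms that(1)]) (use that in auto)
    then have "complex_of_real (expectation (\<lambda>\<omega>. B u \<omega> ^ (2 * p))) = of_real (\<kappa> * u ^ p)"
      unfolding \<kappa>_def gauss_mom_of_real_double[symmetric] by (simp flip: of_real_power)
    then show ?thesis by (simp only: of_real_eq_iff)
  qed
  show ?thesis
  proof (intro exI[of _ "2 ^ p * (2 * \<kappa>)"] conjI allI impI)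
    show "0 \<le> 2 ^ p * (2 * \<kappa>)" by (simp add: \<kappa>_def)
    fix u :: real assume u: "0 \<le> u"
    have le: "norm (complex_bm B1 B2 u \<omega>) ^ (2 * p) \<le> 2 ^ p * (B1 u \<omega> ^ (2 * p) + B2 u \<omega> ^ (2 * p))" for \<omega>
    proof -
      have "(norm (complex_bm B1 B2 u \<omega>))\<^sup>2 = ((B1 u \<omega>)\<^sup>2 + (B2 u \<omega>)\<^sup>2) / 2"
        by (simp add: complex_bm_def norm_divide power_divide cmod_power2)
      also have "\<dots> \<le> (B1 u \<omega>)\<^sup>2 + (B2 u \<omega>)\<^sup>2" by simp
      finally have "((norm (complex_bm B1 B2 u \<omega>))\<^sup>2) ^ p \<le> ((B1 u \<omega>)\<^sup>2 + (B2 u \<omega>)\<^sup>2) ^ p"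
        by (rule power_mono) simp
      also have "\<dots> \<le> 2 ^ p * (((B1 u \<omega>)\<^sup>2) ^ p + ((B2 u \<omega>)\<^sup>2) ^ p)" by (rule add_power_le) auto
      finally show ?thesis by (simp add: power_mult)
    qed
    have i: "integrable M (\<lambda>\<omega>. B1 u \<omega> ^ (2 * p))" "integrable M (\<lambda>\<omega>. B2 u \<omega> ^ (2 * p))"
      by (intro all_moments_integrable all_moments_power brownian_all_moments[OF prob_space_axioms] B1 B2 u)+
    have "(\<integral>\<^sup>+\<omega>. ennreal (norm (complex_bm B1 B2 u \<omega>) ^ (2 * p)) \<partial>M)
      \<le> (\<integral>\<^sup>+\<omega>. ennreal (2 ^ p * (B1 u \<omega> ^ (2 * p) + B2 u \<omega> ^ (2 * p))) \<partial>M)"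
      by (intro nn_integral_mono ennreal_leI le)
    also have "\<dots> = ennreal (expectation (\<lambda>\<omega>. 2 ^ p * (B1 u \<omega> ^ (2 * p) + B2 u \<omega> ^ (2 * p))))"
      using i by (intro nn_integral_eq_integral) auto
    also have "expectation (\<lambda>\<omega>. 2 ^ p * (B1 u \<omega> ^ (2 * p) + B2 u \<omega> ^ (2 * p))) = 2 ^ p * (2 * \<kappa>) * u ^ p"
      using i EB[OF B1 u] EB[OF B2 u] by simp
    finally show "(\<integral>\<^sup>+\<omega>. ennreal (norm (complex_bm B1 B2 u \<omega>) ^ (2 * p)) \<partial>M) \<le> ennreal (2 ^ p * (2 * \<kappa>) * u ^ p)" .
  qed
qed

context
  fixes T :: "real \<Rightarrow> 'a \<Rightarrow> real"
  assumes T: "\<And>t. 0 \<le> t \<Longrightarrow> all_moments M (T t)"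
    and T0: "\<And>t \<omega>. 0 \<le> t \<Longrightarrow> \<omega> \<in> space M \<Longrightarrow> 0 \<le> T t \<omega>"
    and indT: "independent_processes M {0..} (complex_bm B1 B2) {0..} T"
begin

lemma time_changed_bm_freezing:
  shows "subalgebra M (process_measure M {0..} (complex_bm B1 B2))" "subalgebra M (process_measure M {0..} T)"
    "indep_set (sets (process_measure M {0..} (complex_bm B1 B2))) (sets (process_measure M {0..} T))"
proof -
  have m1: "complex_bm B1 B2 t \<in> borel_measurable M" if "t \<in> {0..}" for t using complex_bm_measurable that by simp
  have m2: "T t \<in> borel_measurable M" if "t \<in> {0..}" for t using T[THEN all_moments_measurable] that by simp
  show "subalgebra M (process_measure M {0..} (complex_bm B1 B2))" "subalgebra M (process_measure M {0..} T)"
    "indep_set (sets (process_measure M {0..} (complex_bm B1 B2))) (sets (process_measure M {0..} T))"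
    by (rule freezing_processes[OF m1 m2 indT]; assumption)+
qed

lemma time_changed_bm_joint_measurable:
  assumes t: "0 \<le> t"
  shows "(\<lambda>z. complex_bm B1 B2 (T t (snd z)) (fst z))
    \<in> borel_measurable (process_measure M {0..} (complex_bm B1 B2) \<Otimes>\<^sub>M process_measure M {0..} T)"
proof (rule right_continuous_joint_measurable[where A = "process_measure M {0..} (complex_bm B1 B2)"])
  show "(\<lambda>z. T t (snd z)) \<in> borel_measurable (process_measure M {0..} (complex_bm B1 B2) \<Otimes>\<^sub>M process_measure M {0..} T)"
    by (intro measurable_compose[OF measurable_snd] measurable_process_measure) (use t in auto)
qed (use T0 t in \<open>auto intro: measurable_process_measure complex_bm_right_continuous simp: space_pair_measure\<close>)

lemma time_changed_bm_all_moments: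
  assumes t: "0 \<le> t"
  shows "all_moments M (\<lambda>\<omega>. complex_bm B1 B2 (T t \<omega>) \<omega>)"
proof (rule all_moments_even)
  let ?A = "process_measure M {0..} (complex_bm B1 B2)" and ?B = "process_measure M {0..} T"
  note fr = time_changed_bm_freezing
  note jm = time_changed_bm_joint_measurable[OF t]
  show m: "(\<lambda>\<omega>. complex_bm B1 B2 (T t \<omega>) \<omega>) \<in> borel_measurable M"
    by (rule right_continuous_joint_measurable[where A = M])
      (use T[OF t, THEN all_moments_measurable] T0 t in \<open>auto intro: complex_bm_measurable complex_bm_right_continuous\<close>)
  fix p :: nat
  obtain C where C: "0 \<le> C" "\<And>u. 0 \<le> u \<Longrightarrow> (\<integral>\<^sup>+\<omega>. ennreal (norm (complex_bm B1 B2 u \<omega>) ^ (2 * p)) \<partial>M) \<le> ennreal (C * u ^ p)"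
    using complex_bm_even_moment_bound[of p] by blast
  show "integrable M (\<lambda>\<omega>. norm (complex_bm B1 B2 (T t \<omega>) \<omega>) ^ (2 * p))"
  proof (rule integrableI_bounded)
    show "(\<lambda>\<omega>. norm (complex_bm B1 B2 (T t \<omega>) \<omega>) ^ (2 * p)) \<in> borel_measurable M" using m by measurable
    have "(\<lambda>x::complex. ennreal (norm x ^ (2 * p))) \<in> borel_measurable borel" by measurable
    note m' = measurable_compose[OF jm this]
    have m2: "case_prod (\<lambda>\<omega> \<omega>'. ennreal (norm (complex_bm B1 B2 (T t \<omega>') \<omega>) ^ (2 * p))) \<in> borel_measurable (?A \<Otimes>\<^sub>M ?B)"
      using m' unfolding case_prod_beta' .
    have "(\<integral>\<^sup>+\<omega>. ennreal (norm (norm (complex_bm B1 B2 (T t \<omega>) \<omega>) ^ (2 * p))) \<partial>M)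
       = (\<integral>\<^sup>+\<omega>'. \<integral>\<^sup>+\<omega>. ennreal (norm (complex_bm B1 B2 (T t \<omega>') \<omega>) ^ (2 * p)) \<partial>M \<partial>M)"
      using freezing_nn[OF fr m2] by simp
    also have "\<dots> \<le> (\<integral>\<^sup>+\<omega>'. ennreal (C * T t \<omega>' ^ p) \<partial>M)"
      using T0[OF t] by (intro nn_integral_mono C(2))
    also have "\<dots> = ennreal (expectation (\<lambda>\<omega>'. C * T t \<omega>' ^ p))"
      using T0[OF t] C(1) by (intro nn_integral_eq_integral all_moments_integrable all_moments_cmult all_moments_power T t) (auto intro!: AE_I2)
    also have "\<dots> < \<infinity>" by simp
    finally show "(\<integral>\<^sup>+\<omega>. ennreal (norm (norm (complex_bm B1 B2 (T t \<omega>) \<omega>) ^ (2 * p))) \<partial>M) < \<infinity>" .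
  qed
qed unfold_locales

text \<open>Freezing the clock leaves Gaussian moments at deterministic times, so the answer is the
  same functional of the clock as the one reached in the limit of the walks.\<close>

lemma time_changed_bm_moment:
  assumes S: "finite S" and tt: "\<And>p. p \<in> S \<Longrightarrow> 0 \<le> tt p"
  shows "expectation (\<lambda>\<omega>. (\<Sum>p\<in>S. conj_if (b p) (complex_bm B1 B2 (T (tt p) \<omega>) \<omega>)) ^ r)
    = expectation (\<lambda>\<omega>. gauss_mom r (of_real (conj_cov S b (\<lambda>p. T (tt p) \<omega>))))"
proof -
  let ?A = "process_measure M {0..} (complex_bm B1 B2)" and ?B = "process_measure M {0..} T"
  note fr = time_changed_bm_freezing
  have cm: "conj_if c \<in> borel_measurable borel" for c
    unfolding conj_if_def[abs_def] by (cases c) (auto intro!: borel_measurable_continuous_onI continuous_intros)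
  have "(\<lambda>z. (\<Sum>p\<in>S. conj_if (b p) (complex_bm B1 B2 (T (tt p) (snd z)) (fst z))) ^ r) \<in> borel_measurable (?A \<Otimes>\<^sub>M ?B)"
    by (intro borel_measurable_power borel_measurable_sum measurable_compose[OF time_changed_bm_joint_measurable cm] tt)
  then have m: "case_prod (\<lambda>\<omega> \<omega>'. (\<Sum>p\<in>S. conj_if (b p) (complex_bm B1 B2 (T (tt p) \<omega>') \<omega>)) ^ r) \<in> borel_measurable (?A \<Otimes>\<^sub>M ?B)"
    unfolding case_prod_beta' .
  have "all_moments M (\<lambda>\<omega>. conj_if (b p) (complex_bm B1 B2 (T (tt p) \<omega>) \<omega>))" if "p \<in> S" for p
    using time_changed_bm_all_moments[OF tt[OF that]] measurable_compose[OF all_moments_measurable[OF time_changed_bm_all_moments[OF tt[OF that]]] cm]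
    unfolding all_moments_def by (simp add: conj_if_def if_distrib cong: if_cong)
  then have i: "integrable M (\<lambda>\<omega>. (\<Sum>p\<in>S. conj_if (b p) (complex_bm B1 B2 (T (tt p) \<omega>) \<omega>)) ^ r)"
    by (intro all_moments_integrable all_moments_power all_moments_sum)
  have "expectation (\<lambda>\<omega>. (\<Sum>p\<in>S. conj_if (b p) (complex_bm B1 B2 (T (tt p) \<omega>) \<omega>)) ^ r)
      = expectation (\<lambda>\<omega>'. expectation (\<lambda>\<omega>. (\<Sum>p\<in>S. conj_if (b p) (complex_bm B1 B2 (T (tt p) \<omega>') \<omega>)) ^ r))"
    by (rule freezing(1)[OF fr m i])
  also have "\<dots> = expectation (\<lambda>\<omega>'. gauss_mom r (of_real (conj_cov S b (\<lambda>p. T (tt p) \<omega>'))))"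
    by (intro Bochner_Integration.integral_cong refl complex_bm_moment S T0 tt)
  finally show ?thesis .
qed

end

end

section \<open>Convergence of traces of words\<close>

text \<open>Both limits are instances: a deterministic count with \<open>\<alpha> = 1\<close>, and
  the fractional Poisson process. Asymptotically only product moments of minima of the clock
  \<open>K\<close> are prescribed; minima occur because the covariance of two walks is the number of
  their common steps.\<close>

locale walk_limit = bounded_array M X D + P: complex_brownian P B1 B2
  for M :: "'a measure" and X D and P :: "'b measure" and B1 B2 +
  fixes \<alpha> :: real and K :: "real \<Rightarrow> 'a \<Rightarrow> nat" and T :: "real \<Rightarrow> 'b \<Rightarrow> real"
  assumes \<alpha>: "0 \<le> \<alpha>"
    and K: "\<And>t. 0 \<le> t \<Longrightarrow> all_moments M (\<lambda>\<omega>. real (K t \<omega>))"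
    and K_measurable: "\<And>t. 0 \<le> t \<Longrightarrow> K t \<in> borel_measurable M"
    and K_indep: "independent_processes M (UNIV \<times> {1..}) (\<lambda>(i, k). X i k) {0..} K"
    and T: "\<And>t. 0 \<le> t \<Longrightarrow> all_moments P (T t)"
    and T_nonneg: "\<And>t \<omega>. 0 \<le> t \<Longrightarrow> \<omega> \<in> space P \<Longrightarrow> 0 \<le> T t \<omega>"
    and T_indep: "independent_processes P {0..} (complex_bm B1 B2) {0..} T"
    and lim: "\<And>h (s :: nat \<Rightarrow> real) t. (\<And>i. i < h \<Longrightarrow> 0 \<le> s i \<and> 0 \<le> t i) \<Longrightarrow>
      (\<lambda>n. expectation (\<lambda>\<omega>. \<Prod>i<h. min (real (K (real n * s i) \<omega>)) (real (K (real n * t i) \<omega>)) / real n powr \<alpha>))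
        \<longlonglongrightarrow> P.expectation (\<lambda>\<omega>. \<Prod>i<h. min (T (s i) \<omega>) (T (t i) \<omega>))"
begin

definition scaling :: "nat \<Rightarrow> real" where
  "scaling n = real n powr (- (1 + \<alpha>) / 2)"

lemma walk_moments: "0 \<le> t \<Longrightarrow> all_moments M (\<lambda>\<omega>. walk X (K (real n * t) \<omega>) \<omega> i)"
  by (rule walk_all_moments[OF K K_measurable K_indep]) auto

lemma random_matrix_walk:
  assumes "0 \<le> t"
  shows "random_matrix M n (\<lambda>\<omega>. scaling n \<cdot>\<^sub>m circulant_counting_walk X K n t \<omega>)"
  unfolding random_matrix_def
proof (intro conjI ballI allI impI)
  fix i j assume ij: "i < n" "j < n"
  have e: "(scaling n \<cdot>\<^sub>m circulant_counting_walk X K n t \<omega>) $$ (i, j)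
      = scaling n * walk X (K (real n * t) \<omega>) \<omega> (circulant_link n (Suc i) (Suc j))" for \<omega>
    using ij by (simp add: circulant_counting_walk_def circulant_def walk_def)
  have "all_moments M (\<lambda>\<omega>. scaling n * walk X (K (real n * t) \<omega>) \<omega> (circulant_link n (Suc i) (Suc j)))"
    by (intro all_moments_cmult walk_moments assms)
  then show "(\<lambda>\<omega>. (scaling n \<cdot>\<^sub>m circulant_counting_walk X K n t \<omega>) $$ (i, j)) \<in> borel_measurable M"
    "integrable M (\<lambda>\<omega>. \<bar>(scaling n \<cdot>\<^sub>m circulant_counting_walk X K n t \<omega>) $$ (i, j)\<bar> ^ p)" for p
    unfolding e all_moments_def by auto
qed (simp add: circulant_counting_walk_def circulant_def)

lemma prod_list_nth: "(\<Prod>v\<leftarrow>w. f v) = (\<Prod>i<length w. f (w ! i))"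
  for f :: "'c \<Rightarrow> 'd::comm_monoid_mult"
  by (simp add: prod.list_conv_set_nth atLeast0LessThan)

lemma word_limit:
  assumes ts: "\<And>v. v \<in> set w \<Longrightarrow> 0 \<le> ts (fst v)"
  shows "(\<lambda>n. (\<Sum>k<n. expectation (\<lambda>\<omega>. \<Prod>v\<leftarrow>w. of_real (scaling n) *
        circ_eig n (walk X (K (real n * ts (fst v)) \<omega>) \<omega>) k (snd v))) / of_nat n)
    \<longlonglongrightarrow> P.expectation (\<lambda>\<omega>. \<Prod>v\<leftarrow>w. conj_if (snd v) (complex_bm B1 B2 (T (ts (fst v)) \<omega>) \<omega>))"
proof -
  let ?r = "length w"
  \<comment> \<open>Polarisation runs over positions in the word and not over letters, since a
    letter may occur several times.\<close>
  let ?V = "{..<?r}"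
  define tt where "tt i = ts (fst (w ! i))" for i
  define b where "b i = snd (w ! i)" for i
  define \<sigma> :: "nat set \<Rightarrow> complex" where "\<sigma> S = (-1) ^ card (?V - S) / fact ?r" for S
  define y where "y n k i \<omega> = of_real (scaling n) * circ_eig n (walk X (K (real n * tt i) \<omega>) \<omega>) k (b i)" for n k i \<omega>
  define z where "z i \<omega> = conj_if (b i) (complex_bm B1 B2 (T (tt i) \<omega>) \<omega>)" for i \<omega>
  have tt: "0 \<le> tt i" if "i < ?r" for i using ts[of "w ! i"] that by (simp add: tt_def)
  have pol: "(\<Prod>i<?r. x i) = (\<Sum>S\<in>Pow ?V. \<sigma> S * (\<Sum>i\<in>S. x i) ^ ?r)" for x :: "nat \<Rightarrow> complex"
    using polarization[of ?V x] by (simp add: \<sigma>_def)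
  have ym: "all_moments M (y n k i)" if "i < ?r" for n k i
    unfolding y_def by (intro all_moments_cmult circ_eig_all_moments walk_moments tt that)
  have zm: "all_moments P (z i)" if "i < ?r" for i
    using P.time_changed_bm_all_moments[OF T T_nonneg T_indep tt[OF that]]
      measurable_compose[OF P.time_changed_bm_all_moments[OF T T_nonneg T_indep tt[OF that], THEN all_moments_measurable] borel_measurable_continuous_onI[OF continuous_on_cnj[OF continuous_on_id]]]
    unfolding all_moments_def z_def by (cases "b i") (simp_all add: conj_if_def)
  have L: "(\<lambda>n. (\<Sum>k<n. expectation (\<lambda>\<omega>. (\<Sum>i\<in>S. y n k i \<omega>) ^ ?r)) / of_nat n) \<longlonglongrightarrow> P.expectation (\<lambda>\<omega>. (\<Sum>i\<in>S. z i \<omega>) ^ ?r)"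
    if S: "S \<in> Pow ?V" for S
  proof -
    have fS: "finite S" and ttS: "\<And>i. i \<in> S \<Longrightarrow> 0 \<le> tt i" using S finite_subset tt by auto
    have "(\<lambda>n. (\<Sum>k<n. expectation (\<lambda>\<omega>. (\<Sum>i\<in>S. y n k i \<omega>) ^ ?r)) / of_nat n)
      \<longlonglongrightarrow> P.expectation (\<lambda>\<omega>. gauss_mom ?r (of_real (conj_cov S b (\<lambda>i. T (tt i) \<omega>))))"
      unfolding y_def scaling_def
      by (rule walk_power_limit[OF fS \<alpha> P.prob_space_axioms K K_measurable K_indep T lim ttS])
    also have "P.expectation (\<lambda>\<omega>. gauss_mom ?r (of_real (conj_cov S b (\<lambda>i. T (tt i) \<omega>)))) = P.expectation (\<lambda>\<omega>. (\<Sum>i\<in>S. z i \<omega>) ^ ?r)"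
      unfolding z_def by (rule P.time_changed_bm_moment[OF T T_nonneg T_indep fS ttS, symmetric])
    finally show ?thesis .
  qed
  have E1: "(\<Sum>k<n. expectation (\<lambda>\<omega>. \<Prod>i<?r. y n k i \<omega>)) / of_nat n
      = (\<Sum>S\<in>Pow ?V. \<sigma> S * ((\<Sum>k<n. expectation (\<lambda>\<omega>. (\<Sum>i\<in>S. y n k i \<omega>) ^ ?r)) / of_nat n))" for n
  proof -
    have "expectation (\<lambda>\<omega>. \<Prod>i<?r. y n k i \<omega>) = (\<Sum>S\<in>Pow ?V. \<sigma> S * expectation (\<lambda>\<omega>. (\<Sum>i\<in>S. y n k i \<omega>) ^ ?r))" for k
      unfolding pol by (subst Bochner_Integration.integral_sum)
        (auto intro!: all_moments_integrable all_moments_cmult all_moments_power all_moments_sum ym)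
    then have "(\<Sum>k<n. expectation (\<lambda>\<omega>. \<Prod>i<?r. y n k i \<omega>))
        = (\<Sum>S\<in>Pow ?V. \<sigma> S * (\<Sum>k<n. expectation (\<lambda>\<omega>. (\<Sum>i\<in>S. y n k i \<omega>) ^ ?r)))"
      by (simp only: sum_distrib_left sum.swap[of _ "{..<n}"])
    then show ?thesis by (simp only: sum_divide_distrib[where A = "Pow ?V"] times_divide_eq_right)
  qed
  have E2: "P.expectation (\<lambda>\<omega>. \<Prod>i<?r. z i \<omega>) = (\<Sum>S\<in>Pow ?V. \<sigma> S * P.expectation (\<lambda>\<omega>. (\<Sum>i\<in>S. z i \<omega>) ^ ?r))"
    unfolding pol by (subst Bochner_Integration.integral_sum)
      (auto intro!: all_moments_integrable P.all_moments_cmult P.all_moments_power P.all_moments_sum zm)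
  have "(\<lambda>n. (\<Sum>k<n. expectation (\<lambda>\<omega>. \<Prod>i<?r. y n k i \<omega>)) / of_nat n) \<longlonglongrightarrow> P.expectation (\<lambda>\<omega>. \<Prod>i<?r. z i \<omega>)"
    unfolding E1 E2 by (intro tendsto_sum tendsto_mult tendsto_const L)
  then show ?thesis unfolding prod_list_nth y_def z_def tt_def b_def .
qed

theorem converges_star_distribution_walk:
  "converges_star_distribution M (\<lambda>n t \<omega>. scaling n \<cdot>\<^sub>m circulant_counting_walk X K n t \<omega>)
     P (time_change (complex_bm B1 B2) T)"
  unfolding converges_star_distribution_def
proof (intro conjI allI impI)
  fix n t assume "0 \<le> (t::real)"
  then show "random_matrix M n (\<lambda>\<omega>. scaling n \<cdot>\<^sub>m circulant_counting_walk X K n t \<omega>)"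
    by (rule random_matrix_walk)
next
  fix t assume t: "0 \<le> (t::real)"
  have am: "all_moments P (time_change (complex_bm B1 B2) T t)"
    unfolding time_change_def[abs_def] by (rule P.time_changed_bm_all_moments[OF T T_nonneg T_indep t])
  show "time_change (complex_bm B1 B2) T t \<in> borel_measurable P" by (rule all_moments_measurable[OF am])
  show "integrable P (\<lambda>\<omega>. cmod (time_change (complex_bm B1 B2) T t \<omega>) ^ p)" for p
    by (rule all_moments_norm_power[OF am])
next
  fix q :: nat and ts :: "nat \<Rightarrow> real" and g
  assume q: "1 \<le> q" and ts: "\<forall>i<q. 0 \<le> ts i" and g: "nc_poly_in q g"
  have tsw: "0 \<le> ts (fst v)" if "w \<in> Poly_Mapping.keys g" "v \<in> set w" for w v
  proof -
    have "set w \<subseteq> {..<q} \<times> UNIV" using g that(1) by (simp add: nc_poly_in_def)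
    then have "fst v < q" using that(2) by auto
    then show ?thesis using ts by blast
  qed
  let ?F = "\<lambda>n k w \<omega>. \<Prod>v\<leftarrow>w. of_real (scaling n) * circ_eig n (walk X (K (real n * ts (fst v)) \<omega>) \<omega>) k (snd v)"
  let ?Z = "\<lambda>w \<omega>. \<Prod>v\<leftarrow>w. conj_if (snd v) (complex_bm B1 B2 (T (ts (fst v)) \<omega>) \<omega>)"
  have Fm: "all_moments M (?F n k w)" if "w \<in> Poly_Mapping.keys g" for n k w
    unfolding prod_list_nth
    by (intro all_moments_prod all_moments_cmult circ_eig_all_moments walk_moments tsw[OF that]) auto
  have Zm: "all_moments P (?Z w)" if "w \<in> Poly_Mapping.keys g" for w
    unfolding prod_list_nth
  proof (intro P.all_moments_prod)
    fix i assume "i \<in> {..<length w}"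
    then have t: "0 \<le> ts (fst (w ! i))" using tsw[OF that, of "w ! i"] by simp
    note am = P.time_changed_bm_all_moments[OF T T_nonneg T_indep t]
    show "all_moments P (\<lambda>\<omega>. conj_if (snd (w ! i)) (complex_bm B1 B2 (T (ts (fst (w ! i))) \<omega>) \<omega>))"
      using am measurable_compose[OF am[THEN all_moments_measurable] borel_measurable_continuous_onI[OF continuous_on_cnj[OF continuous_on_id]]]
      unfolding all_moments_def by (cases "snd (w ! i)") (simp_all add: conj_if_def)
  qed
  have EM: "expectation (\<lambda>\<omega>. mat_trace (nc_eval_mat n g (mat_letter (\<lambda>i. scaling n \<cdot>\<^sub>m circulant_counting_walk X K n (ts i) \<omega>)))) / of_nat n
      = (\<Sum>w\<in>Poly_Mapping.keys g. Poly_Mapping.lookup g w * ((\<Sum>k<n. expectation (?F n k w)) / of_nat n))" if n: "1 \<le> n" for n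
  proof -
    have "mat_trace (nc_eval_mat n g (mat_letter (\<lambda>i. scaling n \<cdot>\<^sub>m circulant_counting_walk X K n (ts i) \<omega>)))
       = (\<Sum>w\<in>Poly_Mapping.keys g. Poly_Mapping.lookup g w * (\<Sum>k<n. ?F n k w \<omega>))" for \<omega>
    proof -
      have "circulant_counting_walk X K n (ts i) \<omega> = circulant n (walk X (K (real n * ts i) \<omega>) \<omega>)" for i
        unfolding circulant_counting_walk_def walk_def[abs_def] ..
      then show ?thesis using trace_nc_eval_circulant[of n g "scaling n" "\<lambda>i. walk X (K (real n * ts i) \<omega>) \<omega>"] n by simp
    qed
    then have "expectation (\<lambda>\<omega>. mat_trace (nc_eval_mat n g (mat_letter (\<lambda>i. scaling n \<cdot>\<^sub>m circulant_counting_walk X K n (ts i) \<omega>))))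
       = expectation (\<lambda>\<omega>. \<Sum>w\<in>Poly_Mapping.keys g. Poly_Mapping.lookup g w * (\<Sum>k<n. ?F n k w \<omega>))" by presburger
    also have "\<dots> = (\<Sum>w\<in>Poly_Mapping.keys g. expectation (\<lambda>\<omega>. Poly_Mapping.lookup g w * (\<Sum>k<n. ?F n k w \<omega>)))"
      by (intro Bochner_Integration.integral_sum all_moments_integrable all_moments_cmult all_moments_sum Fm)
    also have "\<dots> = (\<Sum>w\<in>Poly_Mapping.keys g. Poly_Mapping.lookup g w * (\<Sum>k<n. expectation (?F n k w)))"
    proof (rule sum.cong[OF refl])
      fix w assume w: "w \<in> Poly_Mapping.keys g"
      have "expectation (\<lambda>\<omega>. \<Sum>k<n. ?F n k w \<omega>) = (\<Sum>k<n. expectation (?F n k w))"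
        by (intro Bochner_Integration.integral_sum all_moments_integrable Fm w)
      then show "expectation (\<lambda>\<omega>. Poly_Mapping.lookup g w * (\<Sum>k<n. ?F n k w \<omega>)) = Poly_Mapping.lookup g w * (\<Sum>k<n. expectation (?F n k w))"
        by simp
    qed
    finally show ?thesis by (simp only: sum_divide_distrib[where A = "Poly_Mapping.keys g"] times_divide_eq_right)
  qed
  have EP: "P.expectation (\<lambda>\<omega>. nc_eval_complex g (complex_letter (\<lambda>i. time_change (complex_bm B1 B2) T (ts i) \<omega>)))
      = (\<Sum>w\<in>Poly_Mapping.keys g. Poly_Mapping.lookup g w * P.expectation (?Z w))"
  proof -
    have "complex_letter (\<lambda>i. time_change (complex_bm B1 B2) T (ts i) \<omega>) = (\<lambda>v. conj_if (snd v) (complex_bm B1 B2 (T (ts (fst v)) \<omega>) \<omega>))" for \<omega>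
      by (rule ext) (simp add: complex_letter_def conj_if_def time_change_def case_prod_beta)
    then have "P.expectation (\<lambda>\<omega>. nc_eval_complex g (complex_letter (\<lambda>i. time_change (complex_bm B1 B2) T (ts i) \<omega>)))
      = P.expectation (\<lambda>\<omega>. \<Sum>w\<in>Poly_Mapping.keys g. Poly_Mapping.lookup g w * ?Z w \<omega>)"
      by (simp add: nc_eval_complex_def)
    also have "\<dots> = (\<Sum>w\<in>Poly_Mapping.keys g. P.expectation (\<lambda>\<omega>. Poly_Mapping.lookup g w * ?Z w \<omega>))"
      by (intro Bochner_Integration.integral_sum all_moments_integrable P.all_moments_cmult Zm)
    finally show ?thesis by simp
  qed
  have "(\<lambda>n. \<Sum>w\<in>Poly_Mapping.keys g. Poly_Mapping.lookup g w * ((\<Sum>k<n. expectation (?F n k w)) / of_nat n))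
      \<longlonglongrightarrow> (\<Sum>w\<in>Poly_Mapping.keys g. Poly_Mapping.lookup g w * P.expectation (?Z w))"
    by (intro tendsto_sum tendsto_mult tendsto_const word_limit tsw)
  then show "(\<lambda>n. expectation (\<lambda>\<omega>. mat_trace (nc_eval_mat n g (mat_letter (\<lambda>i. scaling n \<cdot>\<^sub>m circulant_counting_walk X K n (ts i) \<omega>)))) / of_nat n)
      \<longlonglongrightarrow> P.expectation (\<lambda>\<omega>. nc_eval_complex g (complex_letter (\<lambda>i. time_change (complex_bm B1 B2) T (ts i) \<omega>)))"
    unfolding EP by (rule Lim_transform_eventually) (use EM in \<open>auto intro!: eventually_sequentiallyI[of 1]\<close>)
qed

end

section \<open>Stable subordinators and their inverses\<close>

text \<open>\<open>exp (- f)\<close> lies almost surely in the unit interval, so all its moments are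
  at most one and the Taylor remainder of its characteristic function is bounded independently of
  the law. The Taylor coefficients are values of the Laplace transform of \<open>f\<close> at
  integers.\<close>

lemma char_exp_approx:
  fixes f :: "'a \<Rightarrow> real"
  assumes "prob_space M" and f: "f \<in> borel_measurable M" "AE \<omega> in M. 0 \<le> f \<omega>"
  shows "cmod (char (distr M borel (\<lambda>\<omega>. exp (- f \<omega>))) t
      - (\<Sum>k\<le>n. ((\<i> * t) ^ k / fact k) * of_real (\<integral>\<omega>. exp (- real k * f \<omega>) \<partial>M))) \<le> 2 * \<bar>t\<bar> ^ n / fact n"
proof -
  interpret prob_space M by fact
  let ?Y = "\<lambda>\<omega>. exp (- f \<omega>)"
  have Y: "?Y \<in> borel_measurable M" using f(1) by measurable
  interpret D: real_distribution "distr M borel ?Y" by (rule real_distribution_distr[OF Y])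
  have pw: "?Y \<omega> ^ k = exp (- real k * f \<omega>)" for k \<omega> by (simp add: exp_of_nat_mult[symmetric])
  have bd: "AE \<omega> in M. norm (?Y \<omega> ^ k) \<le> 1" for k
    using f(2) by eventually_elim (simp add: power_le_one)
  have int: "integrable M (\<lambda>\<omega>. ?Y \<omega> ^ k)" for k
    by (rule integrable_const_bound[OF bd borel_measurable_power[OF Y]])
  have intD: "integrable (distr M borel ?Y) (\<lambda>x. x ^ k)" for k
    using int[of k] Y by (subst integrable_distr_eq) auto
  have mom: "D.expectation (\<lambda>x. x ^ k) = (\<integral>\<omega>. exp (- real k * f \<omega>) \<partial>M)" for k
    unfolding pw[symmetric] using Y by (subst integral_distr) auto
  have "D.expectation (\<lambda>x. \<bar>x\<bar> ^ n) = expectation (\<lambda>\<omega>. ?Y \<omega> ^ n)"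
    using Y by (subst integral_distr) auto
  also have "\<dots> \<le> 1"
    by (rule integral_le_const[OF int]) (use bd[of n] in eventually_elim, simp)
  finally have "2 * \<bar>t\<bar> ^ n / fact n * D.expectation (\<lambda>x. \<bar>x\<bar> ^ n) \<le> 2 * \<bar>t\<bar> ^ n / fact n"
    by (intro mult_left_le) auto
  moreover have "cmod (char (distr M borel ?Y) t - (\<Sum>k\<le>n. ((\<i> * t) ^ k / fact k) * D.expectation (\<lambda>x. x ^ k)))
      \<le> (2 * \<bar>t\<bar> ^ n / fact n) * D.expectation (\<lambda>x. \<bar>x\<bar> ^ n)"
    by (rule D.char_approx1) (rule intD)
  ultimately show ?thesis unfolding mom by linarith
qed

text \<open>The Laplace transform at the integers gives the moments of \<open>exp (- f)\<close>,
  and a law on the unit interval is determined by its moments.\<close>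

lemma distr_eq_of_laplace:
  fixes f :: "'a \<Rightarrow> real" and g :: "'b \<Rightarrow> real"
  assumes M: "prob_space M" and P: "prob_space P"
    and f: "f \<in> borel_measurable M" "AE \<omega> in M. 0 \<le> f \<omega>"
    and g: "g \<in> borel_measurable P" "AE \<omega> in P. 0 \<le> g \<omega>"
    and eq: "\<And>k::nat. 0 < k \<Longrightarrow> (\<integral>\<omega>. exp (- real k * f \<omega>) \<partial>M) = (\<integral>\<omega>. exp (- real k * g \<omega>) \<partial>P)"
  shows "distr M borel f = distr P borel g"
proof -
  interpret M: prob_space M by fact
  interpret P: prob_space P by fact
  let ?\<mu> = "distr M borel (\<lambda>\<omega>. exp (- f \<omega>))" and ?\<nu> = "distr P borel (\<lambda>\<omega>. exp (- g \<omega>))"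
  have mf: "(\<lambda>\<omega>. exp (- f \<omega>)) \<in> borel_measurable M" using f by measurable
  have mg: "(\<lambda>\<omega>. exp (- g \<omega>)) \<in> borel_measurable P" using g by measurable
  have eq': "(\<integral>\<omega>. exp (- real k * f \<omega>) \<partial>M) = (\<integral>\<omega>. exp (- real k * g \<omega>) \<partial>P)" for k
    using eq[of k] by (cases "k = 0") (auto simp: M.prob_space P.prob_space)
  have "char ?\<mu> t = char ?\<nu> t" for t
  proof -
    \<comment> \<open>The Taylor polynomials coincide, so the difference is at most the sum of the
      two remainders.\<close>
    have le: "cmod (char ?\<mu> t - char ?\<nu> t) \<le> 4 * (inverse (fact n) * \<bar>t\<bar> ^ n)" for n
      using norm_triangle_le_diff[OF add_mono[OF char_exp_approx[OF M f, of t n] char_exp_approx[OF P g, of t n]]]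
      unfolding eq' by (simp add: field_simps)
    have "(\<lambda>n. 4 * (inverse (fact n) * \<bar>t\<bar> ^ n)) \<longlonglongrightarrow> 4 * 0"
      by (intro tendsto_mult tendsto_const summable_LIMSEQ_zero[OF summable_exp])
    then have "cmod (char ?\<mu> t - char ?\<nu> t) \<le> 4 * 0"
      by (rule LIMSEQ_le_const) (use le in blast)
    then show ?thesis by simp
  qed
  then have "?\<mu> = ?\<nu>"
    by (intro Levy_uniqueness M.real_distribution_distr P.real_distribution_distr mf mg ext)
  \<comment> \<open>Pushing forward by \<open>- ln\<close> undoes the passage to
    \<open>exp (- f)\<close> and \<open>exp (- g)\<close>.\<close>
  then have "distr ?\<mu> borel (\<lambda>y. - ln y) = distr ?\<nu> borel (\<lambda>y. - ln y)" by simp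
  then show ?thesis using mf mg by (simp add: distr_distr o_def)
qed

section \<open>Joint laws and self-similarity of stable subordinators\<close>

lemma levy_increment_distr:
  assumes "levy_process M Z" "0 \<le> s" "s \<le> t"
  shows "distr M borel (\<lambda>\<omega>. Z t \<omega> - Z s \<omega>) = distr M borel (Z (t - s))"
proof -
  have "\<forall>s\<ge>0. \<forall>t\<ge>0. distr M borel (\<lambda>\<omega>. Z (s + t) \<omega> - Z s \<omega>) = distr M borel (Z t)"
    using assms(1) unfolding levy_process_def by blast
  from this[rule_format, of s "t - s"] show ?thesis using assms by simp
qed

lemma levy_measurable: "levy_process M Z \<Longrightarrow> 0 \<le> t \<Longrightarrow> Z t \<in> borel_measurable M"
  by (simp add: levy_process_def)

lemma stable_increment_laplace:
  assumes H: "stable_subordinator M \<alpha> H" and st: "0 \<le> s" "s \<le> t" and u: "0 < u"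
  shows "(\<integral>\<omega>. exp (- u * (H t \<omega> - H s \<omega>)) \<partial>M) = exp (- (t - s) * u powr \<alpha>)"
proof -
  have lev: "levy_process M H" using H by (simp add: stable_subordinator_def)
  have m: "H t \<in> borel_measurable M" "H s \<in> borel_measurable M" "H (t - s) \<in> borel_measurable M"
    using levy_measurable[OF lev] st by auto
  have "(\<integral>\<omega>. exp (- u * (H t \<omega> - H s \<omega>)) \<partial>M) = (\<integral>x. exp (- u * x) \<partial>distr M borel (\<lambda>\<omega>. H t \<omega> - H s \<omega>))"
    using m by (subst integral_distr) auto
  also have "\<dots> = (\<integral>\<omega>. exp (- u * H (t - s) \<omega>) \<partial>M)"
    unfolding levy_increment_distr[OF lev st] using m by (subst integral_distr) auto
  also have "\<dots> = exp (- (t - s) * u powr \<alpha>)"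
  proof -
    have "\<forall>t\<ge>0. \<forall>u>0. (\<integral>\<omega>. exp (- u * H t \<omega>) \<partial>M) = exp (- t * u powr \<alpha>)"
      using H unfolding stable_subordinator_def by blast
    then show ?thesis using st u by (metis diff_ge_0_iff_ge)
  qed
  finally show ?thesis .
qed

text \<open>Self-similarity: dividing space by \<open>a\<close> replaces the Laplace argument
  \<open>k\<close> by \<open>k / a\<close>, whose power \<open>\<alpha>\<close> cancels the time
  factor \<open>a powr \<alpha>\<close>. The two processes may live on different spaces.\<close>

lemma stable_increment_distr:
  assumes M: "prob_space M" and P: "prob_space P"
    and H: "stable_subordinator M \<alpha> H" and G: "stable_subordinator P \<alpha> G"
    and a: "0 < a" and st: "0 \<le> s" "s \<le> t"
  shows "distr M borel (\<lambda>\<omega>. (H (a powr \<alpha> * t) \<omega> - H (a powr \<alpha> * s) \<omega>) / a) = distr P borel (\<lambda>\<omega>. G t \<omega> - G s \<omega>)"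
proof (rule distr_eq_of_laplace[OF M P])
  let ?c = "a powr \<alpha>"
  have st': "0 \<le> ?c * s" "?c * s \<le> ?c * t" using a st by (auto intro: mult_left_mono)
  have lev: "levy_process M H" "levy_process P G" using H G by (simp_all add: stable_subordinator_def)
  have mono: "mono_on {0..} (\<lambda>t. H t \<omega>)" if "\<omega> \<in> space M" for \<omega>
    using H that by (auto simp: stable_subordinator_def)
  have mono': "mono_on {0..} (\<lambda>t. G t \<omega>)" if "\<omega> \<in> space P" for \<omega>
    using G that by (auto simp: stable_subordinator_def)
  have tt: "0 \<le> ?c * t" "0 \<le> t" using st' st by auto
  have "H (?c * t) \<in> borel_measurable M" "H (?c * s) \<in> borel_measurable M"
    using levy_measurable[OF lev(1)] st' tt by auto
  then show "(\<lambda>\<omega>. (H (?c * t) \<omega> - H (?c * s) \<omega>) / a) \<in> borel_measurable M" by measurable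
  have "G t \<in> borel_measurable P" "G s \<in> borel_measurable P"
    using levy_measurable[OF lev(2)] st tt by auto
  then show "(\<lambda>\<omega>. G t \<omega> - G s \<omega>) \<in> borel_measurable P" by measurable
  show "AE \<omega> in M. 0 \<le> (H (?c * t) \<omega> - H (?c * s) \<omega>) / a"
    using a st' tt mono_onD[OF mono] by (intro AE_I2) auto
  show "AE \<omega> in P. 0 \<le> G t \<omega> - G s \<omega>"
    using st tt mono_onD[OF mono'] by (intro AE_I2) auto
  fix k :: nat assume k: "0 < k"
  have "(\<integral>\<omega>. exp (- real k * ((H (?c * t) \<omega> - H (?c * s) \<omega>) / a)) \<partial>M)
      = (\<integral>\<omega>. exp (- (real k / a) * (H (?c * t) \<omega> - H (?c * s) \<omega>)) \<partial>M)" by simp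
  also have "\<dots> = exp (- (?c * t - ?c * s) * (real k / a) powr \<alpha>)"
    by (rule stable_increment_laplace[OF H st']) (use k a in simp)
  also have "(real k / a) powr \<alpha> = real k powr \<alpha> / ?c" using a by (simp add: powr_divide)
  also have "- (?c * t - ?c * s) * (real k powr \<alpha> / ?c) = - (t - s) * real k powr \<alpha>"
    using a by (simp add: field_simps)
  also have "exp (- (t - s) * real k powr \<alpha>) = (\<integral>\<omega>. exp (- real k * (G t \<omega> - G s \<omega>)) \<partial>P)"
    by (rule stable_increment_laplace[OF G st, symmetric]) (use k in simp)
  finally show "(\<integral>\<omega>. exp (- real k * ((H (?c * t) \<omega> - H (?c * s) \<omega>) / a)) \<partial>M) = (\<integral>\<omega>. exp (- real k * (G t \<omega> - G s \<omega>)) \<partial>P)" .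
qed

text \<open>Independent increments turn a joint event of the path into an event under a product of
  increment laws. That product depends on the laws alone, so paths on different spaces become
  comparable; \<open>c\<close> and \<open>a\<close> let the rescaled and the plain process share one
  formula. The characterisation of independence by product measures asks for a non-empty index set,
  hence \<open>0 < n\<close>.\<close>

lemma levy_joint_event:
  assumes "prob_space M" and lev: "levy_process M H" and c: "0 < c" and a: "0 < (a::real)" and n: "0 < n"
    and ts0: "ts 0 = 0" and ts: "\<And>k. k < n \<Longrightarrow> ts k < ts (Suc k)" and I: "finite I" and j: "\<And>i. i \<in> I \<Longrightarrow> j i \<le> n"
  shows "measure M {\<omega> \<in> space M. \<forall>i\<in>I. H (c * ts (j i)) \<omega> < a * t i}
    = measure (PiM {..<n} (\<lambda>k. distr M borel (\<lambda>\<omega>. (H (c * ts (Suc k)) \<omega> - H (c * ts k) \<omega>) / a)))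
        {v \<in> space (PiM {..<n} (\<lambda>_. borel)). \<forall>i\<in>I. (\<Sum>k<j i. v k) < t i}"
proof -
  interpret prob_space M by fact
  define Y where "Y k \<omega> = (H (c * ts (Suc k)) \<omega> - H (c * ts k) \<omega>) / a" for k \<omega>
  let ?V = "\<lambda>\<omega>. \<lambda>k\<in>{..<n}. Y k \<omega>" and ?\<Pi> = "PiM {..<n} (\<lambda>_. borel :: real measure)"
  let ?S = "{v \<in> space ?\<Pi>. \<forall>i\<in>I. (\<Sum>k<j i. v k) < t i}"
  have tsn: "0 \<le> ts k" if "k \<le> n" for k
    using that
  proof (induction k)
    case (Suc k)
    then show ?case using ts[of k] by simp
  qed (simp add: ts0)
  have Hm: "H (c * ts k) \<in> borel_measurable M" if "k \<le> n" for k
    using levy_measurable[OF lev] tsn[OF that] c by simp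
  have Ym: "Y k \<in> borel_measurable M" if "k < n" for k
    using Hm[of k] Hm[of "Suc k"] that unfolding Y_def[abs_def] by simp
  have "indep_vars (\<lambda>_. borel) (\<lambda>k \<omega>. H (c * ts (Suc k)) \<omega> - H (c * ts k) \<omega>) {..<n}"
  proof -
    have "\<forall>n (ts :: nat \<Rightarrow> real). 0 \<le> ts 0 \<longrightarrow> (\<forall>k<n. ts k < ts (Suc k)) \<longrightarrow>
        indep_vars (\<lambda>_. borel) (\<lambda>k \<omega>. H (ts (Suc k)) \<omega> - H (ts k) \<omega>) {..<n}"
      using lev unfolding levy_process_def by blast
    from this[rule_format, of "\<lambda>k. c * ts k" n] show ?thesis using ts ts0 c by simp
  qed
  from indep_vars_compose2[OF this, of "\<lambda>_ x. x / a" "\<lambda>_. borel"]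
  have "indep_vars (\<lambda>_. borel) Y {..<n}" unfolding Y_def by simp
  moreover have ne: "{..<n} \<noteq> {}" using n by auto
  ultimately have law: "distr M ?\<Pi> ?V = PiM {..<n} (\<lambda>k. distr M borel (Y k))"
    using indep_vars_iff_distr_eq_PiM'[OF ne, where M' = "\<lambda>_. borel" and X = Y] Ym by simp
  have Vm: "?V \<in> measurable M ?\<Pi>" by (rule measurable_restrict) (use Ym in auto)
  have S: "?S \<in> sets ?\<Pi>"
  proof -
    have "(\<lambda>v. \<Sum>k<j i. v k) \<in> borel_measurable ?\<Pi>" if "i \<in> I" for i
      using j[OF that] by (intro borel_measurable_sum measurable_component_singleton) auto
    then have "{v \<in> space ?\<Pi>. (\<Sum>k<j i. v k) < t i} \<in> sets ?\<Pi>" if "i \<in> I" for i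
      using that by (intro borel_measurable_less) auto
    then show ?thesis using I by (intro sets.sets_Collect_finite_All) auto
  qed
  have "measure (PiM {..<n} (\<lambda>k. distr M borel (Y k))) ?S = measure M (?V -` ?S \<inter> space M)"
    unfolding law[symmetric] by (rule measure_distr[OF Vm S])
  also have "\<dots> = measure M {\<omega> \<in> space M. \<forall>i\<in>I. H (c * ts (j i)) \<omega> < a * t i}"
  \<comment> \<open>The increments sum to a difference from \<open>H 0\<close>, which is
    \<open>0\<close> only almost surely, so the two events agree up to a null set.\<close>
  proof (rule measure_eq_AE)
    have "AE \<omega> in M. H 0 \<omega> = 0" using lev by (simp add: levy_process_def)
    then show "AE \<omega> in M. (\<omega> \<in> ?V -` ?S \<inter> space M) \<longleftrightarrow> (\<omega> \<in> {\<omega> \<in> space M. \<forall>i\<in>I. H (c * ts (j i)) \<omega> < a * t i})"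
      using AE_space
    proof eventually_elim
      fix \<omega> assume H0: "H 0 \<omega> = 0" and \<omega>: "\<omega> \<in> space M"
      have "(\<Sum>k<j i. ?V \<omega> k) < t i \<longleftrightarrow> H (c * ts (j i)) \<omega> < a * t i" if "i \<in> I" for i
      proof -
        have "(\<Sum>k<j i. ?V \<omega> k) = (\<Sum>k<j i. H (c * ts (Suc k)) \<omega> - H (c * ts k) \<omega>) / a"
          using j[OF that] unfolding Y_def sum_divide_distrib by (intro sum.cong) auto
        also have "\<dots> = H (c * ts (j i)) \<omega> / a"
          using sum_lessThan_telescope[of "\<lambda>k. H (c * ts k) \<omega>" "j i"] by (simp add: ts0 H0)
        finally show ?thesis using a by (simp add: pos_divide_less_eq mult.commute)
      qed
      moreover have "?V \<omega> \<in> space ?\<Pi>" using measurable_space[OF Vm \<omega>] .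
      ultimately show "(\<omega> \<in> ?V -` ?S \<inter> space M) \<longleftrightarrow> (\<omega> \<in> {\<omega> \<in> space M. \<forall>i\<in>I. H (c * ts (j i)) \<omega> < a * t i})"
        using \<omega> by auto
    qed
    show "?V -` ?S \<inter> space M \<in> sets M" by (rule measurable_sets[OF Vm S])
    show "{\<omega> \<in> space M. \<forall>i\<in>I. H (c * ts (j i)) \<omega> < a * t i} \<in> sets M"
      using I j Hm by (intro sets.sets_Collect_finite_All borel_measurable_less) auto
  qed
  finally show ?thesis unfolding Y_def ..
qed

lemma stable_joint_scaling:
  assumes M: "prob_space M" and P: "prob_space P"
    and H: "stable_subordinator M \<alpha> H" and G: "stable_subordinator P \<alpha> G"
    and a: "0 < a" and I: "finite I" and x: "\<And>i. i \<in> I \<Longrightarrow> 0 \<le> x i"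
  shows "measure M {\<omega> \<in> space M. \<forall>i\<in>I. H (a powr \<alpha> * x i) \<omega> < a * t i}
    = measure P {\<omega> \<in> space P. \<forall>i\<in>I. G (x i) \<omega> < t i}"
proof -
  \<comment> \<open>\<open>0\<close> starts the telescoping sums; \<open>1\<close> is adjoined so
    that at least one increment exists even if all \<open>x i\<close> are zero.\<close>
  have fin: "finite (insert 1 (insert 0 (x ` I)))" using I by simp
  have nn: "\<And>u. u \<in> insert 1 (insert 0 (x ` I)) \<Longrightarrow> 0 \<le> u" using x by auto
  have z: "0 \<in> insert 1 (insert 0 (x ` I))" by simp
  obtain ts :: "nat \<Rightarrow> real" and n where ts0: "ts 0 = 0" and ts: "\<And>k. k < n \<Longrightarrow> ts k < ts (Suc k)"
    and U: "insert 1 (insert 0 (x ` I)) = ts ` {..n}"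
    by (rule finite_times_enumeration[OF fin nn z]) (assumption, rule that, assumption+)
  have n: "0 < n"
  proof -
    have "1 \<in> ts ` {..n}" unfolding U[symmetric] by simp
    then obtain k where "k \<le> n" "ts k = 1" by auto
    with ts0 show ?thesis by (cases n) auto
  qed
  have "\<exists>j. j \<le> n \<and> x i = ts j" if "i \<in> I" for i
  proof -
    have "x i \<in> ts ` {..n}" unfolding U[symmetric] using that by blast
    then show ?thesis by auto
  qed
  then obtain j where j: "\<And>i. i \<in> I \<Longrightarrow> j i \<le> n" "\<And>i. i \<in> I \<Longrightarrow> x i = ts (j i)" by metis
  have tsn: "0 \<le> ts k" if "k \<le> n" for k
  proof -
    have "ts k \<in> insert 1 (insert 0 (x ` I))" unfolding U using that by blast
    then show ?thesis by (rule nn)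
  qed
  have lev: "levy_process M H" "levy_process P G" using H G by (simp_all add: stable_subordinator_def)
  have c: "0 < a powr \<alpha>" using a by simp
  have "{\<omega> \<in> space M. \<forall>i\<in>I. H (a powr \<alpha> * x i) \<omega> < a * t i} = {\<omega> \<in> space M. \<forall>i\<in>I. H (a powr \<alpha> * ts (j i)) \<omega> < a * t i}"
    using j(2) by auto
  also have "measure M \<dots> = measure (PiM {..<n} (\<lambda>k. distr M borel (\<lambda>\<omega>. (H (a powr \<alpha> * ts (Suc k)) \<omega> - H (a powr \<alpha> * ts k) \<omega>) / a)))
        {v \<in> space (PiM {..<n} (\<lambda>_. borel)). \<forall>i\<in>I. (\<Sum>k<j i. v k) < t i}"
    by (rule levy_joint_event[OF M lev(1) c a n ts0 ts I j(1)])
  also have "PiM {..<n} (\<lambda>k. distr M borel (\<lambda>\<omega>. (H (a powr \<alpha> * ts (Suc k)) \<omega> - H (a powr \<alpha> * ts k) \<omega>) / a))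
      = PiM {..<n} (\<lambda>k. distr P borel (\<lambda>\<omega>. (G (1 * ts (Suc k)) \<omega> - G (1 * ts k) \<omega>) / 1))"
  proof (rule PiM_cong[OF refl])
    fix k assume "k \<in> {..<n}"
    then have "0 \<le> ts k" "ts k \<le> ts (Suc k)" using tsn[of k] ts[of k] by auto
    from stable_increment_distr[OF M P H G a this]
    show "distr M borel (\<lambda>\<omega>. (H (a powr \<alpha> * ts (Suc k)) \<omega> - H (a powr \<alpha> * ts k) \<omega>) / a)
      = distr P borel (\<lambda>\<omega>. (G (1 * ts (Suc k)) \<omega> - G (1 * ts k) \<omega>) / 1)" by simp
  qed
  also have "measure \<dots> {v \<in> space (PiM {..<n} (\<lambda>_. borel)). \<forall>i\<in>I. (\<Sum>k<j i. v k) < t i}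
      = measure P {\<omega> \<in> space P. \<forall>i\<in>I. G (1 * ts (j i)) \<omega> < 1 * t i}"
    by (rule levy_joint_event[OF P lev(2) _ _ n ts0 ts I j(1), symmetric]) auto
  also have "{\<omega> \<in> space P. \<forall>i\<in>I. G (1 * ts (j i)) \<omega> < 1 * t i} = {\<omega> \<in> space P. \<forall>i\<in>I. G (x i) \<omega> < t i}"
    using j(2) by auto
  finally show ?thesis .
qed

text \<open>Layer cake: one factor at a time is written as an integral over its level \<open>x\<close>,
  and the event \<open>x < f h \<omega>\<close> is absorbed into the set \<open>A\<close>.\<close>

lemma nn_integral_prod_eq_of_joint_tails:
  fixes f :: "nat \<Rightarrow> 'a \<Rightarrow> real" and g :: "nat \<Rightarrow> 'b \<Rightarrow> real"
  assumes M: "prob_space M" and P: "prob_space P"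
    and f: "\<And>i. i < h \<Longrightarrow> f i \<in> borel_measurable M" "\<And>i \<omega>. i < h \<Longrightarrow> \<omega> \<in> space M \<Longrightarrow> 0 \<le> f i \<omega>"
    and g: "\<And>i. i < h \<Longrightarrow> g i \<in> borel_measurable P" "\<And>i \<omega>. i < h \<Longrightarrow> \<omega> \<in> space P \<Longrightarrow> 0 \<le> g i \<omega>"
    and A: "A \<in> sets M" and B: "B \<in> sets P"
    and eq: "\<And>x. (\<And>i. i < h \<Longrightarrow> 0 \<le> x i) \<Longrightarrow>
      emeasure M {\<omega> \<in> A. \<forall>i<h. x i < f i \<omega>} = emeasure P {\<omega> \<in> B. \<forall>i<h. x i < g i \<omega>}"
  shows "(\<integral>\<^sup>+\<omega>. indicator A \<omega> * (\<Prod>i<h. ennreal (f i \<omega>)) \<partial>M) = (\<integral>\<^sup>+\<omega>. indicator B \<omega> * (\<Prod>i<h. ennreal (g i \<omega>)) \<partial>P)"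
  using f g A B eq
proof (induction h arbitrary: A B)
  case 0
  then show ?case using 0(7)[of "\<lambda>_. 0"] by simp
next
  case (Suc h)
  interpret M: prob_space M by fact
  interpret P: prob_space P by fact
  have layer: "(\<integral>\<^sup>+\<omega>. indicator C \<omega> * (\<Prod>i<Suc h. ennreal (u i \<omega>)) \<partial>N)
      = (\<integral>\<^sup>+x. indicator {0<..} x * (\<integral>\<^sup>+\<omega>. indicator {\<omega> \<in> C. x < u h \<omega>} \<omega> * (\<Prod>i<h. ennreal (u i \<omega>)) \<partial>N) \<partial>lborel)"
    if N: "prob_space N" and u: "\<And>i. i < Suc h \<Longrightarrow> u i \<in> borel_measurable N"
      "\<And>\<omega>. \<omega> \<in> space N \<Longrightarrow> 0 \<le> u h \<omega>" and C: "C \<in> sets N" for u :: "nat \<Rightarrow> 'c \<Rightarrow> real" and N C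
  proof -
    interpret N: prob_space N by fact
    interpret pair_sigma_finite N lborel ..
    have um: "u h \<in> borel_measurable N" using u(1)[of h] by simp
    have pm: "(\<lambda>\<omega>. \<Prod>i<h. ennreal (u i \<omega>)) \<in> borel_measurable N"
    proof (rule borel_measurable_prod_ennreal)
      fix i assume "i \<in> {..<h}"
      then have "u i \<in> borel_measurable N" using u(1)[of i] by simp
      then show "(\<lambda>\<omega>. ennreal (u i \<omega>)) \<in> borel_measurable N" by measurable
    qed
    have Cm: "(indicator C :: 'c \<Rightarrow> ennreal) \<in> borel_measurable N" using C by measurable
    have "(\<integral>\<^sup>+\<omega>. indicator C \<omega> * (\<Prod>i<Suc h. ennreal (u i \<omega>)) \<partial>N)
      = (\<integral>\<^sup>+\<omega>. (\<integral>\<^sup>+x. (indicator C \<omega> * (\<Prod>i<h. ennreal (u i \<omega>))) * indicator {0<..<u h \<omega>} x \<partial>lborel) \<partial>N)"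
    proof (rule nn_integral_cong)
      fix \<omega> assume "\<omega> \<in> space N"
      then have "0 \<le> u h \<omega>" by (rule u(2))
      then show "indicator C \<omega> * (\<Prod>i<Suc h. ennreal (u i \<omega>))
        = (\<integral>\<^sup>+x. (indicator C \<omega> * (\<Prod>i<h. ennreal (u i \<omega>))) * indicator {0<..<u h \<omega>} x \<partial>lborel)"
        by (subst nn_integral_cmult) (simp_all add: mult.assoc)
    qed
    also have "\<dots> = (\<integral>\<^sup>+x. (\<integral>\<^sup>+\<omega>. (indicator C \<omega> * (\<Prod>i<h. ennreal (u i \<omega>))) * indicator {0<..<u h \<omega>} x \<partial>N) \<partial>lborel)"
    proof (rule Fubini'[symmetric])
      have "(\<lambda>z. indicator {0<..<u h (fst z)} (snd z) :: ennreal) = (\<lambda>z. if 0 < snd z \<and> snd z < u h (fst z) then 1 else 0)"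
        by (auto simp: indicator_def fun_eq_iff)
      also have "\<dots> \<in> borel_measurable (N \<Otimes>\<^sub>M lborel)"
        using um by measurable
      finally have i: "(\<lambda>z. indicator {0<..<u h (fst z)} (snd z) :: ennreal) \<in> borel_measurable (N \<Otimes>\<^sub>M lborel)" .
      show "(\<lambda>(\<omega>, x). (indicator C \<omega> * (\<Prod>i<h. ennreal (u i \<omega>))) * indicator {0<..<u h \<omega>} x) \<in> borel_measurable (N \<Otimes>\<^sub>M lborel)"
        unfolding case_prod_beta'
        by (intro borel_measurable_times_ennreal i measurable_compose[OF measurable_fst Cm] measurable_compose[OF measurable_fst pm])
    qed
    also have "\<dots> = (\<integral>\<^sup>+x. indicator {0<..} x * (\<integral>\<^sup>+\<omega>. indicator {\<omega> \<in> C. x < u h \<omega>} \<omega> * (\<Prod>i<h. ennreal (u i \<omega>)) \<partial>N) \<partial>lborel)"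
    proof (rule nn_integral_cong)
      fix x :: real
      have set: "{\<omega> \<in> C. x < u h \<omega>} \<in> sets N"
      proof -
        have "{\<omega> \<in> C. x < u h \<omega>} = C \<inter> {\<omega> \<in> space N. x < u h \<omega>}" using sets.sets_into_space[OF C] by auto
        also have "\<dots> \<in> sets N" using C um by (intro sets.Int borel_measurable_less) auto
        finally show ?thesis .
      qed
      have "(\<integral>\<^sup>+\<omega>. (indicator C \<omega> * (\<Prod>i<h. ennreal (u i \<omega>))) * indicator {0<..<u h \<omega>} x \<partial>N)
        = (\<integral>\<^sup>+\<omega>. indicator {0<..} x * (indicator {\<omega> \<in> C. x < u h \<omega>} \<omega> * (\<Prod>i<h. ennreal (u i \<omega>))) \<partial>N)"
        by (intro nn_integral_cong) (auto simp: indicator_def)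
      also have "\<dots> = indicator {0<..} x * (\<integral>\<^sup>+\<omega>. indicator {\<omega> \<in> C. x < u h \<omega>} \<omega> * (\<Prod>i<h. ennreal (u i \<omega>)) \<partial>N)"
        using set pm by (intro nn_integral_cmult borel_measurable_times_ennreal) auto
      finally show "(\<integral>\<^sup>+\<omega>. (indicator C \<omega> * (\<Prod>i<h. ennreal (u i \<omega>))) * indicator {0<..<u h \<omega>} x \<partial>N)
        = indicator {0<..} x * (\<integral>\<^sup>+\<omega>. indicator {\<omega> \<in> C. x < u h \<omega>} \<omega> * (\<Prod>i<h. ennreal (u i \<omega>)) \<partial>N)" .
    qed
    finally show ?thesis .
  qed
  have fm: "f i \<in> borel_measurable M" if "i < Suc h" for i using Suc.prems(1) that by blast
  have gm: "g i \<in> borel_measurable P" if "i < Suc h" for i using Suc.prems(3) that by blast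
  have "(\<integral>\<^sup>+\<omega>. indicator A \<omega> * (\<Prod>i<Suc h. ennreal (f i \<omega>)) \<partial>M)
      = (\<integral>\<^sup>+x. indicator {0<..} x * (\<integral>\<^sup>+\<omega>. indicator {\<omega> \<in> A. x < f h \<omega>} \<omega> * (\<Prod>i<h. ennreal (f i \<omega>)) \<partial>M) \<partial>lborel)"
    by (rule layer[OF M fm Suc.prems(2) Suc.prems(5)]) auto
  also have "\<dots> = (\<integral>\<^sup>+x. indicator {0<..} x * (\<integral>\<^sup>+\<omega>. indicator {\<omega> \<in> B. x < g h \<omega>} \<omega> * (\<Prod>i<h. ennreal (g i \<omega>)) \<partial>P) \<partial>lborel)"
  proof (rule nn_integral_cong)
    fix x :: real
    show "indicator {0<..} x * (\<integral>\<^sup>+\<omega>. indicator {\<omega> \<in> A. x < f h \<omega>} \<omega> * (\<Prod>i<h. ennreal (f i \<omega>)) \<partial>M)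
      = indicator {0<..} x * (\<integral>\<^sup>+\<omega>. indicator {\<omega> \<in> B. x < g h \<omega>} \<omega> * (\<Prod>i<h. ennreal (g i \<omega>)) \<partial>P)"
    \<comment> \<open>The indicator restricts to positive levels; the tail hypothesis covers
      nonnegative ones only.\<close>
    proof (cases "0 < x")
      case True
      have setA: "{\<omega> \<in> A. x < f h \<omega>} \<in> sets M"
      proof -
        have "{\<omega> \<in> A. x < f h \<omega>} = A \<inter> {\<omega> \<in> space M. x < f h \<omega>}" using sets.sets_into_space[OF Suc.prems(5)] by auto
        also have "\<dots> \<in> sets M" using Suc.prems(5) fm[of h] by (intro sets.Int borel_measurable_less) auto
        finally show ?thesis .
      qed
      have setB: "{\<omega> \<in> B. x < g h \<omega>} \<in> sets P"
      proof -
        have "{\<omega> \<in> B. x < g h \<omega>} = B \<inter> {\<omega> \<in> space P. x < g h \<omega>}" using sets.sets_into_space[OF Suc.prems(6)] by auto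
        also have "\<dots> \<in> sets P" using Suc.prems(6) gm[of h] by (intro sets.Int borel_measurable_less) auto
        finally show ?thesis .
      qed
      \<comment> \<open>The fixed level \<open>x\<close> becomes the last entry of the level vector,
        which makes the truncated events an instance of the hypothesis.\<close>
      have tails: "emeasure M {\<omega> \<in> {\<omega> \<in> A. x < f h \<omega>}. \<forall>i<h. y i < f i \<omega>} = emeasure P {\<omega> \<in> {\<omega> \<in> B. x < g h \<omega>}. \<forall>i<h. y i < g i \<omega>}"
        if y: "\<And>i. i < h \<Longrightarrow> 0 \<le> y i" for y
      proof -
        have "{\<omega> \<in> {\<omega> \<in> A. x < f h \<omega>}. \<forall>i<h. y i < f i \<omega>} = {\<omega> \<in> A. \<forall>i<Suc h. (y(h := x)) i < f i \<omega>}"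
          by (auto simp: less_Suc_eq)
        moreover have "{\<omega> \<in> {\<omega> \<in> B. x < g h \<omega>}. \<forall>i<h. y i < g i \<omega>} = {\<omega> \<in> B. \<forall>i<Suc h. (y(h := x)) i < g i \<omega>}"
          by (auto simp: less_Suc_eq)
        moreover have "0 \<le> (y(h := x)) i" if "i < Suc h" for i
          using y True that by (auto simp: less_Suc_eq)
        ultimately show ?thesis
          using Suc.prems(7)[of "y(h := x)"] by (simp only:)
      qed
      have "(\<integral>\<^sup>+\<omega>. indicator {\<omega> \<in> A. x < f h \<omega>} \<omega> * (\<Prod>i<h. ennreal (f i \<omega>)) \<partial>M)
          = (\<integral>\<^sup>+\<omega>. indicator {\<omega> \<in> B. x < g h \<omega>} \<omega> * (\<Prod>i<h. ennreal (g i \<omega>)) \<partial>P)"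
        by (rule Suc.IH[OF Suc.prems(1-4) setA setB tails]) auto
      then show ?thesis by simp
    qed simp
  qed
  also have "\<dots> = (\<integral>\<^sup>+\<omega>. indicator B \<omega> * (\<Prod>i<Suc h. ennreal (g i \<omega>)) \<partial>P)"
    by (rule layer[OF P gm Suc.prems(4) Suc.prems(6), symmetric]) auto
  finally show ?case .
qed

section \<open>First passage times\<close>

lemma inverse_stable_nonneg:
  assumes "0 \<le> t"
  shows "0 \<le> inverse_stable \<alpha> H t \<omega>"
proof -
  have "0 \<le> Inf {s. 0 \<le> s \<and> t \<le> H s \<omega>}" if "\<exists>s\<ge>0. t \<le> H s \<omega>"
    using that by (intro cInf_greatest) auto
  then show ?thesis using assms by (auto simp: inverse_stable_def)
qed

text \<open>The first passage time and the subordinator are inverse to each other: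
  right continuity makes the infimum attained.\<close>

lemma inverse_stable_gt_iff:
  assumes \<alpha>: "\<alpha> \<noteq> 1" and mono: "mono_on {0..} (\<lambda>t. H t \<omega>)"
    and rc: "\<And>u. 0 \<le> u \<Longrightarrow> continuous (at_right u) (\<lambda>s. H s \<omega>)"
    and ex: "\<exists>s\<ge>0. t \<le> H s \<omega>" and x: "0 \<le> x"
  shows "x < inverse_stable \<alpha> H t \<omega> \<longleftrightarrow> H x \<omega> < t"
proof -
  let ?A = "{s. 0 \<le> s \<and> t \<le> H s \<omega>}"
  have L: "inverse_stable \<alpha> H t \<omega> = Inf ?A" using \<alpha> ex by (simp add: inverse_stable_def)
  have bdd: "bdd_below ?A" by (rule bdd_belowI[of _ 0]) auto
  show ?thesis
  proof
    assume "x < inverse_stable \<alpha> H t \<omega>"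
    then have "x \<notin> ?A" using cInf_lower[OF _ bdd, of x] unfolding L by auto
    then show "H x \<omega> < t" using x by auto
  next
    assume lt: "H x \<omega> < t"
    have "((\<lambda>s. H s \<omega>) \<longlongrightarrow> H x \<omega>) (at_right x)" using rc[OF x] by (simp add: continuous_within)
    then have "eventually (\<lambda>s. H s \<omega> < t) (at_right x)" by (rule order_tendstoD(2)[OF _ lt])
    then obtain b where b: "b > x" "\<And>s. s > x \<Longrightarrow> s < b \<Longrightarrow> H s \<omega> < t"
      unfolding eventually_at_right_field by blast
    \<comment> \<open>At this \<open>y > x\<close> the level is still not reached; by monotonicity
      it is not reached before \<open>y\<close> either, so the infimum is at least \<open>y\<close>
      and strictly exceeds \<open>x\<close>.\<close>
    define y where "y = (x + b) / 2"
    have y: "x < y" "H y \<omega> < t" "0 \<le> y" using b x by (auto simp: y_def)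
    have "y \<le> s" if "s \<in> ?A" for s
    proof (rule ccontr)
      assume "\<not> y \<le> s"
      then have "H s \<omega> \<le> H y \<omega>" using that y by (intro mono_onD[OF mono]) auto
      then show False using that y by auto
    qed
    then have "y \<le> Inf ?A" using ex by (intro cInf_greatest) auto
    then show "x < inverse_stable \<alpha> H t \<omega>" unfolding L using y by simp
  qed
qed

lemma inverse_stable_mono:
  assumes ex: "\<exists>s\<ge>0. t \<le> H s \<omega>" and st: "s \<le> t"
  shows "inverse_stable \<alpha> H s \<omega> \<le> inverse_stable \<alpha> H t \<omega>"
proof (cases "\<alpha> = 1")
  case False
  have ex': "\<exists>r\<ge>0. s \<le> H r \<omega>" using ex st by force
  have "Inf {r. 0 \<le> r \<and> s \<le> H r \<omega>} \<le> Inf {r. 0 \<le> r \<and> t \<le> H r \<omega>}"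
    using ex st by (intro cInf_superset_mono bdd_belowI[of _ 0]) auto
  then show ?thesis using False ex ex' by (simp add: inverse_stable_def)
qed (use st in \<open>simp add: inverse_stable_def\<close>)

locale stable_process = prob_space M for M :: "'a measure" +
  fixes \<alpha> :: real and H :: "real \<Rightarrow> 'a \<Rightarrow> real"
  assumes \<alpha>0: "0 < \<alpha>" and \<alpha>1: "\<alpha> \<le> 1" and H: "\<alpha> < 1 \<Longrightarrow> stable_subordinator M \<alpha> H"
begin

abbreviation L :: "real \<Rightarrow> 'a \<Rightarrow> real" where "L \<equiv> inverse_stable \<alpha> H"

lemma H_measurable: "\<alpha> < 1 \<Longrightarrow> 0 \<le> t \<Longrightarrow> H t \<in> borel_measurable M"
  using H levy_measurable by (auto simp: stable_subordinator_def)

lemma H_right_continuous: "\<alpha> < 1 \<Longrightarrow> \<omega> \<in> space M \<Longrightarrow> 0 \<le> u \<Longrightarrow> continuous (at_right u) (\<lambda>s. H s \<omega>)"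
  using H by (auto simp: stable_subordinator_def levy_process_def)

lemma H_mono: "\<alpha> < 1 \<Longrightarrow> \<omega> \<in> space M \<Longrightarrow> mono_on {0..} (\<lambda>t. H t \<omega>)"
  using H by (auto simp: stable_subordinator_def)

text \<open>Chernoff bound with Laplace parameter \<open>1\<close>, for which
  \<open>u powr \<alpha>\<close> does not depend on \<open>\<alpha>\<close>. It yields both that the
  subordinator is unbounded and that its inverse has exponential tails.\<close>

lemma H_tail:
  assumes \<alpha>: "\<alpha> < 1" and x: "0 \<le> x"
  shows "emeasure M {\<omega> \<in> space M. H x \<omega> < t} \<le> ennreal (exp (t - x))"
proof -
  have m: "H x \<in> borel_measurable M" by (rule H_measurable[OF \<alpha> x])
  have lap: "expectation (\<lambda>\<omega>. exp (- 1 * H x \<omega>)) = exp (- x * 1 powr \<alpha>)"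
  proof -
    have "expectation (\<lambda>\<omega>. exp (- u * H t \<omega>)) = exp (- t * u powr \<alpha>)" if "0 \<le> t" "0 < u" for t u
      using H[OF \<alpha>] that unfolding stable_subordinator_def by blast
    from this[of x 1] x show ?thesis by simp
  qed
  \<comment> \<open>A non-integrable function would have expectation \<open>0\<close>, but the
    Laplace transform is positive.\<close>
  then have int: "integrable M (\<lambda>\<omega>. exp (- H x \<omega>))"
    using not_integrable_integral_eq[of M "\<lambda>\<omega>. exp (- H x \<omega>)"] by fastforce
  have "emeasure M {\<omega> \<in> space M. H x \<omega> < t} = (\<integral>\<^sup>+\<omega>. indicator {\<omega> \<in> space M. H x \<omega> < t} \<omega> \<partial>M)"
    using m by (intro nn_integral_indicator[symmetric] borel_measurable_less) auto
  also have "\<dots> \<le> (\<integral>\<^sup>+\<omega>. ennreal (exp t * exp (- H x \<omega>)) \<partial>M)"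
    by (intro nn_integral_mono) (auto simp: indicator_def exp_add[symmetric] ennreal_1[symmetric] simp del: ennreal_1 intro!: ennreal_leI)
  also have "\<dots> = ennreal (expectation (\<lambda>\<omega>. exp t * exp (- H x \<omega>)))"
    using int by (intro nn_integral_eq_integral) auto
  also have "expectation (\<lambda>\<omega>. exp t * exp (- H x \<omega>)) = exp (t - x)"
    using lap unfolding integral_mult_right_zero by (simp add: exp_add[symmetric])
  finally show ?thesis .
qed

text \<open>The event \<open>H k < m\<close> has probability at most \<open>exp (m - k)\<close>, and
  countably many integer levels \<open>m\<close> are enough. Off this null set the default branch of
  \<open>inverse_stable\<close> is never taken.\<close>

lemma AE_H_unbounded:
  assumes \<alpha>: "\<alpha> < 1"
  shows "AE \<omega> in M. \<forall>t. \<exists>s\<ge>0. t \<le> H s \<omega>"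
proof -
  have "AE \<omega> in M. \<exists>k::nat. real m \<le> H (real k) \<omega>" for m :: nat
  proof -
    let ?N = "{\<omega> \<in> space M. \<forall>k::nat. H (real k) \<omega> < real m}"
    have N: "?N \<in> sets M"
      by (intro sets.sets_Collect_countable_All borel_measurable_less H_measurable \<alpha>) auto
    have "emeasure M ?N \<le> ennreal (exp (real m - real k))" for k :: nat
    proof -
      have "emeasure M ?N \<le> emeasure M {\<omega> \<in> space M. H (real k) \<omega> < real m}"
        by (intro emeasure_mono borel_measurable_less H_measurable \<alpha>) auto
      also have "\<dots> \<le> ennreal (exp (real m - real k))" by (rule H_tail[OF \<alpha>]) simp
      finally show ?thesis .
    qed
    then have le: "measure M ?N \<le> exp (real m - real k)" for k :: nat
      using emeasure_eq_measure by (simp add: ennreal_le_iff)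
    have "(\<lambda>k. exp (real m - real k)) \<longlonglongrightarrow> 0"
      by (intro filterlim_compose[OF exp_at_bot] filterlim_compose[OF filterlim_uminus_at_bot_at_top]) real_asymp
    then have "measure M ?N \<le> 0" by (rule LIMSEQ_le_const) (use le in blast)
    then have "measure M ?N = 0" using measure_nonneg[of M ?N] by linarith
    then have "?N \<in> null_sets M" using N emeasure_eq_measure by (auto intro!: null_setsI)
    then show ?thesis by (rule AE_I') (auto simp: not_le)
  qed
  then have "AE \<omega> in M. \<forall>m::nat. \<exists>k::nat. real m \<le> H (real k) \<omega>" by (subst AE_all_countable) blast
  then show ?thesis
  proof eventually_elim
    fix \<omega> assume *: "\<forall>m::nat. \<exists>k::nat. real m \<le> H (real k) \<omega>"
    show "\<forall>t. \<exists>s\<ge>0. t \<le> H s \<omega>"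
    proof
      fix t
      obtain m :: nat where "t \<le> real m" using real_arch_simple by blast
      moreover obtain k :: nat where "real m \<le> H (real k) \<omega>" using * by blast
      ultimately show "\<exists>s\<ge>0. t \<le> H s \<omega>" by (intro exI[of _ "real k"]) auto
    qed
  qed
qed

lemma L_nonneg: "0 \<le> t \<Longrightarrow> 0 \<le> L t \<omega>"
  by (rule inverse_stable_nonneg)

text \<open>Monotonicity in the level turns a minimum of two passage times into one passage time, so
  that product moments of minima are product moments of \<open>L\<close>.\<close>

lemma AE_L_min: "AE \<omega> in M. \<forall>s t. min (L s \<omega>) (L t \<omega>) = L (min s t) \<omega>"
proof (cases "\<alpha> = 1")
  case True
  then show ?thesis by (simp add: inverse_stable_def)
next
  case False
  then have "\<alpha> < 1" using \<alpha>1 by simp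
  from AE_H_unbounded[OF this] show ?thesis
  proof eventually_elim
    fix \<omega> assume *: "\<forall>t. \<exists>s\<ge>0. t \<le> H s \<omega>"
    then have "L s \<omega> \<le> L t \<omega>" if "s \<le> t" for s t
      using that by (intro inverse_stable_mono) auto
    then show "\<forall>s t. min (L s \<omega>) (L t \<omega>) = L (min s t) \<omega>"
      by (metis min.absorb1 min.absorb2 linear)
  qed
qed

text \<open>Without completion, the exceptional paths cannot be ignored. On them the value
  \<open>0\<close> is not above \<open>x \<ge> 0\<close>, so the event is the intersection of
  \<open>H x < t\<close> with the level being reached at all, and by monotonicity the latter can be
  tested at integer times.\<close>

lemma L_measurable:
  assumes t: "0 \<le> t"
  shows "L t \<in> borel_measurable M"
proof (cases "\<alpha> = 1")
  case True
  then have "L t = (\<lambda>_. t)" by (simp add: inverse_stable_def fun_eq_iff)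
  then show ?thesis by simp
next
  case False
  then have \<alpha>: "\<alpha> < 1" using \<alpha>1 by simp
  show ?thesis
    unfolding borel_measurable_iff_greater
  proof
    fix x
    show "{\<omega> \<in> space M. x < L t \<omega>} \<in> sets M"
    proof (cases "0 \<le> x")
      case False
      then have "x < L t \<omega>" for \<omega> using L_nonneg[OF t, of \<omega>] by linarith
      then have "{\<omega> \<in> space M. x < L t \<omega>} = space M" by auto
      then show ?thesis by simp
    next
      case True
      have ex_iff: "(\<exists>s\<ge>0. t \<le> H s \<omega>) \<longleftrightarrow> (\<exists>k::nat. t \<le> H (real k) \<omega>)" if "\<omega> \<in> space M" for \<omega>
      proof
        assume "\<exists>s\<ge>0. t \<le> H s \<omega>"
        then obtain s where s: "0 \<le> s" "t \<le> H s \<omega>" by blast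
        obtain k :: nat where k: "s \<le> real k" using real_arch_simple by blast
        have "H s \<omega> \<le> H (real k) \<omega>" using s k by (intro mono_onD[OF H_mono[OF \<alpha> that]]) auto
        then show "\<exists>k::nat. t \<le> H (real k) \<omega>" using s by (intro exI[of _ k]) simp
      next
        assume "\<exists>k::nat. t \<le> H (real k) \<omega>"
        then show "\<exists>s\<ge>0. t \<le> H s \<omega>" using of_nat_0_le_iff by blast
      qed
      have "{\<omega> \<in> space M. x < L t \<omega>} = {\<omega> \<in> space M. \<exists>k::nat. t \<le> H (real k) \<omega>} \<inter> {\<omega> \<in> space M. H x \<omega> < t}"
      proof (rule Set.set_eqI)
        fix \<omega>
        show "\<omega> \<in> {\<omega> \<in> space M. x < L t \<omega>} \<longleftrightarrow> \<omega> \<in> {\<omega> \<in> space M. \<exists>k::nat. t \<le> H (real k) \<omega>} \<inter> {\<omega> \<in> space M. H x \<omega> < t}"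
        proof (cases "\<omega> \<in> space M \<and> (\<exists>s\<ge>0. t \<le> H s \<omega>)")
          case T: True
          then have "x < L t \<omega> \<longleftrightarrow> H x \<omega> < t"
            using H_mono[OF \<alpha>] H_right_continuous[OF \<alpha>] True \<open>\<alpha> \<noteq> 1\<close> by (intro inverse_stable_gt_iff) auto
          then show ?thesis using T ex_iff by blast
        next
          case F: False
          then have "\<omega> \<in> space M \<Longrightarrow> L t \<omega> = 0" using \<open>\<alpha> \<noteq> 1\<close> by (auto simp: inverse_stable_def)
          then show ?thesis using F ex_iff True by auto
        qed
      qed
      also have "\<dots> \<in> sets M"
        using True by (intro sets.Int sets.sets_Collect_countable_Ex borel_measurable_less borel_measurable_le H_measurable \<alpha>) auto
      finally show ?thesis .
    qed
  qed
qed

lemma L_tail: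
  assumes \<alpha>: "\<alpha> < 1" and x: "0 \<le> x"
  shows "AE \<omega> in M. x < L t \<omega> \<longleftrightarrow> H x \<omega> < t"
  using AE_H_unbounded[OF \<alpha>] AE_space
proof eventually_elim
  fix \<omega> assume "\<forall>t. \<exists>s\<ge>0. t \<le> H s \<omega>" "\<omega> \<in> space M"
  then show "x < L t \<omega> \<longleftrightarrow> H x \<omega> < t"
    using \<alpha> x H_mono[OF \<alpha>] H_right_continuous[OF \<alpha>] by (intro inverse_stable_gt_iff) auto
qed

text \<open>\<open>L t > k\<close> has probability at most \<open>exp (t - k)\<close>, while
  \<open>y ^ p\<close> is at most a constant times \<open>exp (y / 2)\<close>; summing over unit
  intervals leaves a geometric series of ratio \<open>exp (- 1 / 2)\<close>.\<close>

lemma L_all_moments: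
  assumes t: "0 \<le> t"
  shows "all_moments M (L t)"
proof (cases "\<alpha> = 1")
  case True
  then have "L t = (\<lambda>_. t)" by (simp add: inverse_stable_def fun_eq_iff)
  then show ?thesis by (simp add: all_moments_const)
next
  case False
  then have \<alpha>: "\<alpha> < 1" using \<alpha>1 by simp
  have Lm: "L t \<in> borel_measurable M" by (rule L_measurable[OF t])
  have "integrable M (\<lambda>\<omega>. \<bar>L t \<omega>\<bar> ^ p)" for p
  proof (rule integrableI_bounded)
    show "(\<lambda>\<omega>. \<bar>L t \<omega>\<bar> ^ p) \<in> borel_measurable M" using Lm by measurable
    \<comment> \<open>From \<open>(1 + y / (2 * p)) ^ p \<le> exp (y / 2)\<close>; the factor
      \<open>exp (1 / 2)\<close> passes from \<open>y\<close> to the left end \<open>k\<close> of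
      its unit interval.\<close>
    let ?C = "(2 * real p) ^ p * exp (1 / 2) :: real"
    have pw: "y ^ p \<le> ?C * exp (real k / 2)" if y: "0 \<le> y" "y \<le> real k + 1" for y k
    proof -
      have "y ^ p \<le> (2 * real p) ^ p * exp (y / 2)"
      proof (cases "p = 0")
        case False
        have "(y / (2 * real p)) ^ p \<le> (1 + (y / 2) / real p) ^ p"
          using y by (intro power_mono) auto
        also have "\<dots> \<le> exp (y / 2)"
          using y False by (intro exp_ge_one_plus_x_over_n_power_n) auto
        finally have "(2 * real p) ^ p * (y / (2 * real p)) ^ p \<le> (2 * real p) ^ p * exp (y / 2)"
          by (rule mult_left_mono) simp
        moreover have "2 * real p * (y / (2 * real p)) = y" using False by simp
        ultimately show ?thesis unfolding power_mult_distrib[symmetric] by (simp only:)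
      qed (use y in simp)
      also have "\<dots> \<le> (2 * real p) ^ p * exp ((real k + 1) / 2)" using y by (intro mult_left_mono) auto
      also have "\<dots> = ?C * exp (real k / 2)" by (simp add: exp_add[symmetric] add_divide_distrib mult.assoc add.commute)
      finally show ?thesis .
    qed
    \<comment> \<open>The summand \<open>1\<close> is for \<open>L t \<omega> = 0\<close>, where no
      \<open>k\<close> qualifies but the power is \<open>1\<close> when
      \<open>p = 0\<close>.\<close>
    have bound: "ennreal (norm (\<bar>L t \<omega>\<bar> ^ p)) \<le> 1 + (suminf (\<lambda>k. ennreal (?C * exp (real k / 2)) * indicator {\<omega> \<in> space M. real k < L t \<omega>} \<omega>))"
      if \<omega>: "\<omega> \<in> space M" for \<omega>
    proof (cases "L t \<omega> = 0")
      case True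
      then have "ennreal (norm (\<bar>L t \<omega>\<bar> ^ p)) \<le> 1" by (cases p) auto
      also have "1 \<le> 1 + (suminf (\<lambda>k. ennreal (?C * exp (real k / 2)) * indicator {\<omega> \<in> space M. real k < L t \<omega>} \<omega>))" by simp
      finally show ?thesis .
    next
      case False
      then have pos: "0 < L t \<omega>" using L_nonneg[OF t, of \<omega>] by simp
      \<comment> \<open>Ceiling minus one, since the interval must be open on the left:
        \<open>k < L t \<omega> \<le> k + 1\<close>.\<close>
      define k where "k = nat (\<lceil>L t \<omega>\<rceil> - 1)"
      have k: "real k < L t \<omega>" "L t \<omega> \<le> real k + 1"
        using pos unfolding k_def by (auto simp: of_nat_nat) linarith+
      have "ennreal (norm (\<bar>L t \<omega>\<bar> ^ p)) \<le> ennreal (?C * exp (real k / 2)) * indicator {\<omega> \<in> space M. real k < L t \<omega>} \<omega>"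
        using pw[OF _ k(2)] pos k(1) \<omega> by (auto intro!: ennreal_leI)
      also have "\<dots> \<le> (suminf (\<lambda>k. ennreal (?C * exp (real k / 2)) * indicator {\<omega> \<in> space M. real k < L t \<omega>} \<omega>))"
      proof -
        define F :: "nat \<Rightarrow> ennreal" where "F = (\<lambda>k. ennreal (?C * exp (real k / 2)) * indicator {\<omega> \<in> space M. real k < L t \<omega>} \<omega>)"
        have "sum F {k} \<le> suminf F" by (rule sum_le_suminf) auto
        then have "F k \<le> suminf F" by simp
        then show ?thesis unfolding F_def .
      qed
      finally show ?thesis by (simp add: add_increasing)
    qed
    have set: "{\<omega> \<in> space M. real k < L t \<omega>} \<in> sets M" for k
      using Lm by (intro borel_measurable_less) auto
    have "(\<integral>\<^sup>+\<omega>. ennreal (norm (\<bar>L t \<omega>\<bar> ^ p)) \<partial>M)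
      \<le> (\<integral>\<^sup>+\<omega>. 1 + (suminf (\<lambda>k. ennreal (?C * exp (real k / 2)) * indicator {\<omega> \<in> space M. real k < L t \<omega>} \<omega>)) \<partial>M)"
      by (intro nn_integral_mono bound)
    also have "\<dots> = 1 + (suminf (\<lambda>k. ennreal (?C * exp (real k / 2)) * emeasure M {\<omega> \<in> space M. real k < L t \<omega>}))"
      using set by (subst nn_integral_add) (auto simp: nn_integral_suminf nn_integral_cmult_indicator emeasure_space_1)
    also have "\<dots> \<le> 1 + (suminf (\<lambda>k. ennreal (?C * exp t * exp (- 1 / 2) ^ k)))"
    proof (intro add_left_mono suminf_le summableI)
      fix k :: nat
      have "emeasure M {\<omega> \<in> space M. real k < L t \<omega>} = emeasure M {\<omega> \<in> space M. H (real k) \<omega> < t}"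
      proof (rule emeasure_eq_AE)
        show "AE \<omega> in M. \<omega> \<in> {\<omega> \<in> space M. real k < L t \<omega>} \<longleftrightarrow> \<omega> \<in> {\<omega> \<in> space M. H (real k) \<omega> < t}"
          using L_tail[OF \<alpha>, of "real k" t] by (auto elim: eventually_mono)
        show "{\<omega> \<in> space M. H (real k) \<omega> < t} \<in> sets M"
          by (intro borel_measurable_less H_measurable \<alpha>) auto
      qed (rule set)
      also have "\<dots> \<le> ennreal (exp (t - real k))" by (rule H_tail[OF \<alpha>]) simp
      finally have "ennreal (?C * exp (real k / 2)) * emeasure M {\<omega> \<in> space M. real k < L t \<omega>}
          \<le> ennreal (?C * exp (real k / 2)) * ennreal (exp (t - real k))"
        by (rule mult_left_mono) simp
      also have "\<dots> = ennreal (?C * exp t * exp (- 1 / 2) ^ k)"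
      proof -
        have "exp (real k / 2) * exp (t - real k) = exp t * exp (- 1 / 2) ^ k"
          by (simp add: exp_of_nat_mult[symmetric] exp_add[symmetric])
        then show ?thesis by (simp add: ennreal_mult'[symmetric] mult.assoc)
      qed
      finally show "ennreal (?C * exp (real k / 2)) * emeasure M {\<omega> \<in> space M. real k < L t \<omega>}
          \<le> ennreal (?C * exp t * exp (- 1 / 2) ^ k)" .
    qed
    also have "\<dots> < \<infinity>"
    proof -
      have "summable (\<lambda>k. ?C * exp t * exp (- 1 / 2 :: real) ^ k)"
        by (intro summable_mult summable_geometric) simp
      then have "(suminf (\<lambda>k. ennreal (?C * exp t * exp (- 1 / 2 :: real) ^ k))) = ennreal (suminf (\<lambda>k. ?C * exp t * exp (- 1 / 2 :: real) ^ k))"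
        by (intro suminf_ennreal2) auto
      then show ?thesis by simp
    qed
    finally show "(\<integral>\<^sup>+\<omega>. ennreal (norm (\<bar>L t \<omega>\<bar> ^ p)) \<partial>M) < \<infinity>" .
  qed
  then show ?thesis using Lm by (simp add: all_moments_def)
qed

end

text \<open>Upper tails of passage times are lower events for the subordinator, whose joint
  probabilities scale; integrating the joint tails gives the product moments. The result is an
  identity for each \<open>a\<close>, so rescaled moments of the clock require no passage to the
  limit.\<close>

lemma inverse_stable_moment_scaling:
  fixes u :: "nat \<Rightarrow> real"
  assumes M: "stable_process M \<alpha> H" and P: "stable_process P \<alpha> G" and a: "0 < a" and u: "\<And>i. i < h \<Longrightarrow> 0 \<le> u i"
  shows "(\<integral>\<omega>. (\<Prod>i<h. inverse_stable \<alpha> H (a * u i) \<omega> / a powr \<alpha>) \<partial>M) = (\<integral>\<omega>. (\<Prod>i<h. inverse_stable \<alpha> G (u i) \<omega>) \<partial>P)"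
proof -
  interpret M: stable_process M \<alpha> H by fact
  interpret P: stable_process P \<alpha> G by fact
  show ?thesis
  proof (cases "\<alpha> = 1")
    case True
    then show ?thesis using a by (simp add: inverse_stable_def M.prob_space P.prob_space)
  next
    case False
    then have \<alpha>: "\<alpha> < 1" using M.\<alpha>1 by simp
    have au: "0 \<le> a * u i" if "i < h" for i using a u[OF that] by simp
    let ?f = "\<lambda>i \<omega>. M.L (a * u i) \<omega> / a powr \<alpha>" and ?g = "\<lambda>i. P.L (u i)"
    have fm: "?f i \<in> borel_measurable M" if "i < h" for i using M.L_measurable[OF au[OF that]] by measurable
    have gm: "?g i \<in> borel_measurable P" if "i < h" for i by (rule P.L_measurable[OF u[OF that]])
    have f0: "0 \<le> ?f i \<omega>" if "i < h" for i \<omega> using M.L_nonneg[OF au[OF that]] by simp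
    have g0: "0 \<le> ?g i \<omega>" if "i < h" for i \<omega> by (rule P.L_nonneg[OF u[OF that]])
    have "(\<integral>\<^sup>+\<omega>. indicator (space M) \<omega> * (\<Prod>i<h. ennreal (?f i \<omega>)) \<partial>M)
        = (\<integral>\<^sup>+\<omega>. indicator (space P) \<omega> * (\<Prod>i<h. ennreal (?g i \<omega>)) \<partial>P)"
    proof (rule nn_integral_prod_eq_of_joint_tails[OF M.prob_space_axioms P.prob_space_axioms, of h ?f ?g "space M" "space P"])
      show "?f i \<in> borel_measurable M" "?g i \<in> borel_measurable P" if "i < h" for i by (rule fm gm, fact)+
      show "0 \<le> ?f i \<omega>" "0 \<le> ?g i \<omega>'" if "i < h" for i \<omega> \<omega>' by (rule f0 g0, fact)+
      show "space M \<in> sets M" "space P \<in> sets P" by auto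
      fix x :: "nat \<Rightarrow> real" assume x: "\<And>i. i < h \<Longrightarrow> 0 \<le> x i"
      have "AE \<omega> in M. \<forall>i\<in>{..<h}. a powr \<alpha> * x i < M.L (a * u i) \<omega> \<longleftrightarrow> H (a powr \<alpha> * x i) \<omega> < a * u i"
        by (intro AE_finite_allI M.L_tail[OF \<alpha>]) (use x in auto)
      then have "emeasure M {\<omega> \<in> space M. \<forall>i<h. x i < ?f i \<omega>} = emeasure M {\<omega> \<in> space M. \<forall>i\<in>{..<h}. H (a powr \<alpha> * x i) \<omega> < a * u i}"
      proof (intro emeasure_eq_AE)
        show "AE \<omega> in M. \<omega> \<in> {\<omega> \<in> space M. \<forall>i<h. x i < ?f i \<omega>} \<longleftrightarrow> \<omega> \<in> {\<omega> \<in> space M. \<forall>i\<in>{..<h}. H (a powr \<alpha> * x i) \<omega> < a * u i}"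
          if "AE \<omega> in M. \<forall>i\<in>{..<h}. a powr \<alpha> * x i < M.L (a * u i) \<omega> \<longleftrightarrow> H (a powr \<alpha> * x i) \<omega> < a * u i"
          using that by eventually_elim (use a in \<open>auto simp: pos_less_divide_eq mult.commute\<close>)
        have "{\<omega> \<in> space M. \<forall>i\<in>{..<h}. x i < ?f i \<omega>} \<in> sets M"
          using fm by (intro sets.sets_Collect_finite_All borel_measurable_less) auto
        then show "{\<omega> \<in> space M. \<forall>i<h. x i < ?f i \<omega>} \<in> sets M" by (simp only: Ball_def lessThan_iff)
        show "{\<omega> \<in> space M. \<forall>i\<in>{..<h}. H (a powr \<alpha> * x i) \<omega> < a * u i} \<in> sets M"
          using x a by (intro sets.sets_Collect_finite_All borel_measurable_less M.H_measurable \<alpha>) auto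
      qed
      also have "\<dots> = emeasure P {\<omega> \<in> space P. \<forall>i\<in>{..<h}. G (x i) \<omega> < u i}"
        unfolding M.emeasure_eq_measure P.emeasure_eq_measure
        using stable_joint_scaling[OF M.prob_space_axioms P.prob_space_axioms M.H[OF \<alpha>] P.H[OF \<alpha>] a, of "{..<h}" x u] x by simp
      also have "\<dots> = emeasure P {\<omega> \<in> space P. \<forall>i<h. x i < ?g i \<omega>}"
      proof (rule emeasure_eq_AE)
        have "AE \<omega> in P. \<forall>i\<in>{..<h}. x i < P.L (u i) \<omega> \<longleftrightarrow> G (x i) \<omega> < u i"
          by (intro AE_finite_allI P.L_tail[OF \<alpha>]) (use x in auto)
        then show "AE \<omega> in P. \<omega> \<in> {\<omega> \<in> space P. \<forall>i\<in>{..<h}. G (x i) \<omega> < u i} \<longleftrightarrow> \<omega> \<in> {\<omega> \<in> space P. \<forall>i<h. x i < ?g i \<omega>}"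
          by eventually_elim auto
        have "{\<omega> \<in> space P. \<forall>i\<in>{..<h}. x i < ?g i \<omega>} \<in> sets P"
          using gm by (intro sets.sets_Collect_finite_All borel_measurable_less) auto
        then show "{\<omega> \<in> space P. \<forall>i<h. x i < ?g i \<omega>} \<in> sets P" by (simp only: Ball_def lessThan_iff)
        show "{\<omega> \<in> space P. \<forall>i\<in>{..<h}. G (x i) \<omega> < u i} \<in> sets P"
          using x by (intro sets.sets_Collect_finite_All borel_measurable_less P.H_measurable \<alpha>) auto
      qed
      finally show "emeasure M {\<omega> \<in> space M. \<forall>i<h. x i < ?f i \<omega>} = emeasure P {\<omega> \<in> space P. \<forall>i<h. x i < ?g i \<omega>}" .
    qed
    moreover have "(\<integral>\<^sup>+\<omega>. indicator (space M) \<omega> * (\<Prod>i<h. ennreal (?f i \<omega>)) \<partial>M) = (\<integral>\<^sup>+\<omega>. ennreal (\<Prod>i<h. ?f i \<omega>) \<partial>M)"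
      by (intro nn_integral_cong) (subst prod_ennreal, rule f0, simp_all)
    moreover have "(\<integral>\<^sup>+\<omega>. indicator (space P) \<omega> * (\<Prod>i<h. ennreal (?g i \<omega>)) \<partial>P) = (\<integral>\<^sup>+\<omega>. ennreal (\<Prod>i<h. ?g i \<omega>) \<partial>P)"
      by (intro nn_integral_cong) (subst prod_ennreal, rule g0, simp_all)
    ultimately have "(\<integral>\<^sup>+\<omega>. ennreal (\<Prod>i<h. ?f i \<omega>) \<partial>M) = (\<integral>\<^sup>+\<omega>. ennreal (\<Prod>i<h. ?g i \<omega>) \<partial>P)" by simp
    moreover have "(\<integral>\<omega>. (\<Prod>i<h. ?f i \<omega>) \<partial>M) = enn2real (\<integral>\<^sup>+\<omega>. ennreal (\<Prod>i<h. ?f i \<omega>) \<partial>M)"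
      using fm f0 by (intro integral_eq_nn_integral AE_I2 prod_nonneg borel_measurable_prod) auto
    moreover have "(\<integral>\<omega>. (\<Prod>i<h. ?g i \<omega>) \<partial>P) = enn2real (\<integral>\<^sup>+\<omega>. ennreal (\<Prod>i<h. ?g i \<omega>) \<partial>P)"
      using gm g0 by (intro integral_eq_nn_integral AE_I2 prod_nonneg borel_measurable_prod) auto
    ultimately show ?thesis by simp
  qed
qed

section \<open>The fractional Poisson process\<close>

text \<open>The Stein-Chen identity, from \<open>(k + 1) * pmf (k + 1) = r * pmf k\<close>. It
  lowers the degree of a moment by one and so takes the place of explicit Poisson moments.\<close>

lemma poisson_shift:
  fixes f :: "nat \<Rightarrow> ennreal"
  assumes r: "0 < r"
  shows "(\<integral>\<^sup>+k. of_nat k * f k \<partial>measure_pmf (poisson_pmf r)) = ennreal r * (\<integral>\<^sup>+k. f (Suc k) \<partial>measure_pmf (poisson_pmf r))"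
proof -
  let ?p = "pmf (poisson_pmf r)"
  have step: "ennreal (?p (Suc k)) * of_nat (Suc k) = ennreal r * ennreal (?p k)" for k
  proof -
    have "ennreal (?p (Suc k)) * of_nat (Suc k) = ennreal (?p (Suc k) * real (Suc k))"
      by (simp add: ennreal_mult' ennreal_of_nat_eq_real_of_nat del: of_nat_Suc)
    also have "?p (Suc k) * real (Suc k) = r * ?p k"
      using r by (simp add: pmf_poisson field_simps del: of_nat_Suc)
    also have "ennreal (r * ?p k) = ennreal r * ennreal (?p k)" by (rule ennreal_mult') (use r in simp)
    finally show ?thesis .
  qed
  have "(\<integral>\<^sup>+k. of_nat k * f k \<partial>measure_pmf (poisson_pmf r)) = suminf (\<lambda>k. ennreal (?p k) * (of_nat k * f k))"
    by (simp add: nn_integral_measure_pmf nn_integral_count_space_nat)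
  also have "\<dots> = suminf (\<lambda>k. ennreal (?p (Suc k)) * (of_nat (Suc k) * f (Suc k)))"
    using suminf_offset[OF summableI, of "\<lambda>k. ennreal (?p k) * (of_nat k * f k)" 1] by simp
  also have "\<dots> = suminf (\<lambda>k. ennreal r * (ennreal (?p k) * f (Suc k)))"
    by (simp only: mult.assoc[symmetric] step)
  also have "\<dots> = ennreal r * suminf (\<lambda>k. ennreal (?p k) * f (Suc k))" by (rule ennreal_suminf_cmult)
  also have "suminf (\<lambda>k. ennreal (?p k) * f (Suc k)) = (\<integral>\<^sup>+k. f (Suc k) \<partial>measure_pmf (poisson_pmf r))"
    by (simp add: nn_integral_measure_pmf nn_integral_count_space_nat)
  finally show ?thesis .
qed

text \<open>One factor \<open>1 + k\<close> is split into \<open>k\<close>, removed by the shift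
  identity, and \<open>1\<close>. The growth in \<open>r\<close> is explicit because
  \<open>r\<close> will be a random time.\<close>

lemma poisson_moment_bound:
  "\<exists>C\<ge>0. \<forall>r>0. (\<integral>\<^sup>+k. ennreal ((1 + real k) ^ p) \<partial>measure_pmf (poisson_pmf r)) \<le> ennreal (C * (1 + r) ^ p)"
proof (induction p)
  case 0
  show ?case by (intro exI[of _ 1]) (simp add: measure_pmf.emeasure_space_1)
next
  case (Suc p)
  then obtain C where C: "0 \<le> C" "\<And>r. 0 < r \<Longrightarrow> (\<integral>\<^sup>+k. ennreal ((1 + real k) ^ p) \<partial>measure_pmf (poisson_pmf r)) \<le> ennreal (C * (1 + r) ^ p)"
    by blast
  show ?case
  \<comment> \<open>\<open>2 ^ p\<close> is the cost of the shift, from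
    \<open>1 + Suc k \<le> 2 * (1 + k)\<close>, and it also covers the unshifted term since
    \<open>r * 2 ^ p + 1 \<le> 2 ^ p * (1 + r)\<close>.\<close>
  proof (intro exI[of _ "2 ^ p * C"] conjI allI impI)
    show "0 \<le> 2 ^ p * C" using C by simp
    fix r :: real assume r: "0 < r"
    let ?I = "\<lambda>f. \<integral>\<^sup>+k. f k \<partial>measure_pmf (poisson_pmf r)"
    have "?I (\<lambda>k. ennreal ((1 + real k) ^ Suc p))
        = ?I (\<lambda>k. of_nat k * ennreal ((1 + real k) ^ p) + ennreal ((1 + real k) ^ p))"
      by (intro nn_integral_cong) (simp add: ennreal_of_nat_eq_real_of_nat ennreal_mult'[symmetric] ennreal_plus[symmetric] distrib_right algebra_simps del: ennreal_plus)
    also have "\<dots> = ennreal r * ?I (\<lambda>k. ennreal ((1 + real (Suc k)) ^ p)) + ?I (\<lambda>k. ennreal ((1 + real k) ^ p))"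
      by (subst nn_integral_add) (simp_all add: poisson_shift[OF r] del: of_nat_Suc)
    also have "?I (\<lambda>k. ennreal ((1 + real (Suc k)) ^ p)) \<le> ?I (\<lambda>k. ennreal (2 ^ p) * ennreal ((1 + real k) ^ p))"
    proof (rule nn_integral_mono)
      fix k
      have "(1 + real (Suc k)) ^ p \<le> (2 * (1 + real k)) ^ p" by (rule power_mono) auto
      also have "\<dots> = 2 ^ p * (1 + real k) ^ p" by (rule power_mult_distrib)
      finally have "ennreal ((1 + real (Suc k)) ^ p) \<le> ennreal (2 ^ p * (1 + real k) ^ p)" by (rule ennreal_leI)
      also have "\<dots> = ennreal (2 ^ p) * ennreal ((1 + real k) ^ p)" by (rule ennreal_mult') simp
      finally show "ennreal ((1 + real (Suc k)) ^ p) \<le> ennreal (2 ^ p) * ennreal ((1 + real k) ^ p)" .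
    qed
    also have "\<dots> = ennreal (2 ^ p) * ?I (\<lambda>k. ennreal ((1 + real k) ^ p))"
      by (rule nn_integral_cmult) simp
    also have "ennreal r * (ennreal (2 ^ p) * ?I (\<lambda>k. ennreal ((1 + real k) ^ p))) + ?I (\<lambda>k. ennreal ((1 + real k) ^ p))
        = (ennreal r * ennreal (2 ^ p) + 1) * ?I (\<lambda>k. ennreal ((1 + real k) ^ p))"
      by (simp add: distrib_right mult.assoc)
    also have "\<dots> \<le> ennreal (2 ^ p * (1 + r)) * ennreal (C * (1 + r) ^ p)"
    proof (rule mult_mono)
      have "ennreal r * ennreal (2 ^ p) + 1 = ennreal (r * 2 ^ p + 1)"
        using r by (simp add: ennreal_mult'[symmetric] ennreal_plus[symmetric] ennreal_1[symmetric] del: ennreal_plus ennreal_1)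
      also have "\<dots> \<le> ennreal (2 ^ p * (1 + r))"
        using one_le_power[of "2::real" p] by (intro ennreal_leI) (simp add: algebra_simps)
      finally show "ennreal r * ennreal (2 ^ p) + 1 \<le> ennreal (2 ^ p * (1 + r))" .
    qed (use C r in auto)
    also have "\<dots> = ennreal (2 ^ p * C * (1 + r) ^ Suc p)"
      using r C by (simp add: ennreal_mult'[symmetric] mult_ac)
    finally show "?I (\<lambda>k. ennreal ((1 + real k) ^ Suc p)) \<le> ennreal (2 ^ p * C * (1 + r) ^ Suc p)"
      by (simp add: mult_left_mono add_right_mono)
  qed
qed

lemma poisson_variance:
  assumes r: "0 < r"
  shows "(\<integral>\<^sup>+k. ennreal ((real k - r)\<^sup>2) \<partial>measure_pmf (poisson_pmf r)) = ennreal r"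
proof -
  let ?P = "measure_pmf (poisson_pmf r)"
  have 1: "(\<integral>\<^sup>+k. ennreal (real k) \<partial>?P) = ennreal r"
    using poisson_shift[OF r, of "\<lambda>_. 1"] by (simp add: ennreal_of_nat_eq_real_of_nat measure_pmf.emeasure_space_1)
  have 2: "(\<integral>\<^sup>+k. ennreal (real k * real k) \<partial>?P) = ennreal (r * (r + 1))"
  proof -
    have "(\<integral>\<^sup>+k. ennreal (real k * real k) \<partial>?P) = (\<integral>\<^sup>+k. of_nat k * ennreal (real k) \<partial>?P)"
      by (intro nn_integral_cong) (simp add: ennreal_of_nat_eq_real_of_nat ennreal_mult')
    also have "\<dots> = ennreal r * (\<integral>\<^sup>+k. ennreal (real (Suc k)) \<partial>?P)" by (rule poisson_shift[OF r])
    also have "(\<integral>\<^sup>+k. ennreal (real (Suc k)) \<partial>?P) = (\<integral>\<^sup>+k. ennreal (real k) + 1 \<partial>?P)"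
      by (intro nn_integral_cong) (simp add: ennreal_plus[symmetric] ennreal_1[symmetric] add.commute del: ennreal_plus ennreal_1)
    also have "\<dots> = ennreal r + 1" by (subst nn_integral_add) (simp_all add: 1 measure_pmf.emeasure_space_1)
    also have "ennreal r * (ennreal r + 1) = ennreal (r * (r + 1))"
      using r by (simp add: ennreal_mult' ennreal_plus)
    finally show ?thesis .
  qed
  have i1: "integrable ?P (\<lambda>k. real k)" "(\<integral>k. real k \<partial>?P) = r"
    using 1 r by (simp_all add: nn_integral_eq_integrable)
  have i2: "integrable ?P (\<lambda>k. real k * real k)" "(\<integral>k. real k * real k \<partial>?P) = r * (r + 1)"
    using 2 r by (simp_all add: nn_integral_eq_integrable)
  have e: "(real k - r)\<^sup>2 = real k * real k - 2 * r * real k + r\<^sup>2" for k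
    by (simp add: power2_eq_square algebra_simps)
  have i: "integrable ?P (\<lambda>k. real k * real k - 2 * r * real k + r\<^sup>2)"
    using i1(1) i2(1) by (intro Bochner_Integration.integrable_add Bochner_Integration.integrable_diff integrable_mult_right) auto
  have "(\<integral>k. real k * real k - 2 * r * real k + r\<^sup>2 \<partial>?P) = r * (r + 1) - 2 * r * r + r\<^sup>2"
    using i1 i2 by (simp add: measure_pmf.prob_space)
  also have "\<dots> = r" by (simp add: power2_eq_square algebra_simps)
  finally have v: "(\<integral>k. (real k - r)\<^sup>2 \<partial>?P) = r" unfolding e .
  have "integrable ?P (\<lambda>k. (real k - r)\<^sup>2)" using i unfolding e .
  then have "(\<integral>\<^sup>+k. ennreal ((real k - r)\<^sup>2) \<partial>?P) = ennreal (\<integral>k. (real k - r)\<^sup>2 \<partial>?P)"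
    by (rule nn_integral_eq_integral) simp
  then show ?thesis unfolding v .
qed

section \<open>The Poisson process at fixed times\<close>

lemma poisson_process_nn_integral:
  fixes f :: "nat \<Rightarrow> ennreal"
  assumes N: "poisson_process M 1 N" and s: "0 < s"
  shows "(\<integral>\<^sup>+\<omega>. f (N s \<omega>) \<partial>M) = (\<integral>\<^sup>+k. f k \<partial>measure_pmf (poisson_pmf s))"
proof -
  have lev: "levy_process M (\<lambda>t \<omega>. real (N t \<omega>))" and d: "distr M (count_space UNIV) (N s) = measure_pmf (poisson_pmf s)"
    using N s by (auto simp: poisson_process_def)
  have "(\<lambda>\<omega>. real (N s \<omega>)) \<in> borel_measurable M" using levy_measurable[OF lev] s by simp
  \<comment> \<open>The path is known to be measurable as a real function; rounding recovers the
    count as a discrete variable.\<close>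
  then have "(\<lambda>\<omega>. nat \<lfloor>real (N s \<omega>)\<rfloor>) \<in> measurable M (count_space UNIV)" by measurable
  then have m: "N s \<in> measurable M (count_space UNIV)" by simp
  show ?thesis unfolding d[symmetric] by (subst nn_integral_distr[OF m]) auto
qed

text \<open>The Poisson law is prescribed for positive times only, whereas the clock may be
  \<open>0\<close>; there the count vanishes almost surely by the initial condition of a Levy
  process.\<close>

lemma poisson_process_at_0:
  assumes "prob_space M" and N: "poisson_process M 1 N"
  shows "(\<integral>\<^sup>+\<omega>. f (N 0 \<omega>) \<partial>M) = f 0"
proof -
  interpret prob_space M by fact
  have "AE \<omega> in M. real (N 0 \<omega>) = 0" using N by (simp add: poisson_process_def levy_process_def)
  then have "(\<integral>\<^sup>+\<omega>. f (N 0 \<omega>) \<partial>M) = (\<integral>\<^sup>+\<omega>. f 0 \<partial>M)"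
    by (intro nn_integral_cong_AE) (auto elim: eventually_mono)
  then show ?thesis by (simp add: emeasure_space_1)
qed

lemma poisson_process_moment_bound:
  assumes "prob_space M" and N: "poisson_process M 1 N"
  shows "\<exists>C\<ge>0. \<forall>s\<ge>0. (\<integral>\<^sup>+\<omega>. ennreal ((1 + real (N s \<omega>)) ^ p) \<partial>M) \<le> ennreal (C * (1 + s) ^ p)"
proof -
  obtain C where C: "0 \<le> C" "\<And>r. 0 < r \<Longrightarrow> (\<integral>\<^sup>+k. ennreal ((1 + real k) ^ p) \<partial>measure_pmf (poisson_pmf r)) \<le> ennreal (C * (1 + r) ^ p)"
    using poisson_moment_bound[of p] by blast
  show ?thesis
  proof (intro exI[of _ "C + 1"] conjI allI impI)
    show "0 \<le> C + 1" using C by simp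
    fix s :: real assume s: "0 \<le> s"
    show "(\<integral>\<^sup>+\<omega>. ennreal ((1 + real (N s \<omega>)) ^ p) \<partial>M) \<le> ennreal ((C + 1) * (1 + s) ^ p)"
    proof (cases "s = 0")
      case True
      then show ?thesis using poisson_process_at_0[OF assms, of "\<lambda>k. ennreal ((1 + real k) ^ p)"] C
        by (simp add: ennreal_1[symmetric] ennreal_leI del: ennreal_1)
    next
      case False
      then have "(\<integral>\<^sup>+\<omega>. ennreal ((1 + real (N s \<omega>)) ^ p) \<partial>M) \<le> ennreal (C * (1 + s) ^ p)"
        using C(2)[of s] s poisson_process_nn_integral[OF N, of s "\<lambda>k. ennreal ((1 + real k) ^ p)"] by simp
      also have "\<dots> \<le> ennreal ((C + 1) * (1 + s) ^ p)"
        using s by (intro ennreal_leI mult_right_mono) auto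
      finally show ?thesis .
    qed
  qed
qed

lemma poisson_process_variance:
  assumes "prob_space M" and N: "poisson_process M 1 N" and s: "0 \<le> s"
  shows "(\<integral>\<^sup>+\<omega>. ennreal ((real (N s \<omega>) - s)\<^sup>2) \<partial>M) = ennreal s"
proof (cases "s = 0")
  case True
  then show ?thesis using poisson_process_at_0[OF assms(1,2), of "\<lambda>k. ennreal ((real k - s)\<^sup>2)"] by simp
next
  case False
  then show ?thesis
    using s poisson_process_nn_integral[OF N, of s "\<lambda>k. ennreal ((real k - s)\<^sup>2)"] poisson_variance[of s] by simp
qed

section \<open>The Poisson process at an independent clock\<close>

locale fractional_poisson = stable_process M \<alpha> H for M :: "'a measure" and \<alpha> H +
  fixes N :: "real \<Rightarrow> 'a \<Rightarrow> nat"
  assumes N: "poisson_process M 1 N" and NL: "independent_processes M {0..} N {0..} L"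
begin

abbreviation K :: "real \<Rightarrow> 'a \<Rightarrow> nat" where "K \<equiv> time_change N L"

lemma N_right_continuous:
  "\<omega> \<in> space M \<Longrightarrow> 0 \<le> u \<Longrightarrow> continuous (at_right u) (\<lambda>s. real (N s \<omega>))"
  using N by (auto simp: poisson_process_def levy_process_def)

lemma N_measurable:
  assumes "0 \<le> t"
  shows "N t \<in> borel_measurable M" "(\<lambda>\<omega>. real (N t \<omega>)) \<in> borel_measurable M"
proof -
  have "levy_process M (\<lambda>t \<omega>. real (N t \<omega>))" using N by (simp add: poisson_process_def)
  then show m: "(\<lambda>\<omega>. real (N t \<omega>)) \<in> borel_measurable M" using levy_measurable[of M "\<lambda>t \<omega>. real (N t \<omega>)"] assms by simp
  then have "(\<lambda>\<omega>. nat \<lfloor>real (N t \<omega>)\<rfloor>) \<in> measurable M (count_space UNIV)" by measurable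
  then show "N t \<in> borel_measurable M" by (simp add: measurable_cong_sets[OF refl sets_borel_eq_count_space])
qed

lemma K_measurable:
  assumes t: "0 \<le> t"
  shows "K t \<in> borel_measurable M" "(\<lambda>\<omega>. real (K t \<omega>)) \<in> borel_measurable M"
proof -
  have "(\<lambda>\<omega>. real (N (L t \<omega>) \<omega>)) \<in> borel_measurable M"
    by (rule right_continuous_joint_measurable[where A = M and Z = "\<lambda>s \<omega>. real (N s \<omega>)" and h = "\<lambda>\<omega>. \<omega>"])
      (use t N_measurable N_right_continuous L_measurable L_nonneg in auto)
  then show m: "(\<lambda>\<omega>. real (K t \<omega>)) \<in> borel_measurable M" unfolding time_change_def .
  then have "(\<lambda>\<omega>. nat \<lfloor>real (K t \<omega>)\<rfloor>) \<in> measurable M (count_space UNIV)" by measurable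
  then show "K t \<in> borel_measurable M" by (simp add: measurable_cong_sets[OF refl sets_borel_eq_count_space])
qed

text \<open>Keeping \<open>L t\<close> as a second argument of \<open>\<phi>\<close> lets one
  identity treat both the moments of the count and its deviation from the clock.\<close>

lemma K_freezing:
  fixes \<phi> :: "real \<Rightarrow> real \<Rightarrow> ennreal"
  assumes t: "0 \<le> t" and \<phi>: "case_prod \<phi> \<in> borel_measurable (borel \<Otimes>\<^sub>M borel)"
  shows "(\<integral>\<^sup>+\<omega>. \<phi> (real (K t \<omega>)) (L t \<omega>) \<partial>M) = (\<integral>\<^sup>+\<omega>'. (\<integral>\<^sup>+\<omega>. \<phi> (real (N (L t \<omega>') \<omega>)) (L t \<omega>') \<partial>M) \<partial>M)"
proof -
  let ?A = "process_measure M {0..} N" and ?B = "process_measure M {0..} L"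
  have m1: "N t \<in> borel_measurable M" if "t \<in> {0..}" for t using N_measurable that by simp
  have m2: "L t \<in> borel_measurable M" if "t \<in> {0..}" for t using L_measurable that by simp
  note fr = freezing_processes[OF m1 m2 NL]
  have NA: "(\<lambda>\<omega>. real (N s \<omega>)) \<in> borel_measurable ?A" if "0 \<le> s" for s
  proof -
    have "N s \<in> measurable ?A (count_space UNIV)"
      using measurable_process_measure[of s "{0..}" N M] that
      by (simp add: measurable_cong_sets[OF refl sets_borel_eq_count_space])
    then show ?thesis by (rule measurable_compose) simp
  qed
  have LB: "(\<lambda>z. L t (snd z)) \<in> borel_measurable (?A \<Otimes>\<^sub>M ?B)"
    by (intro measurable_compose[OF measurable_snd] measurable_process_measure) (use t in auto)
  have KB: "(\<lambda>z. real (N (L t (snd z)) (fst z))) \<in> borel_measurable (?A \<Otimes>\<^sub>M ?B)"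
    by (rule right_continuous_joint_measurable[where A = ?A and Z = "\<lambda>s \<omega>. real (N s \<omega>)" and h = fst])
      (use t NA N_right_continuous LB L_nonneg in \<open>auto simp: space_pair_measure\<close>)
  have "(\<lambda>z. case_prod \<phi> (real (N (L t (snd z)) (fst z)), L t (snd z))) \<in> borel_measurable (?A \<Otimes>\<^sub>M ?B)"
    by (rule measurable_compose[OF measurable_Pair[OF KB LB] \<phi>])
  then have "case_prod (\<lambda>\<omega> \<omega>'. \<phi> (real (N (L t \<omega>') \<omega>)) (L t \<omega>')) \<in> borel_measurable (?A \<Otimes>\<^sub>M ?B)"
    by (simp add: case_prod_beta')
  from freezing_nn[OF fr this] show ?thesis unfolding time_change_def .
qed

lemma K_moment_bound:
  "\<exists>C\<ge>0. \<forall>t\<ge>0. (\<integral>\<^sup>+\<omega>. ennreal ((1 + real (K t \<omega>)) ^ p) \<partial>M) \<le> ennreal (C * expectation (\<lambda>\<omega>. (1 + L t \<omega>) ^ p))"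
proof -
  obtain C where C: "0 \<le> C" "\<And>s. 0 \<le> s \<Longrightarrow> (\<integral>\<^sup>+\<omega>. ennreal ((1 + real (N s \<omega>)) ^ p) \<partial>M) \<le> ennreal (C * (1 + s) ^ p)"
    using poisson_process_moment_bound[OF prob_space_axioms N, of p] by blast
  show ?thesis
  proof (intro exI[of _ C] conjI allI impI)
    fix t :: real assume t: "0 \<le> t"
    have "(\<integral>\<^sup>+\<omega>. ennreal ((1 + real (K t \<omega>)) ^ p) \<partial>M) = (\<integral>\<^sup>+\<omega>'. (\<integral>\<^sup>+\<omega>. ennreal ((1 + real (N (L t \<omega>') \<omega>)) ^ p) \<partial>M) \<partial>M)"
      by (rule K_freezing[OF t, of "\<lambda>k l. ennreal ((1 + k) ^ p)"]) measurable
    also have "\<dots> \<le> (\<integral>\<^sup>+\<omega>'. ennreal (C * (1 + L t \<omega>') ^ p) \<partial>M)"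
      by (intro nn_integral_mono C L_nonneg t)
    also have "\<dots> = ennreal (expectation (\<lambda>\<omega>. C * (1 + L t \<omega>) ^ p))"
    proof (rule nn_integral_eq_integral)
      show "integrable M (\<lambda>\<omega>. C * (1 + L t \<omega>) ^ p)"
        by (intro all_moments_integrable all_moments_cmult all_moments_power all_moments_add all_moments_const L_all_moments t)
      show "AE \<omega> in M. 0 \<le> C * (1 + L t \<omega>) ^ p"
        using C L_nonneg[OF t] by (intro AE_I2 mult_nonneg_nonneg zero_le_power add_nonneg_nonneg) auto
    qed
    finally show "(\<integral>\<^sup>+\<omega>. ennreal ((1 + real (K t \<omega>)) ^ p) \<partial>M) \<le> ennreal (C * expectation (\<lambda>\<omega>. (1 + L t \<omega>) ^ p))" by simp
  qed (rule C)
qed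

lemma K_all_moments:
  assumes t: "0 \<le> t"
  shows "all_moments M (\<lambda>\<omega>. real (K t \<omega>))"
proof -
  have "integrable M (\<lambda>\<omega>. \<bar>real (K t \<omega>)\<bar> ^ p)" for p
  proof (rule integrableI_bounded)
    show "(\<lambda>\<omega>. \<bar>real (K t \<omega>)\<bar> ^ p) \<in> borel_measurable M" using K_measurable(2)[OF t] by measurable
    obtain C where "(\<integral>\<^sup>+\<omega>. ennreal ((1 + real (K t \<omega>)) ^ p) \<partial>M) \<le> ennreal (C * expectation (\<lambda>\<omega>. (1 + L t \<omega>) ^ p))"
      using K_moment_bound[of p] t by blast
    moreover have "(\<integral>\<^sup>+\<omega>. ennreal (norm (\<bar>real (K t \<omega>)\<bar> ^ p)) \<partial>M) \<le> (\<integral>\<^sup>+\<omega>. ennreal ((1 + real (K t \<omega>)) ^ p) \<partial>M)"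
      by (intro nn_integral_mono ennreal_leI) (auto intro!: power_mono)
    ultimately have "(\<integral>\<^sup>+\<omega>. ennreal (norm (\<bar>real (K t \<omega>)\<bar> ^ p)) \<partial>M) \<le> ennreal (C * expectation (\<lambda>\<omega>. (1 + L t \<omega>) ^ p))"
      by (rule order.trans[rotated])
    then show "(\<integral>\<^sup>+\<omega>. ennreal (norm (\<bar>real (K t \<omega>)\<bar> ^ p)) \<partial>M) < \<infinity>"
      by (rule order.strict_trans1) simp
  qed
  then show ?thesis using K_measurable(2)[OF t] by (simp add: all_moments_def)
qed

text \<open>Given the clock, the count is Poisson with parameter \<open>L t\<close>, whose mean and
  variance are both \<open>L t\<close>.\<close>

lemma K_minus_L_variance:
  assumes t: "0 \<le> t"
  shows "expectation (\<lambda>\<omega>. (real (K t \<omega>) - L t \<omega>)\<^sup>2) = expectation (L t)"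
proof -
  have am: "all_moments M (\<lambda>\<omega>. real (K t \<omega>) + (- 1) * L t \<omega>)"
    by (intro all_moments_add all_moments_cmult K_all_moments L_all_moments t)
  then have i: "integrable M (\<lambda>\<omega>. (real (K t \<omega>) - L t \<omega>)\<^sup>2)"
    using all_moments_integrable[OF all_moments_power[OF am, of 2]] by simp
  have "ennreal (expectation (\<lambda>\<omega>. (real (K t \<omega>) - L t \<omega>)\<^sup>2)) = (\<integral>\<^sup>+\<omega>. ennreal ((real (K t \<omega>) - L t \<omega>)\<^sup>2) \<partial>M)"
    by (rule nn_integral_eq_integral[OF i, symmetric]) simp
  also have "\<dots> = (\<integral>\<^sup>+\<omega>'. (\<integral>\<^sup>+\<omega>. ennreal ((real (N (L t \<omega>') \<omega>) - L t \<omega>')\<^sup>2) \<partial>M) \<partial>M)"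
    by (rule K_freezing[OF t, of "\<lambda>k l. ennreal ((k - l)\<^sup>2)"]) measurable
  also have "\<dots> = (\<integral>\<^sup>+\<omega>'. ennreal (L t \<omega>') \<partial>M)"
    by (intro nn_integral_cong poisson_process_variance[OF prob_space_axioms N] L_nonneg t)
  also have "\<dots> = ennreal (expectation (L t))"
    using L_nonneg[OF t] by (intro nn_integral_eq_integral all_moments_integrable L_all_moments t) auto
  finally show ?thesis
    using L_nonneg[OF t] by (subst (asm) ennreal_inj) (auto intro!: integral_nonneg_AE)
qed

end

section \<open>Replacing the count by its clock\<close>

definition bounded_moments :: "'a measure \<Rightarrow> (nat \<Rightarrow> 'a \<Rightarrow> real) \<Rightarrow> bool" where
  "bounded_moments M f \<longleftrightarrow> (\<forall>n. all_moments M (f n)) \<and> (\<forall>p::nat. \<exists>C. \<forall>n\<ge>1. (\<integral>\<omega>. \<bar>f n \<omega>\<bar> ^ p \<partial>M) \<le> C)"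

lemma bounded_moments_add:
  assumes "bounded_moments M f" "bounded_moments M g"
  shows "bounded_moments M (\<lambda>n \<omega>. f n \<omega> + g n \<omega>)"
  unfolding bounded_moments_def
proof (intro conjI allI)
  have fm: "all_moments M (f n)" and gm: "all_moments M (g n)" for n using assms by (simp_all add: bounded_moments_def)
  then show "all_moments M (\<lambda>\<omega>. f n \<omega> + g n \<omega>)" for n by (rule all_moments_add)
  fix p :: nat
  obtain C C' where C: "\<And>n. 1 \<le> n \<Longrightarrow> (\<integral>\<omega>. \<bar>f n \<omega>\<bar> ^ p \<partial>M) \<le> C" "\<And>n. 1 \<le> n \<Longrightarrow> (\<integral>\<omega>. \<bar>g n \<omega>\<bar> ^ p \<partial>M) \<le> C'"
    using assms unfolding bounded_moments_def by blast
  show "\<exists>C. \<forall>n\<ge>1. (\<integral>\<omega>. \<bar>f n \<omega> + g n \<omega>\<bar> ^ p \<partial>M) \<le> C"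
  proof (intro exI[of _ "2 ^ p * (C + C')"] allI impI)
    fix n :: nat assume n: "1 \<le> n"
    have i: "integrable M (\<lambda>\<omega>. \<bar>f n \<omega>\<bar> ^ p)" "integrable M (\<lambda>\<omega>. \<bar>g n \<omega>\<bar> ^ p)"
      using all_moments_norm_power[OF fm, of n p] all_moments_norm_power[OF gm, of n p] by simp_all
    have "(\<integral>\<omega>. \<bar>f n \<omega> + g n \<omega>\<bar> ^ p \<partial>M) \<le> (\<integral>\<omega>. 2 ^ p * (\<bar>f n \<omega>\<bar> ^ p + \<bar>g n \<omega>\<bar> ^ p) \<partial>M)"
    proof (rule integral_mono')
      show "integrable M (\<lambda>\<omega>. 2 ^ p * (\<bar>f n \<omega>\<bar> ^ p + \<bar>g n \<omega>\<bar> ^ p))" using i by simp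
      show "\<bar>f n \<omega> + g n \<omega>\<bar> ^ p \<le> 2 ^ p * (\<bar>f n \<omega>\<bar> ^ p + \<bar>g n \<omega>\<bar> ^ p)" for \<omega>
        by (rule order.trans[OF power_mono[OF abs_triangle_ineq] add_power_le]) auto
    qed simp
    also have "\<dots> = 2 ^ p * ((\<integral>\<omega>. \<bar>f n \<omega>\<bar> ^ p \<partial>M) + (\<integral>\<omega>. \<bar>g n \<omega>\<bar> ^ p \<partial>M))" using i by simp
    also have "\<dots> \<le> 2 ^ p * (C + C')" using C[OF n] by simp
    finally show "(\<integral>\<omega>. \<bar>f n \<omega> + g n \<omega>\<bar> ^ p \<partial>M) \<le> 2 ^ p * (C + C')" .
  qed
qed

lemma bounded_moments_const:
  assumes "prob_space M"
  shows "bounded_moments M (\<lambda>_ _. c)"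
proof -
  interpret prob_space M by fact
  show ?thesis unfolding bounded_moments_def by (auto simp: all_moments_const prob_space)
qed

lemma bounded_moments_sum:
  assumes "prob_space M" "finite I" "\<And>i. i \<in> I \<Longrightarrow> bounded_moments M (f i)"
  shows "bounded_moments M (\<lambda>n \<omega>. \<Sum>i\<in>I. f i n \<omega>)"
  using assms(2,3)
  by (induction I rule: finite_induct) (auto intro: bounded_moments_const[OF assms(1)] bounded_moments_add)

text \<open>Factors are exchanged one at a time; \<open>1 \<le> R\<close> lets a single power of
  \<open>R\<close> bound the remaining product whatever its length.\<close>

lemma abs_prod_diff_le:
  fixes a b :: "nat \<Rightarrow> real"
  assumes "\<And>i. i < h \<Longrightarrow> \<bar>a i\<bar> \<le> R" "\<And>i. i < h \<Longrightarrow> \<bar>b i\<bar> \<le> R" "1 \<le> R"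
  shows "\<bar>(\<Prod>i<h. a i) - (\<Prod>i<h. b i)\<bar> \<le> R ^ h * (\<Sum>i<h. \<bar>a i - b i\<bar>)"
  using assms(1,2)
proof (induction h)
  case (Suc h)
  have pb: "\<bar>\<Prod>i<h. b i\<bar> \<le> R ^ Suc h"
  proof -
    have "\<bar>\<Prod>i<h. b i\<bar> = (\<Prod>i<h. \<bar>b i\<bar>)" by (rule abs_prod)
    also have "\<dots> \<le> (\<Prod>i<h. R)" using Suc.prems(2) by (intro prod_mono) auto
    also have "\<dots> = R ^ h" by simp
    also have "\<dots> \<le> R ^ Suc h" using assms(3) by (intro power_increasing) auto
    finally show ?thesis .
  qed
  have "(\<Prod>i<Suc h. a i) - (\<Prod>i<Suc h. b i) = a h * ((\<Prod>i<h. a i) - (\<Prod>i<h. b i)) + (a h - b h) * (\<Prod>i<h. b i)"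
    by (simp add: algebra_simps)
  then have "\<bar>(\<Prod>i<Suc h. a i) - (\<Prod>i<Suc h. b i)\<bar> \<le> \<bar>a h\<bar> * \<bar>(\<Prod>i<h. a i) - (\<Prod>i<h. b i)\<bar> + \<bar>a h - b h\<bar> * \<bar>\<Prod>i<h. b i\<bar>"
    by (simp add: abs_mult[symmetric])
  also have "\<dots> \<le> R * (R ^ h * (\<Sum>i<h. \<bar>a i - b i\<bar>)) + \<bar>a h - b h\<bar> * R ^ Suc h"
    using Suc pb assms(3) by (intro add_mono mult_mono) auto
  finally show ?case by (simp add: algebra_simps)
qed simp

context fractional_poisson
begin

text \<open>After division by \<open>n powr \<alpha>\<close> the product moments of the clock are
  constant in \<open>n \<ge> 1\<close>, so only the replacement of count by clock causes an error.
  The root mean square of the difference is of order \<open>n powr (- \<alpha> / 2)\<close>, and it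
  is multiplied by a power of a variable with bounded moments.\<close>

lemma counting_limit:
  fixes h :: nat and s t :: "nat \<Rightarrow> real"
  assumes P: "stable_process P \<alpha> G" and st: "\<And>i. i < h \<Longrightarrow> 0 \<le> s i \<and> 0 \<le> t i"
  shows "(\<lambda>n. expectation (\<lambda>\<omega>. \<Prod>i<h. min (real (K (real n * s i) \<omega>)) (real (K (real n * t i) \<omega>)) / real n powr \<alpha>))
    \<longlonglongrightarrow> (\<integral>\<omega>. (\<Prod>i<h. min (inverse_stable \<alpha> G (s i) \<omega>) (inverse_stable \<alpha> G (t i) \<omega>)) \<partial>P)"
proof -
  interpret P: stable_process P \<alpha> G by fact
  have SM: "stable_process M \<alpha> H" by unfold_locales
  have n\<alpha>: "1 \<le> real n powr \<alpha>" if "1 \<le> n" for n using that \<alpha>0 by (simp add: ge_one_powr_ge_zero)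
  define k where "k u n \<omega> = real (K (real n * u) \<omega>) / real n powr \<alpha>" for u n \<omega>
  define l where "l u n \<omega> = L (real n * u) \<omega> / real n powr \<alpha>" for u n \<omega>
  have nu: "0 \<le> real n * u" if "0 \<le> u" for n u using that by simp
  have div: "all_moments M (\<lambda>\<omega>. f \<omega> / d)" if "all_moments M f" for f and d :: real
    using all_moments_cmult[OF that, of "1 / d"] by simp
  have km: "all_moments M (k u n)" if "0 \<le> u" for u n
    unfolding k_def by (intro div K_all_moments nu that)
  have lm: "all_moments M (l u n)" if "0 \<le> u" for u n
    unfolding l_def by (intro div L_all_moments nu that)
  have k0: "0 \<le> k u n \<omega>" for u n \<omega> by (simp add: k_def)
  have l0: "0 \<le> l u n \<omega>" if "0 \<le> u" for u n \<omega> using L_nonneg[OF nu[OF that]] by (simp add: l_def)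
  have lpow: "expectation (\<lambda>\<omega>. l u n \<omega> ^ p) = P.expectation (\<lambda>\<omega>. P.L u \<omega> ^ p)" if "0 \<le> u" "1 \<le> n" for u n p
    using inverse_stable_moment_scaling[OF SM P, of "real n" p "\<lambda>_. u"] that by (simp add: l_def)
  have lb: "bounded_moments M (l u)" if u: "0 \<le> u" for u
    unfolding bounded_moments_def
  proof (intro conjI allI)
    show "all_moments M (l u n)" for n by (rule lm[OF u])
    show "\<exists>C. \<forall>n\<ge>1. expectation (\<lambda>\<omega>. \<bar>l u n \<omega>\<bar> ^ p) \<le> C" for p
      using lpow[OF u] l0[OF u] by (intro exI[of _ "P.expectation (\<lambda>\<omega>. P.L u \<omega> ^ p)"]) simp
  qed
  have kb: "bounded_moments M (k u)" if u: "0 \<le> u" for u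
    unfolding bounded_moments_def
  proof (intro conjI allI)
    show "all_moments M (k u n)" for n by (rule km[OF u])
    fix p :: nat
    obtain C where C: "0 \<le> C" "\<And>t. 0 \<le> t \<Longrightarrow> (\<integral>\<^sup>+\<omega>. ennreal ((1 + real (K t \<omega>)) ^ p) \<partial>M) \<le> ennreal (C * expectation (\<lambda>\<omega>. (1 + L t \<omega>) ^ p))"
      using K_moment_bound[of p] by blast
    obtain D where D: "\<And>n. 1 \<le> n \<Longrightarrow> expectation (\<lambda>\<omega>. \<bar>1 + l u n \<omega>\<bar> ^ p) \<le> D"
      using bounded_moments_add[OF bounded_moments_const[OF prob_space_axioms, of 1] lb[OF u]] unfolding bounded_moments_def by blast
    show "\<exists>C. \<forall>n\<ge>1. expectation (\<lambda>\<omega>. \<bar>k u n \<omega>\<bar> ^ p) \<le> C"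
    proof (intro exI[of _ "C * D"] allI impI)
      fix n :: nat assume n: "1 \<le> n"
      let ?t = "real n * u" and ?d = "real n powr \<alpha>"
      have i1: "integrable M (\<lambda>\<omega>. (1 + real (K ?t \<omega>)) ^ p)"
        by (intro all_moments_integrable all_moments_power all_moments_add all_moments_const K_all_moments nu u)
      have i2: "integrable M (\<lambda>\<omega>. (1 + L ?t \<omega>) ^ p)"
        by (intro all_moments_integrable all_moments_power all_moments_add all_moments_const L_all_moments nu u)
      have i3: "integrable M (\<lambda>\<omega>. (1 + l u n \<omega>) ^ p)"
        by (intro all_moments_integrable all_moments_power all_moments_add all_moments_const lm u)
      have L0: "0 \<le> L ?t \<omega>" for \<omega> by (rule L_nonneg[OF nu[OF u]])
      have "ennreal (expectation (\<lambda>\<omega>. (1 + real (K ?t \<omega>)) ^ p)) \<le> ennreal (C * expectation (\<lambda>\<omega>. (1 + L ?t \<omega>) ^ p))"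
        using C(2)[OF nu[OF u], of n] nn_integral_eq_integral[OF i1] by simp
      then have KL: "expectation (\<lambda>\<omega>. (1 + real (K ?t \<omega>)) ^ p) \<le> C * expectation (\<lambda>\<omega>. (1 + L ?t \<omega>) ^ p)"
        using C(1) L0 by (subst (asm) ennreal_le_iff) (auto intro!: mult_nonneg_nonneg integral_nonneg_AE)
      have "expectation (\<lambda>\<omega>. \<bar>k u n \<omega>\<bar> ^ p) \<le> expectation (\<lambda>\<omega>. (1 + real (K ?t \<omega>)) ^ p / ?d ^ p)"
      proof (rule integral_mono')
        show "integrable M (\<lambda>\<omega>. (1 + real (K ?t \<omega>)) ^ p / ?d ^ p)" using i1 by simp
        show "\<bar>k u n \<omega>\<bar> ^ p \<le> (1 + real (K ?t \<omega>)) ^ p / ?d ^ p" for \<omega>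
          unfolding k_def power_divide[symmetric] by (intro power_mono) (auto simp: divide_right_mono)
      qed (auto intro!: divide_nonneg_nonneg)
      also have "\<dots> = expectation (\<lambda>\<omega>. (1 + real (K ?t \<omega>)) ^ p) / ?d ^ p" by simp
      also have "\<dots> \<le> C * expectation (\<lambda>\<omega>. (1 + L ?t \<omega>) ^ p) / ?d ^ p"
        using KL by (rule divide_right_mono) simp
      also have "\<dots> = C * expectation (\<lambda>\<omega>. (1 + L ?t \<omega>) ^ p / ?d ^ p)" by simp
      also have "\<dots> \<le> C * expectation (\<lambda>\<omega>. (1 + l u n \<omega>) ^ p)"
      proof (intro mult_left_mono integral_mono')
        show "(1 + L ?t \<omega>) ^ p / ?d ^ p \<le> (1 + l u n \<omega>) ^ p" for \<omega>
        proof -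
          have "1 / ?d \<le> 1" using n\<alpha>[OF n] n by (auto simp: divide_le_eq_1)
          then have "(1 + L ?t \<omega>) / ?d \<le> 1 + l u n \<omega>" by (simp add: l_def add_divide_distrib)
          then show ?thesis unfolding power_divide[symmetric] using L0[of \<omega>]
            by (intro power_mono) (auto intro!: divide_nonneg_nonneg add_nonneg_nonneg)
        qed
        show "0 \<le> (1 + l u n \<omega>) ^ p" for \<omega> using l0[OF u, of n \<omega>] by simp
      qed (use i3 C in auto)
      also have "expectation (\<lambda>\<omega>. (1 + l u n \<omega>) ^ p) = expectation (\<lambda>\<omega>. \<bar>1 + l u n \<omega>\<bar> ^ p)"
        using l0[OF u] by simp
      also have "C * \<dots> \<le> C * D" using D[OF n] C(1) by (rule mult_left_mono)
      finally show "expectation (\<lambda>\<omega>. \<bar>k u n \<omega>\<bar> ^ p) \<le> C * D" .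
    qed
  qed
  \<comment> \<open>A common bound for all factors of both products; the summand \<open>1\<close>
    keeps it at least one for the exchange of factors.\<close>
  define R where "R n \<omega> = 1 + (\<Sum>i<h. k (s i) n \<omega> + k (t i) n \<omega> + l (s i) n \<omega> + l (t i) n \<omega>)" for n \<omega>
  have Rb: "bounded_moments M R"
    unfolding R_def[abs_def]
    by (intro bounded_moments_add bounded_moments_const bounded_moments_sum prob_space_axioms kb lb) (use st in auto)
  then have Rm: "all_moments M (R n)" for n by (simp add: bounded_moments_def)
  obtain W where W: "\<And>n. 1 \<le> n \<Longrightarrow> expectation (\<lambda>\<omega>. \<bar>R n \<omega>\<bar> ^ (2 * h)) \<le> W"
    using Rb unfolding bounded_moments_def by blast
  have term0: "0 \<le> k (s i) n \<omega> + k (t i) n \<omega> + l (s i) n \<omega> + l (t i) n \<omega>" if "i < h" for i n \<omega>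
    using k0 l0 st[OF that] by (intro add_nonneg_nonneg) auto
  have R1: "1 \<le> R n \<omega>" for n \<omega> unfolding R_def using term0 by (auto intro!: sum_nonneg)
  have Rge: "k (s i) n \<omega> + k (t i) n \<omega> + l (s i) n \<omega> + l (t i) n \<omega> \<le> R n \<omega>" if "i < h" for i n \<omega>
  proof -
    have "k (s i) n \<omega> + k (t i) n \<omega> + l (s i) n \<omega> + l (t i) n \<omega> \<le> (\<Sum>i<h. k (s i) n \<omega> + k (t i) n \<omega> + l (s i) n \<omega> + l (t i) n \<omega>)"
      using term0 that by (intro member_le_sum[of i "{..<h}" "\<lambda>i. k (s i) n \<omega> + k (t i) n \<omega> + l (s i) n \<omega> + l (t i) n \<omega>"]) auto
    then show ?thesis by (simp add: R_def)
  qed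
  let ?\<epsilon> = "\<lambda>n. real n powr (- \<alpha> / 2)"
  text \<open>\<open>N (L u) - L u\<close> has conditional variance \<open>L u\<close>, which is of order \<open>n powr \<alpha>\<close>.\<close>
  have err: "integrable M (\<lambda>\<omega>. R n \<omega> ^ h * \<bar>k u n \<omega> - l u n \<omega>\<bar>)"
    "expectation (\<lambda>\<omega>. R n \<omega> ^ h * \<bar>k u n \<omega> - l u n \<omega>\<bar>) \<le> ?\<epsilon> n * (P.expectation (P.L u) + W)"
    if u: "0 \<le> u" and n: "1 \<le> n" for u n
  proof -
    let ?d = "real n powr \<alpha>"
    have dm: "all_moments M (\<lambda>\<omega>. k u n \<omega> + (- 1) * l u n \<omega>)"
      by (intro all_moments_add all_moments_cmult km lm u)
    have "all_moments M (\<lambda>\<omega>. R n \<omega> ^ h * norm (k u n \<omega> + (- 1) * l u n \<omega>))"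
      using dm by (intro all_moments_mult all_moments_power Rm) (auto simp: all_moments_def intro!: borel_measurable_abs)
    then show i: "integrable M (\<lambda>\<omega>. R n \<omega> ^ h * \<bar>k u n \<omega> - l u n \<omega>\<bar>)"
      using all_moments_integrable by fastforce
    have i2: "integrable M (\<lambda>\<omega>. (k u n \<omega> - l u n \<omega>)\<^sup>2)"
      using all_moments_integrable[OF all_moments_power[OF dm, of 2]] by simp
    have i3: "integrable M (\<lambda>\<omega>. R n \<omega> ^ (2 * h))"
      by (intro all_moments_integrable all_moments_power Rm)
    have var: "expectation (\<lambda>\<omega>. (k u n \<omega> - l u n \<omega>)\<^sup>2) = P.expectation (P.L u) / ?d"
    proof -
      have "expectation (\<lambda>\<omega>. (k u n \<omega> - l u n \<omega>)\<^sup>2) = expectation (\<lambda>\<omega>. (real (K (real n * u) \<omega>) - L (real n * u) \<omega>)\<^sup>2 / ?d\<^sup>2)"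
        unfolding k_def l_def diff_divide_distrib[symmetric] power_divide ..
      also have "\<dots> = expectation (L (real n * u)) / ?d\<^sup>2"
        using K_minus_L_variance[OF nu[OF u], of n] by simp
      also have "\<dots> = expectation (\<lambda>\<omega>. l u n \<omega> ^ 1) / ?d"
        by (simp add: l_def power2_eq_square)
      finally show ?thesis using lpow[OF u n, of 1] by simp
    qed
    \<comment> \<open>Cauchy-Schwarz in additive form. The weight
      \<open>n powr (\<alpha> / 4)\<close> balances the two squares: \<open>(k - l) ^ 2\<close> has
      expectation of order \<open>n powr (- \<alpha>)\<close>, so both terms become of order
      \<open>n powr (- \<alpha> / 2)\<close>.\<close>
    have amgm: "R n \<omega> ^ h * \<bar>k u n \<omega> - l u n \<omega>\<bar> \<le> real n powr (\<alpha> / 2) * (k u n \<omega> - l u n \<omega>)\<^sup>2 + ?\<epsilon> n * R n \<omega> ^ (2 * h)" for \<omega>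
    proof -
      define c where "c = real n powr (\<alpha> / 4)"
      define a where "a = c * \<bar>k u n \<omega> - l u n \<omega>\<bar>"
      define b where "b = R n \<omega> ^ h / c"
      have c: "0 < c" "c\<^sup>2 = real n powr (\<alpha> / 2)" using n by (simp_all add: c_def power2_eq_square powr_add[symmetric])
      have ab: "R n \<omega> ^ h * \<bar>k u n \<omega> - l u n \<omega>\<bar> = a * b" using c by (simp add: a_def b_def)
      have "2 * (a * b) \<le> a\<^sup>2 + b\<^sup>2" using sum_squares_bound[of a b] by (simp add: mult.assoc)
      moreover have "0 \<le> a\<^sup>2" "0 \<le> b\<^sup>2" by simp_all
      ultimately have "a * b \<le> a\<^sup>2 + b\<^sup>2" by linarith
      also have "a\<^sup>2 = real n powr (\<alpha> / 2) * (k u n \<omega> - l u n \<omega>)\<^sup>2" unfolding a_def power_mult_distrib c(2) by simp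
      also have "b\<^sup>2 = ?\<epsilon> n * R n \<omega> ^ (2 * h)"
        unfolding b_def power_divide c(2) by (simp add: powr_minus_divide power_mult[symmetric] mult.commute)
      finally show ?thesis unfolding ab .
    qed
    have "expectation (\<lambda>\<omega>. R n \<omega> ^ h * \<bar>k u n \<omega> - l u n \<omega>\<bar>)
        \<le> expectation (\<lambda>\<omega>. real n powr (\<alpha> / 2) * (k u n \<omega> - l u n \<omega>)\<^sup>2 + ?\<epsilon> n * R n \<omega> ^ (2 * h))"
      using i i2 i3 amgm by (intro integral_mono) auto
    also have "\<dots> = real n powr (\<alpha> / 2) * (P.expectation (P.L u) / ?d) + ?\<epsilon> n * expectation (\<lambda>\<omega>. R n \<omega> ^ (2 * h))"
      using i2 i3 var by simp
    also have "real n powr (\<alpha> / 2) * (P.expectation (P.L u) / ?d) = ?\<epsilon> n * P.expectation (P.L u)"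
    proof -
      have "real n powr (\<alpha> / 2) / ?d = real n powr (\<alpha> / 2 - \<alpha>)" by (rule powr_diff[symmetric])
      also have "\<alpha> / 2 - \<alpha> = - \<alpha> / 2" by simp
      finally have e: "real n powr (\<alpha> / 2) / ?d = ?\<epsilon> n" .
      show ?thesis unfolding e[symmetric] by simp
    qed
    also have "expectation (\<lambda>\<omega>. R n \<omega> ^ (2 * h)) = expectation (\<lambda>\<omega>. \<bar>R n \<omega>\<bar> ^ (2 * h))"
      by (simp add: power_even_abs)
    also have "?\<epsilon> n * P.expectation (P.L u) + ?\<epsilon> n * \<dots> \<le> ?\<epsilon> n * P.expectation (P.L u) + ?\<epsilon> n * W"
      using W[OF n] by (intro add_left_mono mult_left_mono) auto
    finally show "expectation (\<lambda>\<omega>. R n \<omega> ^ h * \<bar>k u n \<omega> - l u n \<omega>\<bar>) \<le> ?\<epsilon> n * (P.expectation (P.L u) + W)"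
      by (simp add: distrib_left)
  qed
  let ?A = "\<lambda>n \<omega>. \<Prod>i<h. min (k (s i) n \<omega>) (k (t i) n \<omega>)"
  let ?B = "\<lambda>n \<omega>. \<Prod>i<h. min (l (s i) n \<omega>) (l (t i) n \<omega>)"
  have Am: "all_moments M (?A n)" for n using st by (intro all_moments_prod all_moments_min km) auto
  have Bm: "all_moments M (?B n)" for n using st by (intro all_moments_prod all_moments_min lm) auto
  have EA: "expectation (\<lambda>\<omega>. \<Prod>i<h. min (real (K (real n * s i) \<omega>)) (real (K (real n * t i) \<omega>)) / real n powr \<alpha>) = expectation (?A n)" for n
  proof -
    have "min x y / real n powr \<alpha> = min (x / real n powr \<alpha>) (y / real n powr \<alpha>)" for x y
    proof (cases "x \<le> y")
      case True
      then have "x / real n powr \<alpha> \<le> y / real n powr \<alpha>" by (rule divide_right_mono) simp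
      then show ?thesis using True by (simp only: min.absorb1)
    next
      case False
      then have "y / real n powr \<alpha> \<le> x / real n powr \<alpha>" by (intro divide_right_mono) auto
      then show ?thesis using False by (simp only: min.absorb2 linear not_le less_imp_le)
    qed
    then show ?thesis unfolding k_def by (simp only:)
  qed
  have EB: "expectation (?B n) = P.expectation (\<lambda>\<omega>. \<Prod>i<h. min (P.L (s i) \<omega>) (P.L (t i) \<omega>))" if n: "1 \<le> n" for n
  proof -
    have minu: "0 \<le> min (s i) (t i)" if "i < h" for i using st[OF that] by simp
    \<comment> \<open>The minimum of two clock values is the clock value at the smaller time, to
      which the scaling identity for product moments applies.\<close>
    have lmin: "AE \<omega> in M. ?B n \<omega> = (\<Prod>i<h. L (real n * min (s i) (t i)) \<omega> / real n powr \<alpha>)"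
      using AE_L_min
    proof eventually_elim
      fix \<omega> assume *: "\<forall>s t. min (L s \<omega>) (L t \<omega>) = L (min s t) \<omega>"
      have "min (l (s i) n \<omega>) (l (t i) n \<omega>) = L (real n * min (s i) (t i)) \<omega> / real n powr \<alpha>" for i
      proof -
        have "min (x / real n powr \<alpha>) (y / real n powr \<alpha>) = min x y / real n powr \<alpha>" for x y
          using n by (auto simp: min_def divide_le_cancel)
        moreover have "min (real n * s i) (real n * t i) = real n * min (s i) (t i)"
          using n by (simp add: min_mult_distrib_left)
        ultimately show ?thesis using * unfolding l_def by simp
      qed
      then show "?B n \<omega> = (\<Prod>i<h. L (real n * min (s i) (t i)) \<omega> / real n powr \<alpha>)" by simp
    qed
    have "expectation (?B n) = expectation (\<lambda>\<omega>. \<Prod>i<h. L (real n * min (s i) (t i)) \<omega> / real n powr \<alpha>)"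
    proof (rule integral_cong_AE[OF _ _ lmin])
      show "?B n \<in> borel_measurable M" by (rule all_moments_measurable[OF Bm])
      have "all_moments M (\<lambda>\<omega>. \<Prod>i<h. L (real n * min (s i) (t i)) \<omega> / real n powr \<alpha>)"
        by (intro all_moments_prod div L_all_moments nu minu) auto
      then show "(\<lambda>\<omega>. \<Prod>i<h. L (real n * min (s i) (t i)) \<omega> / real n powr \<alpha>) \<in> borel_measurable M"
        by (rule all_moments_measurable)
    qed
    also have "\<dots> = P.expectation (\<lambda>\<omega>. \<Prod>i<h. P.L (min (s i) (t i)) \<omega>)"
      by (rule inverse_stable_moment_scaling[OF SM P]) (use n minu in auto)
    also have "\<dots> = P.expectation (\<lambda>\<omega>. \<Prod>i<h. min (P.L (s i) \<omega>) (P.L (t i) \<omega>))"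
    proof (rule integral_cong_AE)
      show "AE \<omega> in P. (\<Prod>i<h. P.L (min (s i) (t i)) \<omega>) = (\<Prod>i<h. min (P.L (s i) \<omega>) (P.L (t i) \<omega>))"
        using P.AE_L_min by eventually_elim simp
      have "all_moments P (\<lambda>\<omega>. \<Prod>i<h. P.L (min (s i) (t i)) \<omega>)"
        by (intro P.all_moments_prod P.L_all_moments minu) auto
      then show "(\<lambda>\<omega>. \<Prod>i<h. P.L (min (s i) (t i)) \<omega>) \<in> borel_measurable P" by (rule all_moments_measurable)
      have "all_moments P (\<lambda>\<omega>. \<Prod>i<h. min (P.L (s i) \<omega>) (P.L (t i) \<omega>))"
        using st by (intro P.all_moments_prod all_moments_min P.L_all_moments) auto
      then show "(\<lambda>\<omega>. \<Prod>i<h. min (P.L (s i) \<omega>) (P.L (t i) \<omega>)) \<in> borel_measurable P" by (rule all_moments_measurable)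
    qed
    finally show ?thesis .
  qed
  define C where "C = (\<Sum>i<h. (P.expectation (P.L (s i)) + W) + (P.expectation (P.L (t i)) + W))"
  have diff: "\<bar>expectation (?A n) - expectation (?B n)\<bar> \<le> C * ?\<epsilon> n" if n: "1 \<le> n" for n
  proof -
    have le: "\<bar>?A n \<omega> - ?B n \<omega>\<bar> \<le> (\<Sum>i<h. R n \<omega> ^ h * \<bar>k (s i) n \<omega> - l (s i) n \<omega>\<bar> + R n \<omega> ^ h * \<bar>k (t i) n \<omega> - l (t i) n \<omega>\<bar>)" for \<omega>
    proof -
      have "\<bar>?A n \<omega> - ?B n \<omega>\<bar> \<le> R n \<omega> ^ h * (\<Sum>i<h. \<bar>min (k (s i) n \<omega>) (k (t i) n \<omega>) - min (l (s i) n \<omega>) (l (t i) n \<omega>)\<bar>)"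
      proof (rule abs_prod_diff_le[OF _ _ R1])
        fix i assume i: "i < h"
        have nn: "0 \<le> k (s i) n \<omega>" "0 \<le> k (t i) n \<omega>" "0 \<le> l (s i) n \<omega>" "0 \<le> l (t i) n \<omega>"
          using k0 l0 st[OF i] by auto
        show "\<bar>min (k (s i) n \<omega>) (k (t i) n \<omega>)\<bar> \<le> R n \<omega>" "\<bar>min (l (s i) n \<omega>) (l (t i) n \<omega>)\<bar> \<le> R n \<omega>"
          using nn Rge[OF i, of n \<omega>] by (auto simp: min_def)
      qed
      also have "\<dots> \<le> R n \<omega> ^ h * (\<Sum>i<h. \<bar>k (s i) n \<omega> - l (s i) n \<omega>\<bar> + \<bar>k (t i) n \<omega> - l (t i) n \<omega>\<bar>)"
        using R1[of n \<omega>] by (intro mult_left_mono sum_mono) (auto simp: min_def)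
      finally show ?thesis by (simp add: sum_distrib_left distrib_left)
    qed
    have st1: "0 \<le> s i" "0 \<le> t i" if "i < h" for i using st[OF that] by auto
    have ii: "integrable M (\<lambda>\<omega>. R n \<omega> ^ h * \<bar>k (s i) n \<omega> - l (s i) n \<omega>\<bar> + R n \<omega> ^ h * \<bar>k (t i) n \<omega> - l (t i) n \<omega>\<bar>)" if "i < h" for i
      by (intro Bochner_Integration.integrable_add err(1) st1 that n)
    have iA: "integrable M (?A n)" and iB: "integrable M (?B n)" by (rule all_moments_integrable, rule Am, rule all_moments_integrable, rule Bm)
    have "\<bar>expectation (?A n) - expectation (?B n)\<bar> = \<bar>expectation (\<lambda>\<omega>. ?A n \<omega> - ?B n \<omega>)\<bar>"
      using iA iB by simp
    also have "\<dots> \<le> expectation (\<lambda>\<omega>. \<bar>?A n \<omega> - ?B n \<omega>\<bar>)" by (rule integral_abs_bound)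
    also have "\<dots> \<le> expectation (\<lambda>\<omega>. \<Sum>i<h. R n \<omega> ^ h * \<bar>k (s i) n \<omega> - l (s i) n \<omega>\<bar> + R n \<omega> ^ h * \<bar>k (t i) n \<omega> - l (t i) n \<omega>\<bar>)"
      by (rule integral_mono[OF integrable_abs[OF Bochner_Integration.integrable_diff[OF iA iB]] Bochner_Integration.integrable_sum le]) (rule ii, simp)
    also have "\<dots> = (\<Sum>i<h. expectation (\<lambda>\<omega>. R n \<omega> ^ h * \<bar>k (s i) n \<omega> - l (s i) n \<omega>\<bar>) + expectation (\<lambda>\<omega>. R n \<omega> ^ h * \<bar>k (t i) n \<omega> - l (t i) n \<omega>\<bar>))"
    proof (subst Bochner_Integration.integral_sum)
      show "integrable M (\<lambda>\<omega>. R n \<omega> ^ h * \<bar>k (s i) n \<omega> - l (s i) n \<omega>\<bar> + R n \<omega> ^ h * \<bar>k (t i) n \<omega> - l (t i) n \<omega>\<bar>)" if "i \<in> {..<h}" for i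
        using ii that by simp
      show "(\<Sum>i<h. expectation (\<lambda>\<omega>. R n \<omega> ^ h * \<bar>k (s i) n \<omega> - l (s i) n \<omega>\<bar> + R n \<omega> ^ h * \<bar>k (t i) n \<omega> - l (t i) n \<omega>\<bar>))
        = (\<Sum>i<h. expectation (\<lambda>\<omega>. R n \<omega> ^ h * \<bar>k (s i) n \<omega> - l (s i) n \<omega>\<bar>) + expectation (\<lambda>\<omega>. R n \<omega> ^ h * \<bar>k (t i) n \<omega> - l (t i) n \<omega>\<bar>))"
        by (intro sum.cong[OF refl] Bochner_Integration.integral_add err(1) st1 n) auto
    qed
    also have "\<dots> \<le> (\<Sum>i<h. ?\<epsilon> n * (P.expectation (P.L (s i)) + W) + ?\<epsilon> n * (P.expectation (P.L (t i)) + W))"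
      by (intro sum_mono add_mono err(2) st1 n) auto
    also have "\<dots> = C * ?\<epsilon> n" unfolding C_def sum_distrib_right by (intro sum.cong refl) (simp add: algebra_simps)
    finally show ?thesis .
  qed
  have "(\<lambda>n. C * ?\<epsilon> n) \<longlonglongrightarrow> C * 0"
    using \<alpha>0 by (intro tendsto_mult tendsto_const tendsto_neg_powr filterlim_real_sequentially) auto
  then have "(\<lambda>n. expectation (?A n) - expectation (?B n)) \<longlonglongrightarrow> 0"
    by (intro Lim_null_comparison[of "\<lambda>n. expectation (?A n) - expectation (?B n)" "\<lambda>n. C * ?\<epsilon> n"])
      (use diff in \<open>auto intro!: eventually_sequentiallyI[of 1]\<close>)
  then have "(\<lambda>n. (expectation (?A n) - expectation (?B n)) + P.expectation (\<lambda>\<omega>. \<Prod>i<h. min (P.L (s i) \<omega>) (P.L (t i) \<omega>)))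
      \<longlonglongrightarrow> 0 + P.expectation (\<lambda>\<omega>. \<Prod>i<h. min (P.L (s i) \<omega>) (P.L (t i) \<omega>))"
    by (intro tendsto_add tendsto_const)
  then have "(\<lambda>n. expectation (?A n)) \<longlonglongrightarrow> 0 + P.expectation (\<lambda>\<omega>. \<Prod>i<h. min (P.L (s i) \<omega>) (P.L (t i) \<omega>))"
    by (rule Lim_transform_eventually) (use EB in \<open>auto intro!: eventually_sequentiallyI[of 1]\<close>)
  then show ?thesis unfolding EA by simp
qed

end

section \<open>The circulant limit theorem\<close>

text \<open>Uniform bounds are given from order three on; lower orders follow from
  \<open>x ^ l \<le> 1 + x ^ 3\<close>. The suprema are taken over integrals with values in
  \<open>ennreal\<close>, so finiteness already contains integrability.\<close>

lemma bounded_array_exists: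
  assumes M: "prob_space M"
    and indep: "prob_space.indep_vars M (\<lambda>_. borel) (\<lambda>(i, k). X i k) (UNIV \<times> {1..})"
    and mean: "\<And>i k. 1 \<le> k \<Longrightarrow> prob_space.expectation M (X i k) = 0"
    and var: "\<And>i k. 1 \<le> k \<Longrightarrow> prob_space.variance M (X i k) = 1"
    and moments: "\<And>l::nat. 3 \<le> l \<Longrightarrow>
          (SUP (i, k)\<in>UNIV \<times> {1..}. \<integral>\<^sup>+\<omega>. ennreal (\<bar>X i k \<omega>\<bar> ^ l) \<partial>M) < \<infinity>"
  shows "\<exists>D. bounded_array M X D"
proof -
  interpret prob_space M by fact
  define S where "S l = (SUP (i, k)\<in>UNIV \<times> {1..}. \<integral>\<^sup>+\<omega>. ennreal (\<bar>X i k \<omega>\<bar> ^ l) \<partial>M)" for l :: nat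
  define D where "D l = (if 3 \<le> l then enn2real (S l) else 1 + enn2real (S 3))" for l
  have Xm: "X i k \<in> borel_measurable M" if "1 \<le> k" for i k
    using indep that unfolding indep_vars_def2 by force
  have big: "integrable M (\<lambda>\<omega>. \<bar>X i k \<omega>\<bar> ^ l)" "expectation (\<lambda>\<omega>. \<bar>X i k \<omega>\<bar> ^ l) \<le> enn2real (S l)"
    if k: "1 \<le> k" and l: "3 \<le> l" for i k l
  proof -
    have fin: "S l < \<infinity>" unfolding S_def by (rule moments[OF l])
    have le: "(\<integral>\<^sup>+\<omega>. ennreal (\<bar>X i k \<omega>\<bar> ^ l) \<partial>M) \<le> S l"
      unfolding S_def by (rule SUP_upper2[of "(i, k)"]) (use k in auto)
    have m: "(\<lambda>\<omega>. \<bar>X i k \<omega>\<bar> ^ l) \<in> borel_measurable M" using Xm[OF k, of i] by measurable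
    show i: "integrable M (\<lambda>\<omega>. \<bar>X i k \<omega>\<bar> ^ l)"
      using m le fin by (intro integrableI_bounded) auto
    have "ennreal (expectation (\<lambda>\<omega>. \<bar>X i k \<omega>\<bar> ^ l)) \<le> S l"
      using le nn_integral_eq_integral[OF i] by simp
    also have "S l = ennreal (enn2real (S l))" using fin by simp
    finally show "expectation (\<lambda>\<omega>. \<bar>X i k \<omega>\<bar> ^ l) \<le> enn2real (S l)" by (simp add: ennreal_le_iff)
  qed
  have small: "integrable M (\<lambda>\<omega>. \<bar>X i k \<omega>\<bar> ^ l)" "expectation (\<lambda>\<omega>. \<bar>X i k \<omega>\<bar> ^ l) \<le> 1 + enn2real (S 3)"
    if k: "1 \<le> k" and l: "l < 3" for i k l
  proof -
    have le: "x ^ l \<le> 1 + x ^ 3" if x: "0 \<le> x" for x :: real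
    proof (cases "x \<le> 1")
      case True
      then have "x ^ l \<le> 1" using x by (intro power_le_one)
      then show ?thesis using x by (simp add: add_increasing2)
    next
      case False
      then have "x ^ l \<le> x ^ 3" using l by (intro power_increasing) auto
      then show ?thesis by simp
    qed
    have i3: "integrable M (\<lambda>\<omega>. 1 + \<bar>X i k \<omega>\<bar> ^ 3)" using big(1)[OF k, of 3 i] by simp
    have m: "(\<lambda>\<omega>. \<bar>X i k \<omega>\<bar> ^ l) \<in> borel_measurable M" using Xm[OF k, of i] by measurable
    show i: "integrable M (\<lambda>\<omega>. \<bar>X i k \<omega>\<bar> ^ l)"
      by (rule Bochner_Integration.integrable_bound[OF i3 m]) (use le in \<open>auto intro!: AE_I2\<close>)
    have "expectation (\<lambda>\<omega>. \<bar>X i k \<omega>\<bar> ^ l) \<le> expectation (\<lambda>\<omega>. 1 + \<bar>X i k \<omega>\<bar> ^ 3)"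
      by (rule integral_mono[OF i i3]) (rule le, simp)
    also have "\<dots> = 1 + expectation (\<lambda>\<omega>. \<bar>X i k \<omega>\<bar> ^ 3)" using big(1)[OF k, of 3 i] by (simp add: prob_space)
    also have "\<dots> \<le> 1 + enn2real (S 3)" using big(2)[OF k, of 3 i] by simp
    finally show "expectation (\<lambda>\<omega>. \<bar>X i k \<omega>\<bar> ^ l) \<le> 1 + enn2real (S 3)" .
  qed
  have "bounded_array M X D"
  proof (unfold_locales)
    show "indep_vars (\<lambda>_. borel) (\<lambda>(i, k). X i k) (UNIV \<times> {1..})" by fact
    fix i k :: nat assume k: "1 \<le> k"
    show "all_moments M (X i k)"
      unfolding all_moments_def
    proof (intro conjI allI)
      show "integrable M (\<lambda>\<omega>. norm (X i k \<omega>) ^ p)" for p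
        using big(1)[OF k, of p i] small(1)[OF k, of p i] by (cases "3 \<le> p") auto
    qed (rule Xm[OF k])
    show "expectation (X i k) = 0" by (rule mean[OF k])
    show "expectation (\<lambda>\<omega>. X i k \<omega> ^ 2) = 1" using var[OF k, of i] mean[OF k, of i] by simp
    show "expectation (\<lambda>\<omega>. \<bar>X i k \<omega>\<bar> ^ j) \<le> D j" for j
      using big(2)[OF k, of j i] small(2)[OF k, of j i] by (cases "3 \<le> j") (auto simp: D_def)
  qed
  then show ?thesis by blast
qed

text \<open>A process that does not depend on the sample point generates the trivial sigma-algebra.
  This lets a deterministic clock enter where an independent one is required.\<close>

lemma (in prob_space) independent_processes_const:
  assumes "\<And>i. i \<in> I \<Longrightarrow> Y i \<in> borel_measurable M"
  shows "independent_processes M I Y J (\<lambda>j _. c j)"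
  unfolding independent_processes_def
proof (rule indep_setI)
  show A: "process_algebra M I Y \<subseteq> events"
    by (rule process_algebra_least[OF refl assms])
  let ?T = "sigma (space M) {}"
  have "process_algebra M J (\<lambda>j _. c j) \<subseteq> sets ?T"
    by (rule process_algebra_least) auto
  then have T: "process_algebra M J (\<lambda>j _. c j) \<subseteq> {{}, space M}"
    by (simp add: sigma_sets_empty_eq)
  then show "process_algebra M J (\<lambda>j _. c j) \<subseteq> events" by auto
  fix a b assume a: "a \<in> process_algebra M I Y" and b: "b \<in> process_algebra M J (\<lambda>j _. c j)"
  have "a \<subseteq> space M" using A a sets.sets_into_space by blast
  then have "a \<inter> space M = a" by blast
  then show "prob (a \<inter> b) = prob a * prob b" using b T by (auto simp: prob_space)
qed

lemma floor_scaling_limit: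
  assumes "0 \<le> s"
  shows "(\<lambda>n. real (nat \<lfloor>real n * s\<rfloor>) / real n) \<longlonglongrightarrow> s"
proof (rule tendsto_sandwich)
  have f: "real (nat \<lfloor>real n * s\<rfloor>) = of_int \<lfloor>real n * s\<rfloor>" for n using assms by simp
  show "\<forall>\<^sub>F n in sequentially. s - 1 / real n \<le> real (nat \<lfloor>real n * s\<rfloor>) / real n"
  proof (rule eventually_sequentiallyI[of 1])
    fix n :: nat assume n: "1 \<le> n"
    have "real n * s - 1 \<le> of_int \<lfloor>real n * s\<rfloor>" by linarith
    then have "(real n * s - 1) / real n \<le> of_int \<lfloor>real n * s\<rfloor> / real n" by (rule divide_right_mono) simp
    then show "s - 1 / real n \<le> real (nat \<lfloor>real n * s\<rfloor>) / real n" using n unfolding f by (simp add: diff_divide_distrib)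
  qed
  show "\<forall>\<^sub>F n in sequentially. real (nat \<lfloor>real n * s\<rfloor>) / real n \<le> s"
  proof (rule eventually_sequentiallyI[of 1])
    fix n :: nat assume n: "1 \<le> n"
    have "of_int \<lfloor>real n * s\<rfloor> / real n \<le> (real n * s) / real n" by (rule divide_right_mono) auto
    then show "real (nat \<lfloor>real n * s\<rfloor>) / real n \<le> s" using n unfolding f by simp
  qed
  show "(\<lambda>n. s - 1 / real n) \<longlonglongrightarrow> s"
    using tendsto_diff[OF tendsto_const lim_1_over_n, of s] by simp
qed simp

text \<open>The limit has its own space \<open>P\<close> and its own subordinator \<open>G\<close>:
  only laws are compared, and no coupling with \<open>H\<close> is involved.\<close>

theorem theorem5p1:
  fixes \<alpha> :: real
    and M :: "'a measure" and X :: "nat \<Rightarrow> nat \<Rightarrow> 'a \<Rightarrow> real"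
    and N :: "real \<Rightarrow> 'a \<Rightarrow> nat" and H :: "real \<Rightarrow> 'a \<Rightarrow> real"
    and P :: "'b measure" and B\<^sub>1 B\<^sub>2 G :: "real \<Rightarrow> 'b \<Rightarrow> real"
  defines "N\<alpha> \<equiv> time_change N (inverse_stable \<alpha> H)"
    and "CBM \<equiv> complex_bm B\<^sub>1 B\<^sub>2"
  assumes \<alpha>: "0 < \<alpha>" "\<alpha> \<le> 1"
    and M: "prob_space M"
    and X_indep: "prob_space.indep_vars M (\<lambda>_. borel) (\<lambda>(i, k). X i k) (UNIV \<times> {1..})"
    and X_mean: "\<And>i k. 1 \<le> k \<Longrightarrow> prob_space.expectation M (X i k) = 0"
    and X_var: "\<And>i k. 1 \<le> k \<Longrightarrow> prob_space.variance M (X i k) = 1"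
    and X_moments: "\<And>l::nat. 3 \<le> l \<Longrightarrow>
          (SUP (i, k)\<in>UNIV \<times> {1..}. \<integral>\<^sup>+\<omega>. ennreal (\<bar>X i k \<omega>\<bar> ^ l) \<partial>M) < \<infinity>"
    and H: "\<alpha> < 1 \<Longrightarrow> stable_subordinator M \<alpha> H"
    and N: "poisson_process M 1 N"
    and N_indep: "independent_processes M {0..} N {0..} (inverse_stable \<alpha> H)"
    and XN_indep: "independent_processes M (UNIV \<times> {1..}) (\<lambda>(i, k). X i k) {0..} N\<alpha>"
    and P: "prob_space P"
    and B\<^sub>1: "brownian_motion P B\<^sub>1"
    and B\<^sub>2: "brownian_motion P B\<^sub>2"
    and B_indep: "independent_processes P {0..} B\<^sub>1 {0..} B\<^sub>2"
    and G: "\<alpha> < 1 \<Longrightarrow> stable_subordinator P \<alpha> G"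
    and G_indep: "independent_processes P {0..} CBM {0..} (inverse_stable \<alpha> G)"
  shows "converges_star_distribution M
           (\<lambda>n t \<omega>. (1 / real n) \<cdot>\<^sub>m circulant_walk X n t \<omega>) P CBM
       \<and> converges_star_distribution M
           (\<lambda>n t \<omega>. (real n powr (- (1 + \<alpha>) / 2)) \<cdot>\<^sub>m circulant_counting_walk X N\<alpha> n t \<omega>) P
           (time_change CBM (inverse_stable \<alpha> G))"
proof -
  obtain D where D: "bounded_array M X D"
    using bounded_array_exists[OF M X_indep X_mean X_var X_moments] by blast
  interpret bounded_array M X D by (rule D)
  have CB: "complex_brownian P B\<^sub>1 B\<^sub>2"
    by (intro complex_brownian.intro complex_brownian_axioms.intro P B\<^sub>1 B\<^sub>2 B_indep)
  interpret P: complex_brownian P B\<^sub>1 B\<^sub>2 by (rule CB)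
  have SM: "stable_process M \<alpha> H"
    by (intro stable_process.intro stable_process_axioms.intro M \<alpha> H)
  have SP: "stable_process P \<alpha> G"
    by (intro stable_process.intro stable_process_axioms.intro P \<alpha> G)
  have FP: "fractional_poisson M \<alpha> H N"
    by (intro fractional_poisson.intro fractional_poisson_axioms.intro SM N N_indep)
  interpret FP: fractional_poisson M \<alpha> H N by (rule FP)
  interpret SP: stable_process P \<alpha> G by (rule SP)
  \<comment> \<open>The deterministic case is the clock \<open>nat \<lfloor>t\<rfloor>\<close>,
    evaluated at \<open>real n * t\<close>, with exponent \<open>1\<close> and limiting clock
    \<open>t\<close>.\<close>
  have W1: "walk_limit M X D P B\<^sub>1 B\<^sub>2 1 (\<lambda>t _. nat \<lfloor>t\<rfloor>) (\<lambda>t _. t)"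
  proof (intro walk_limit.intro walk_limit_axioms.intro D CB)
    show "independent_processes M (UNIV \<times> {1..}) (\<lambda>(i, k). X i k) {0..} (\<lambda>t _. nat \<lfloor>t\<rfloor>)"
      by (rule independent_processes_const) (use moments_X in \<open>auto intro: all_moments_measurable\<close>)
    show "independent_processes P {0..} (complex_bm B\<^sub>1 B\<^sub>2) {0..} (\<lambda>t _. t)"
      by (rule P.independent_processes_const) (simp add: P.complex_bm_measurable)
    fix h and s t :: "nat \<Rightarrow> real" assume st: "\<And>i. i < h \<Longrightarrow> 0 \<le> s i \<and> 0 \<le> t i"
    have "(\<lambda>n. \<Prod>i<h. min (real (nat \<lfloor>real n * s i\<rfloor>) / real n) (real (nat \<lfloor>real n * t i\<rfloor>) / real n))
        \<longlonglongrightarrow> (\<Prod>i<h. min (s i) (t i))"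
      using st by (intro tendsto_prod tendsto_min floor_scaling_limit) auto
    moreover have "min x y / real n powr 1 = min (x / real n) (y / real n)" for x y n
      by (cases "n = 0") (auto simp: min_def divide_le_cancel)
    ultimately show "(\<lambda>n. expectation (\<lambda>\<omega>. \<Prod>i<h. min (real (nat \<lfloor>real n * s i\<rfloor>)) (real (nat \<lfloor>real n * t i\<rfloor>)) / real n powr 1))
        \<longlonglongrightarrow> P.expectation (\<lambda>\<omega>. \<Prod>i<h. min (s i) (t i))"
      by (simp add: prob_space P.prob_space)
  qed (auto intro: all_moments_const P.all_moments_const)
  interpret W1: walk_limit M X D P B\<^sub>1 B\<^sub>2 1 "\<lambda>t _. nat \<lfloor>t\<rfloor>" "\<lambda>t _. t" by (rule W1)
  \<comment> \<open>This holds also at \<open>n = 0\<close>, where both sides are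
    \<open>0\<close>.\<close>
  have "W1.scaling n = 1 / real n" for n
    unfolding W1.scaling_def by (cases "n = 0") (simp_all add: powr_minus_divide)
  then have 1: "converges_star_distribution M (\<lambda>n t \<omega>. (1 / real n) \<cdot>\<^sub>m circulant_walk X n t \<omega>) P CBM"
    using W1.converges_star_distribution_walk
    by (simp add: CBM_def time_change_def[abs_def] circulant_walk_def[abs_def] circulant_counting_walk_def[abs_def])
  have W2: "walk_limit M X D P B\<^sub>1 B\<^sub>2 \<alpha> N\<alpha> (inverse_stable \<alpha> G)"
  proof (intro walk_limit.intro walk_limit_axioms.intro D CB)
    show "0 \<le> \<alpha>" using \<alpha> by simp
    show "independent_processes M (UNIV \<times> {1..}) (\<lambda>(i, k). X i k) {0..} N\<alpha>" by (rule XN_indep)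
    show "independent_processes P {0..} (complex_bm B\<^sub>1 B\<^sub>2) {0..} (inverse_stable \<alpha> G)"
      using G_indep unfolding CBM_def .
    show "all_moments M (\<lambda>\<omega>. real (N\<alpha> t \<omega>))" "N\<alpha> t \<in> borel_measurable M" if "0 \<le> t" for t
      unfolding N\<alpha>_def by (rule FP.K_all_moments[OF that], rule FP.K_measurable(1)[OF that])
    show "all_moments P (inverse_stable \<alpha> G t)" if "0 \<le> t" for t by (rule SP.L_all_moments[OF that])
    show "0 \<le> inverse_stable \<alpha> G t \<omega>" if "0 \<le> t" for t \<omega> by (rule SP.L_nonneg[OF that])
    fix h and s t :: "nat \<Rightarrow> real" assume st: "\<And>i. i < h \<Longrightarrow> 0 \<le> s i \<and> 0 \<le> t i"
    show "(\<lambda>n. expectation (\<lambda>\<omega>. \<Prod>i<h. min (real (N\<alpha> (real n * s i) \<omega>)) (real (N\<alpha> (real n * t i) \<omega>)) / real n powr \<alpha>))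
        \<longlonglongrightarrow> P.expectation (\<lambda>\<omega>. \<Prod>i<h. min (inverse_stable \<alpha> G (s i) \<omega>) (inverse_stable \<alpha> G (t i) \<omega>))"
      unfolding N\<alpha>_def by (rule FP.counting_limit[OF SP st])
  qed
  interpret W2: walk_limit M X D P B\<^sub>1 B\<^sub>2 \<alpha> N\<alpha> "inverse_stable \<alpha> G" by (rule W2)
  show ?thesis
    using 1 W2.converges_star_distribution_walk unfolding W2.scaling_def CBM_def by blast
qed

end
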